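(* Consider the non-hierarchical $g$-prior model $P_M$ with known constants $g\equiv g_n$ and prior means $\gamma_n\in\mathbb{R}^{p_n}$, and true parameters $\{(\beta_{0n},\sigma_0^2),n\ge1\}$, as described in the context. Posterior consistency under the $\ell_\infty$ norm occurs, i.e. $P_M(\|\beta_n-\beta_{0n}\|_\infty>\epsilon\mid\hat\beta_n,S_n)\to0$ almost surely under $P_0$ for every $\epsilon>0$, if and only if both $$\frac{\|\gamma_n-\beta_{0n}\|_\infty}{g_n+1}\to0\qquad\text{and}\qquad \frac{g_n\,\log p_n}{(g_n+1)^{2}\,n}\,\|\gamma_n-\beta_{0n}\|_2^2\to0.$$
   Context: Linear model: for each $n\ge1$, $Y_n=X_n\beta_n+e_n$, where $X_n$ is a nonrandom $n\times p_n$ matrix of full column rank, $\beta_n\in\mathbb{R}^{p_n}$, and $e_n\sim N_n(0,\sigma^2 I_n)$. The sequence $p_n$ is nondecreasing with $p_n<n$ and $p_n/n\to\alpha$, where $0\le\alpha<1$. The eigenvalues $\lambda_{n,1},\dots,\lambda_{n,p_n}$ of $n(X_n^TX_n)^{-1}$ satisfy $0<\lambda_{\min}\le\inf_{n,i}\lambda_{n,i}\le\sup_{n,i}\lambda_{n,i}\le\lambda_{\max}<\infty$ for some constants $\lambda_{\min},\lambda_{\max}$. Let $\hat\beta_n=(X_n^TX_n)^{-1}X_n^TY_n$ and $S_n=\|Y_n-X_n\hat\beta_n\|_2^2$; given $(\beta_n,\sigma^2)$ these are independent with $\hat\beta_n\sim N_{p_n}(\beta_n,\sigma^2(X_n^TX_n)^{-1})$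 and $S_n\sim\sigma^2\chi^2_{n-p_n}$. Norms: $\|x\|_\infty=\max_i|x_i|$, $\|x\|_2=(\sum_i x_i^2)^{1/2}$. Non-hierarchical $g$-prior model $P_M$: given $(\beta_n,\sigma^2)$, the data $\hat\beta_n$ and $S_n$ are independent with $\hat\beta_n\sim N_{p_n}(\beta_n,\sigma^2(X_n^TX_n)^{-1})$ and $S_n\sim\sigma^2\chi^2_{n-p_n}$, with priors $\beta_n\mid\sigma^2\sim N_{p_n}(\gamma_n,g_n\sigma^2(X_n^TX_n)^{-1})$ and $\sigma^2\sim\mathrm{InverseGamma}(a/2,b/2)$ (density proportional to $(\sigma^2)^{-a/2-1}e^{-b/(2\sigma^2)}$), with $a\ge-2$, $b\ge0$ constants (improper priors are allowed, the posterior being defined by Bayes' formula; asymptotic statements concern $n$ large enough that it is proper). Here $\gamma_n\in\mathbb{R}^{p_n}$ and $g_n>0$ are known nonrandom sequences. True distribution $P_0$: $\beta_{0n}\in\mathbb{R}^{p_n}$ ($n\ge1$) and $\sigma_0^2>0$ are fixed, and $P_0$ is the distribution of $\{(\hat\beta_n,S_n),n\ge1\}$ under $Y_n=X_n\beta_{0n}+e_n$, $e_n\sim N_n(0,\sigma_0^2I_n)$, for each $n\ge1$.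
   Formalization: The case p_n = 1 for all large n is excluded: there log p_n = 0 makes the second condition vacuous and the equivalence fails (e.g. X_n a column of ones, β_0n = 0, σ_0² = 1, g_n = n², γ_n = n^{3/2}). *)

theory Defs
  imports
    "HOL-Probability.Probability"
    "Jordan_Normal_Form.DL_Rank"
    "Jordan_Normal_Form.Char_Poly"
    "Jordan_Normal_Form.Gauss_Jordan_Elimination"
begin

(* Vectors and matrices are those of Jordan_Normal_Form.Matrix, since their dimensions vary with n.
   HOL-Analysis declares several of the same names, hence the qualified Matrix.vec etc. *)

definition inv_mat :: "real Matrix.mat \<Rightarrow> real Matrix.mat" where
  "inv_mat A = the (mat_inverse A)"

definition gram_inv :: "real Matrix.mat \<Rightarrow> real Matrix.mat" where
  "gram_inv X = inv_mat (transpose_mat X * X)"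

(* The inserted 0 only matters for the vector of dimension 0, whose norm is 0. *)
definition linf_norm :: "real Matrix.vec \<Rightarrow> real" where
  "linf_norm x = Max (insert 0 {\<bar>vec_index x i\<bar> | i. i < dim_vec x})"

definition l2_norm :: "real Matrix.vec \<Rightarrow> real" where
  "l2_norm x = sqrt (\<Sum>i<dim_vec x. (vec_index x i)\<^sup>2)"

definition ols :: "real Matrix.mat \<Rightarrow> real Matrix.vec \<Rightarrow> real Matrix.vec" where
  "ols X Y = gram_inv X *\<^sub>v (transpose_mat X *\<^sub>v Y)"

definition rss :: "real Matrix.mat \<Rightarrow> real Matrix.vec \<Rightarrow> real" where
  "rss X Y = (l2_norm (Y - X *\<^sub>v ols X Y))\<^sup>2"

definition mvn_density ::
  "real Matrix.vec \<Rightarrow> real Matrix.mat \<Rightarrow> real Matrix.vec \<Rightarrow> real" where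
  "mvn_density \<mu> \<Sigma> x =
     exp (- (scalar_prod (x - \<mu>) (inv_mat \<Sigma> *\<^sub>v (x - \<mu>))) / 2)
       / sqrt ((2 * pi) ^ dim_vec x * Determinant.det \<Sigma>)"

definition chi_square_density :: "nat \<Rightarrow> real \<Rightarrow> real" where
  "chi_square_density k x =
     (if x > 0
      then x powr (real k / 2 - 1) * exp (- x / 2) / (2 powr (real k / 2) * Gamma (real k / 2))
      else 0)"

(* Density of c times a chi-square variable with k degrees of freedom, for c > 0. *)
definition scaled_chi_square_density :: "real \<Rightarrow> nat \<Rightarrow> real \<Rightarrow> real" where
  "scaled_chi_square_density c k x = chi_square_density k (x / c) / c"

(* Unnormalised InverseGamma(a/2, b/2) density: the normalising constant cancels in Bayes' formula,
   and it does not exist when the prior is improper (a <= 0 or b = 0). *)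
definition inverse_gamma_kernel :: "real \<Rightarrow> real \<Rightarrow> real \<Rightarrow> real" where
  "inverse_gamma_kernel a b v =
     (if v > 0 then v powr (- a / 2 - 1) * exp (- b / (2 * v)) else 0)"

(* Likelihood of the data (bhat, S) times the prior, at (beta, sigma^2) = (\<beta>, v). *)
definition g_prior_joint ::
  "real Matrix.mat \<Rightarrow> real Matrix.vec \<Rightarrow> real \<Rightarrow> real \<Rightarrow> real \<Rightarrow> real Matrix.vec \<Rightarrow> real
    \<Rightarrow> real Matrix.vec \<Rightarrow> real \<Rightarrow> real" where
  "g_prior_joint X \<gamma> g a b bhat S \<beta> v =
     (if v > 0 then
        mvn_density \<beta> (v \<cdot>\<^sub>m gram_inv X) bhat
        * scaled_chi_square_density v (dim_row X - dim_col X) S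
        * mvn_density \<gamma> ((g * v) \<cdot>\<^sub>m gram_inv X) \<beta>
        * inverse_gamma_kernel a b v
      else 0)"

(* Lebesgue measure on R^p x R, the space of (beta, sigma^2); R^p is carried by nat => real. *)
abbreviation param_measure :: "nat \<Rightarrow> ((nat \<Rightarrow> real) \<times> real) measure" where
  "param_measure p \<equiv> (\<Pi>\<^sub>M i\<in>{..<p}. lborel) \<Otimes>\<^sub>M lborel"

definition g_prior_evidence ::
  "real Matrix.mat \<Rightarrow> real Matrix.vec \<Rightarrow> real \<Rightarrow> real \<Rightarrow> real \<Rightarrow> real Matrix.vec \<Rightarrow> real
    \<Rightarrow> ennreal" where
  "g_prior_evidence X \<gamma> g a b bhat S =
     (\<integral>\<^sup>+ (\<beta>, v). ennreal (g_prior_joint X \<gamma> g a b bhat S (Matrix.vec (dim_col X) \<beta>) v)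
        \<partial>param_measure (dim_col X))"

(* The posterior law of (beta, sigma^2) given (bhat, S), by Bayes' formula. It is a probability
   measure exactly when the evidence is positive and finite, i.e. when the posterior is proper. *)
definition g_prior_posterior ::
  "real Matrix.mat \<Rightarrow> real Matrix.vec \<Rightarrow> real \<Rightarrow> real \<Rightarrow> real \<Rightarrow> real Matrix.vec \<Rightarrow> real
    \<Rightarrow> ((nat \<Rightarrow> real) \<times> real) measure" where
  "g_prior_posterior X \<gamma> g a b bhat S =
     density (param_measure (dim_col X))
       (\<lambda>(\<beta>, v). ennreal (g_prior_joint X \<gamma> g a b bhat S (Matrix.vec (dim_col X) \<beta>) v)
                 / g_prior_evidence X \<gamma> g a b bhat S)"

(* P_M(||beta - beta_0||_inf > eps | bhat, S) *)
definition posterior_linf_prob ::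
  "real Matrix.mat \<Rightarrow> real Matrix.vec \<Rightarrow> real \<Rightarrow> real \<Rightarrow> real \<Rightarrow> real Matrix.vec \<Rightarrow> real
    \<Rightarrow> real Matrix.vec \<Rightarrow> real \<Rightarrow> real" where
  "posterior_linf_prob X \<gamma> g a b bhat S \<beta>\<^sub>0 \<epsilon> =
     measure (g_prior_posterior X \<gamma> g a b bhat S)
       {(\<beta>, v) \<in> space (param_measure (dim_col X)).
          linf_norm (Matrix.vec (dim_col X) \<beta> - \<beta>\<^sub>0) > \<epsilon>}"

end

theory Submission
  imports Defs "HOL-Real_Asymp.Real_Asymp"
begin

text \<open>
  Write \<open>A = X\<^sup>T X\<close> and \<open>q(x) = x\<^sup>T A x\<close>, and let \<open>u\<close> be the least squares estimate. Given \<open>\<sigma>\<^sup>2 = v\<close>, the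
  posterior of \<open>\<beta>\<close> is Gaussian with mean \<open>m = (\<gamma> + g u)/(g + 1)\<close> and covariance \<open>v g/(g + 1) A\<^sup>-\<^sup>1\<close>, and \<open>\<sigma>\<^sup>2\<close>
  is inverse gamma with shape \<open>(n + a)/2\<close> and scale \<open>B/2\<close>, where \<open>B = b + S + q(u - \<gamma>)/(g + 1)\<close>; up to
  exponentially small mass it lies between \<open>B/(4(n + a))\<close> and \<open>2B/(n + a)\<close>. Put \<open>\<tau> = g B/((g + 1) n\<^sup>2)\<close>.
  Up to that mass the posterior leaves the \<open>\<epsilon>\<close>-box around \<open>m\<close> with probability at most
  \<open>2 p exp(- c \<epsilon>\<^sup>2/\<tau>)\<close>, and it stays in an \<open>\<epsilon>\<close>-box around any given point with probability at most
  \<open>exp(- c p exp(- C \<epsilon>\<^sup>2/\<tau>))\<close>. So consistency forces \<open>\<tau> log p \<rightarrow> 0\<close>, and under \<open>\<tau> log p \<rightarrow> 0\<close> it means that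
  \<open>m - \<beta>\<^sub>0 \<rightarrow> 0\<close> in the maximum norm. The noise enters \<open>m\<close> and \<open>\<tau> log p\<close> only through terms that
  vanish almost surely by Borel--Cantelli; what remains of the two quantities are the two stated
  conditions, up to constant factors.
\<close>

section \<open>Lebesgue measure on coordinate functions and quadratic forms\<close>

text \<open>The coordinates of \<beta> are correlated under a general design, so the mass of a box
  is no product. Conditioning on one coordinate at a time replaces independence: given all others, a
  coordinate has variance \<open>w / A k k\<close>, and the diagonal of the Gram matrix is at most
  \<open>n / lmin\<close>. The centre of the box stays arbitrary. This matters because consistency
  must be inverted before anything is known about the posterior mean: the box bound yields \<tau>
  log p -> 0 first, and only then does the concentration bound locate the mean.

  Tails are bounded by comparing an integral with a translate or rescaling of itself, relative to
  its total mass. Thresholds for the noise may be crude: errors below n^(1/4) give a squared length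
  of at most n^(3/2), and n^(3/2) log n / n^2 vanishes.

  Dimension 1 is exceptional: there log p = 0 makes the second condition empty, while consistency
  still requires \<tau> -> 0. With g = n^3 and \<gamma> - \<beta>_0 = n^(5/2) both conditions hold
  but \<tau> grows. Hence p is assumed to differ from 1 eventually.\<close>

abbreviation (input) Lb :: "nat set \<Rightarrow> (nat \<Rightarrow> real) measure" where
  "Lb I \<equiv> \<Pi>\<^sub>M i\<in>I. lborel"

interpretation lborel_PiM: product_sigma_finite "\<lambda>_::nat. lborel :: real measure"
  by standard

text \<open>Translations combined with isotropic scalings act coordinatewise, so the change of
  variables can be checked on boxes, factor by factor.\<close>

lemma PiM_lborel_affine:
  fixes t :: "nat \<Rightarrow> real"
  assumes I: "finite I" and c: "c \<noteq> 0"
  shows "Lb I = density (distr (Lb I) (Lb I) (\<lambda>x. \<lambda>i\<in>I. t i + c * x i)) (\<lambda>_. ennreal (\<bar>c\<bar> ^ card I))"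
    (is "_ = density (distr _ _ ?T) _")
proof (rule lborel_PiM.PiM_eqI[OF I, symmetric])
  show "sets (density (distr (Lb I) (Lb I) ?T) (\<lambda>_. ennreal (\<bar>c\<bar> ^ card I))) = sets (Lb I)"
    by simp
next
  fix A :: "nat \<Rightarrow> real set" assume A: "\<And>i. i \<in> I \<Longrightarrow> A i \<in> sets lborel"
  have T: "?T \<in> measurable (Lb I) (Lb I)"
    by (intro measurable_restrict) measurable
  have box: "Pi\<^sub>E I A \<in> sets (Lb I)" using A I by (intro sets_PiM_I_finite) auto
  have vim: "?T -` (Pi\<^sub>E I A) \<inter> space (Lb I) = (\<Pi>\<^sub>E i\<in>I. (\<lambda>x. t i + c * x) -` A i)"
    by (auto simp: space_PiM PiE_iff)
  have m: "(\<lambda>x. t i + c * x) -` A i \<in> sets lborel" if "i \<in> I" for i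
    using measurable_sets[of "\<lambda>x. t i + c * x" borel borel "A i"] A[OF that] by auto
  have one: "ennreal \<bar>c\<bar> * emeasure lborel ((\<lambda>x. t i + c * x) -` A i) = emeasure lborel (A i)" if "i \<in> I" for i
  proof -
    have "emeasure lborel (A i) = emeasure (density (distr lborel borel (\<lambda>x. t i + c * x)) (\<lambda>_. ennreal \<bar>c\<bar>)) (A i)"
      using lborel_real_affine[OF c, of "t i"] by simp
    also have "\<dots> = ennreal \<bar>c\<bar> * emeasure (distr lborel borel (\<lambda>x. t i + c * x)) (A i)"
      using A[OF that] by (simp add: emeasure_density_const)
    also have "\<dots> = ennreal \<bar>c\<bar> * emeasure lborel ((\<lambda>x. t i + c * x) -` A i)"
      using A[OF that] by (subst emeasure_distr) auto
    finally show ?thesis ..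
  qed
  have "emeasure (density (distr (Lb I) (Lb I) ?T) (\<lambda>_. ennreal (\<bar>c\<bar> ^ card I))) (Pi\<^sub>E I A)
      = ennreal (\<bar>c\<bar> ^ card I) * (\<Prod>i\<in>I. emeasure lborel ((\<lambda>x. t i + c * x) -` A i))"
    using box T I m by (simp add: emeasure_density_const emeasure_distr vim lborel_PiM.emeasure_PiM)
  also have "\<dots> = (\<Prod>i\<in>I. ennreal \<bar>c\<bar> * emeasure lborel ((\<lambda>x. t i + c * x) -` A i))"
    by (simp add: prod.distrib prod_constant ennreal_power)
  also have "\<dots> = (\<Prod>i\<in>I. emeasure lborel (A i))"
    by (intro prod.cong refl one)
  finally show "emeasure (density (distr (Lb I) (Lb I) ?T) (\<lambda>_. ennreal (\<bar>c\<bar> ^ card I))) (Pi\<^sub>E I A)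
      = (\<Prod>i\<in>I. emeasure lborel (A i))" .
qed

lemma nn_integral_PiM_lborel_affine:
  fixes t :: "nat \<Rightarrow> real"
  assumes I: "finite I" and c: "c \<noteq> 0" and f[measurable]: "f \<in> borel_measurable (Lb I)"
  shows "(\<integral>\<^sup>+x. f x \<partial>Lb I) = ennreal (\<bar>c\<bar> ^ card I) * (\<integral>\<^sup>+x. f (\<lambda>i\<in>I. t i + c * x i) \<partial>Lb I)"
proof -
  have T: "(\<lambda>x. \<lambda>i\<in>I. t i + c * x i) \<in> measurable (Lb I) (Lb I)"
    by (intro measurable_restrict) measurable
  have "(\<integral>\<^sup>+x. f x \<partial>Lb I) = (\<integral>\<^sup>+x. f x \<partial>density (distr (Lb I) (Lb I) (\<lambda>x. \<lambda>i\<in>I. t i + c * x i)) (\<lambda>_. ennreal (\<bar>c\<bar> ^ card I)))"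
    using PiM_lborel_affine[OF I c, of t] by simp
  also have "\<dots> = ennreal (\<bar>c\<bar> ^ card I) * (\<integral>\<^sup>+x. f x \<partial>distr (Lb I) (Lb I) (\<lambda>x. \<lambda>i\<in>I. t i + c * x i))"
    by (subst nn_integral_density) (auto simp: nn_integral_cmult)
  also have "\<dots> = ennreal (\<bar>c\<bar> ^ card I) * (\<integral>\<^sup>+x. f (\<lambda>i\<in>I. t i + c * x i) \<partial>Lb I)"
    using T by (subst nn_integral_distr) auto
  finally show ?thesis .
qed

text \<open>Coefficients and arguments are functions of the index, matching the points of
  \<open>Lb {..<p}\<close>; values at indices from \<open>p\<close> on are ignored.\<close>

definition bil :: "nat \<Rightarrow> (nat \<Rightarrow> nat \<Rightarrow> real) \<Rightarrow> (nat \<Rightarrow> real) \<Rightarrow> (nat \<Rightarrow> real) \<Rightarrow> real" where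
  "bil p A x y = (\<Sum>i<p. \<Sum>j<p. A i j * x i * y j)"

lemma bil_cong: "(\<And>i. i < p \<Longrightarrow> x i = x' i) \<Longrightarrow> (\<And>i. i < p \<Longrightarrow> y i = y' i) \<Longrightarrow> bil p A x y = bil p A x' y'"
  unfolding bil_def by (intro sum.cong) auto

lemma bil_scale: "bil p A (\<lambda>i. c * x i) (\<lambda>i. d * y i) = c * d * bil p A x y"
  unfolding bil_def sum_distrib_left by (intro sum.cong refl) (simp add: mult_ac)

lemma bil_add_left: "bil p A (\<lambda>i. x i + y i) z = bil p A x z + bil p A y z"
  unfolding bil_def sum.distrib[symmetric] by (intro sum.cong refl) (simp only: ring_distribs)
lemma bil_diff_left: "bil p A (\<lambda>i. x i - y i) z = bil p A x z - bil p A y z"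
  unfolding bil_def sum_subtractf[symmetric] by (intro sum.cong refl) (simp only: ring_distribs)
lemma bil_add_right: "bil p A x (\<lambda>i. y i + z i) = bil p A x y + bil p A x z"
  unfolding bil_def sum.distrib[symmetric] by (intro sum.cong refl) (simp only: ring_distribs)
lemma bil_diff_right: "bil p A x (\<lambda>i. y i - z i) = bil p A x y - bil p A x z"
  unfolding bil_def sum_subtractf[symmetric] by (intro sum.cong refl) (simp only: ring_distribs)

definition sym_coeffs :: "nat \<Rightarrow> (nat \<Rightarrow> nat \<Rightarrow> real) \<Rightarrow> bool" where
  "sym_coeffs p A \<longleftrightarrow> (\<forall>i<p. \<forall>j<p. A i j = A j i)"

lemma bil_commute:
  assumes "sym_coeffs p A"
  shows "bil p A x y = bil p A y x"
proof -
  have "bil p A x y = (\<Sum>j<p. \<Sum>i<p. A i j * x i * y j)"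
    unfolding bil_def by (rule sum.swap)
  also have "\<dots> = bil p A y x"
    unfolding bil_def by (intro sum.cong refl) (use assms in \<open>simp add: sym_coeffs_def mult_ac\<close>)
  finally show ?thesis .
qed

lemma measurable_bil[measurable]:
  assumes [measurable]: "\<And>i. i < p \<Longrightarrow> (\<lambda>z. f z i) \<in> borel_measurable N"
   "\<And>i. i < p \<Longrightarrow> (\<lambda>z. g z i) \<in> borel_measurable N"
  shows "(\<lambda>z. bil p A (f z) (g z)) \<in> borel_measurable N"
  unfolding bil_def by (intro borel_measurable_sum borel_measurable_times) auto

section \<open>Gaussian integrals\<close>

lemma measurable_PiM_coord[measurable (raw)]: "i < p \<Longrightarrow> (\<lambda>x. x i) \<in> borel_measurable (Lb {..<p})"
  using measurable_component_singleton[of i "{..<p}" "\<lambda>_. lborel :: real measure"] by simp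

lemma bil_unit_left: "k < p \<Longrightarrow> bil p A (\<lambda>i. if i = k then 1 else 0) x = (\<Sum>j<p. A k j * x j)"
proof -
  assume k: "k < p"
  have "bil p A (\<lambda>i. if i = k then 1 else 0) x = (\<Sum>i<p. if i = k then (\<Sum>j<p. A k j * x j) else 0)"
    unfolding bil_def by (intro sum.cong refl) (auto intro: sum.neutral)
  with k show ?thesis by simp
qed

lemma bil_unit_unit: "k < p \<Longrightarrow> bil p A (\<lambda>i. if i = k then 1 else 0) (\<lambda>i. if i = k then 1 else 0) = A k k"
  by (simp add: bil_unit_left if_distrib cong: if_cong)

text \<open>Expansion around the point with coordinate \<open>k\<close> set to 0. The result is a
  quadratic polynomial in \<open>z\<close>, which makes the conditional density of one coordinate a
  one-dimensional Gaussian.\<close>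

lemma bil_upd:
  assumes sym: "sym_coeffs p A" and k: "k < p"
  shows "bil p A (x(k := z)) (x(k := z)) =
    A k k * z\<^sup>2 + 2 * z * bil p A (\<lambda>i. if i = k then 1 else 0) (x(k := 0)) + bil p A (x(k := 0)) (x(k := 0))"
proof -
  define e :: "nat \<Rightarrow> real" where "e = (\<lambda>i. if i = k then 1 else 0)"
  define u where "u = x(k := 0)"
  have "bil p A (x(k := z)) (x(k := z)) = bil p A (\<lambda>i. u i + z * e i) (\<lambda>i. u i + z * e i)"
    by (intro bil_cong) (auto simp: u_def e_def)
  also have "\<dots> = bil p A u u + bil p A u (\<lambda>i. z * e i) + (bil p A (\<lambda>i. z * e i) u + bil p A (\<lambda>i. z * e i) (\<lambda>i. z * e i))"
    by (simp only: bil_add_left bil_add_right)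
  also have "bil p A (\<lambda>i. z * e i) (\<lambda>i. z * e i) = z * z * A k k"
    unfolding bil_scale by (simp add: e_def bil_unit_unit[OF k])
  also have "bil p A u (\<lambda>i. z * e i) = bil p A (\<lambda>i. z * e i) u"
    by (rule bil_commute[OF sym])
  also have "bil p A (\<lambda>i. z * e i) u = z * bil p A e u"
    using bil_scale[of p A z e 1 u] by simp
  finally have *: "bil p A (x(k := z)) (x(k := z)) = bil p A u u + z * bil p A e u + (z * bil p A e u + z * z * A k k)" .
  show ?thesis
    unfolding * u_def[symmetric] e_def[symmetric] by (simp add: power2_eq_square)
qed

text \<open>Substitute \<open>m + sqrt w * x\<close>. The Gaussian integral itself is never
  evaluated; what matters is that it is independent of \<open>m\<close> and proportional to
  \<open>sqrt w ^ p\<close>.\<close>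

lemma gauss_scale:
  assumes w: "w > 0"
  shows "(\<integral>\<^sup>+x. ennreal (exp (- bil p A (\<lambda>i. x i - m i) (\<lambda>i. x i - m i) / (2 * w))) \<partial>Lb {..<p})
     = ennreal (sqrt w ^ p) * (\<integral>\<^sup>+x. ennreal (exp (- bil p A x x / 2)) \<partial>Lb {..<p})"
proof -
  have c: "sqrt w \<noteq> 0" using w by simp
  have *: "exp (- bil p A (\<lambda>i. (\<lambda>i\<in>{..<p}. m i + sqrt w * x i) i - m i) (\<lambda>i. (\<lambda>i\<in>{..<p}. m i + sqrt w * x i) i - m i) / (2 * w))
     = exp (- bil p A x x / 2)" for x
  proof -
    have "bil p A (\<lambda>i. (\<lambda>i\<in>{..<p}. m i + sqrt w * x i) i - m i) (\<lambda>i. (\<lambda>i\<in>{..<p}. m i + sqrt w * x i) i - m i)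
       = bil p A (\<lambda>i. sqrt w * x i) (\<lambda>i. sqrt w * x i)"
      by (rule bil_cong) auto
    also have "\<dots> = w * bil p A x x" using w unfolding bil_scale by simp
    finally have e: "bil p A (\<lambda>i. (\<lambda>i\<in>{..<p}. m i + sqrt w * x i) i - m i) (\<lambda>i. (\<lambda>i\<in>{..<p}. m i + sqrt w * x i) i - m i)
      = w * bil p A x x" .
    show ?thesis unfolding e using w by simp
  qed
  show ?thesis
    using w by (subst nn_integral_PiM_lborel_affine[OF _ c, where t = m]) (simp_all only: *, auto)
qed

lemma gauss_pos:
  "(\<integral>\<^sup>+x. ennreal (exp (- bil p A x x / 2)) \<partial>Lb {..<p}) > 0"
proof -
  have "\<not> (AE x in Lb {..<p}. ennreal (exp (- bil p A x x / 2)) = 0)"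
  proof
    assume "AE x in Lb {..<p}. ennreal (exp (- bil p A x x / 2)) = 0"
    then have "AE x in Lb {..<p}. False" by simp
    then have "emeasure (Lb {..<p}) (space (Lb {..<p})) = 0"
      by (simp add: eventually_False[symmetric] flip: ae_filter_eq_bot_iff)
    moreover have "emeasure (Lb {..<p}) (Pi\<^sub>E {..<p} (\<lambda>_. {0..1})) = 1"
      by (subst lborel_PiM.emeasure_PiM) auto
    moreover have "emeasure (Lb {..<p}) (Pi\<^sub>E {..<p} (\<lambda>_. {0..1})) \<le> emeasure (Lb {..<p}) (space (Lb {..<p}))"
      by (rule emeasure_space)
    ultimately show False by simp
  qed
  then show ?thesis
    by (subst (asm) nn_integral_0_iff_AE[symmetric]) (auto simp: zero_less_iff_neq_zero)
qed

text \<open>The lower bound on the form dominates the integrand by a product of one-dimensional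
  Gaussians.\<close>

lemma gauss_finite:
  assumes k: "\<kappa> > 0" and low: "\<And>x. \<kappa> * (\<Sum>i<p. (x i)\<^sup>2) \<le> bil p A x x"
  shows "(\<integral>\<^sup>+x. ennreal (exp (- bil p A x x / 2)) \<partial>Lb {..<p}) < \<infinity>"
proof -
  have "ennreal (exp (- bil p A x x / 2)) \<le> (\<Prod>i<p. ennreal (exp (- \<kappa> * (x i)\<^sup>2 / 2)))" for x
  proof -
    have "exp (- bil p A x x / 2) \<le> exp (\<Sum>i<p. - \<kappa> * (x i)\<^sup>2 / 2)"
      using low[of x] by (simp add: sum_distrib_left sum_divide_distrib[symmetric] sum_negf)
    also have "\<dots> = (\<Prod>i<p. exp (- \<kappa> * (x i)\<^sup>2 / 2))"
      by (simp add: exp_sum)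
    finally show ?thesis by (subst prod_ennreal) (auto intro: ennreal_leI)
  qed
  then have "(\<integral>\<^sup>+x. ennreal (exp (- bil p A x x / 2)) \<partial>Lb {..<p})
      \<le> (\<integral>\<^sup>+x. (\<Prod>i<p. ennreal (exp (- \<kappa> * (x i)\<^sup>2 / 2))) \<partial>Lb {..<p})"
    by (intro nn_integral_mono)
  also have "\<dots> = (\<Prod>i<p. (\<integral>\<^sup>+z. ennreal (exp (- \<kappa> * z\<^sup>2 / 2)) \<partial>lborel))"
    by (subst lborel_PiM.product_nn_integral_prod) auto
  also have "(\<integral>\<^sup>+z. ennreal (exp (- \<kappa> * z\<^sup>2 / 2)) \<partial>lborel) =
     (\<integral>\<^sup>+z. ennreal (sqrt (2 * pi * (1 / \<kappa>))) * ennreal (normal_density 0 (sqrt (1/\<kappa>)) z) \<partial>lborel)"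
    using k by (intro nn_integral_cong) (simp add: normal_density_def ennreal_mult[symmetric] real_sqrt_divide real_sqrt_mult field_simps)
  also have "\<dots> = ennreal (sqrt (2 * pi * (1 / \<kappa>)))"
    using k by (subst nn_integral_cmult) (auto simp: nn_integral_eq_integral integrable_normal_density integral_normal_density)
  finally show ?thesis
    using k by (auto simp: ennreal_power less_top[symmetric] top_unique)
qed

text \<open>On the half-space \<open>q(y) \<le> y\<^sup>T A x\<close> we have \<open>q(x) \<ge> q(x - y) + q(y)\<close>, and the integral of the translate
  is that of the original.\<close>

lemma gauss_tail:
  assumes sym: "sym_coeffs p A" and w: "w > 0"
  shows "(\<integral>\<^sup>+x. ennreal (exp (- bil p A (\<lambda>i. x i - m i) (\<lambda>i. x i - m i) / (2 * w))) *
            indicator {x. bil p A y y \<le> bil p A y (\<lambda>i. x i - m i)} x \<partial>Lb {..<p})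
     \<le> ennreal (exp (- bil p A y y / (2 * w))) *
        (\<integral>\<^sup>+x. ennreal (exp (- bil p A (\<lambda>i. x i - m i) (\<lambda>i. x i - m i) / (2 * w))) \<partial>Lb {..<p})"
    (is "?L \<le> ?R")
proof -
  let ?m = "\<lambda>i. m i + y i"
  have "?L \<le> (\<integral>\<^sup>+x. ennreal (exp (- bil p A y y / (2 * w))) *
      ennreal (exp (- bil p A (\<lambda>i. x i - ?m i) (\<lambda>i. x i - ?m i) / (2 * w))) \<partial>Lb {..<p})"
  proof (intro nn_integral_mono)
    fix x
    let ?z = "\<lambda>i. x i - m i"
    show "ennreal (exp (- bil p A ?z ?z / (2 * w))) * indicator {x. bil p A y y \<le> bil p A y (\<lambda>i. x i - m i)} x
       \<le> ennreal (exp (- bil p A y y / (2 * w))) * ennreal (exp (- bil p A (\<lambda>i. x i - ?m i) (\<lambda>i. x i - ?m i) / (2 * w)))"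
    proof (cases "bil p A y y \<le> bil p A y ?z")
      case True
      have "bil p A (\<lambda>i. x i - ?m i) (\<lambda>i. x i - ?m i) = bil p A (\<lambda>i. ?z i - y i) (\<lambda>i. ?z i - y i)"
        by (simp add: algebra_simps)
      also have "\<dots> = bil p A ?z ?z - 2 * bil p A y ?z + bil p A y y"
        using bil_commute[OF sym, where x = ?z and y = y] by (simp only: bil_diff_left[of p A ?z y] bil_diff_right[of p A _ ?z y])
      finally have "bil p A (\<lambda>i. x i - ?m i) (\<lambda>i. x i - ?m i) + bil p A y y \<le> bil p A ?z ?z" using True by simp
      then have "- bil p A ?z ?z / (2 * w) \<le> - bil p A y y / (2 * w) + - bil p A (\<lambda>i. x i - ?m i) (\<lambda>i. x i - ?m i) / (2 * w)"
        using w by (simp add: divide_simps)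
      then have "exp (- bil p A ?z ?z / (2 * w)) \<le> exp (- bil p A y y / (2 * w)) * exp (- bil p A (\<lambda>i. x i - ?m i) (\<lambda>i. x i - ?m i) / (2 * w))"
        unfolding exp_add[symmetric] by simp
      then show ?thesis by (simp add: True ennreal_mult[symmetric] ennreal_leI)
    qed simp
  qed
  also have "\<dots> = ennreal (exp (- bil p A y y / (2 * w))) *
      (\<integral>\<^sup>+x. ennreal (exp (- bil p A (\<lambda>i. x i - ?m i) (\<lambda>i. x i - ?m i) / (2 * w))) \<partial>Lb {..<p})"
    by (rule nn_integral_cmult) measurable
  also have "(\<integral>\<^sup>+x. ennreal (exp (- bil p A (\<lambda>i. x i - ?m i) (\<lambda>i. x i - ?m i) / (2 * w))) \<partial>Lb {..<p})
     = (\<integral>\<^sup>+x. ennreal (exp (- bil p A (\<lambda>i. x i - m i) (\<lambda>i. x i - m i) / (2 * w))) \<partial>Lb {..<p})"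
    unfolding gauss_scale[OF w] ..
  finally show ?thesis .
qed

text \<open>The vector \<open>y\<close> represents coordinate \<open>i\<close> through the form: it
  is row \<open>i\<close> of the inverse of \<open>A\<close>, and \<open>w * y i\<close> is the
  variance of that coordinate. Testing the lower bound \<open>low\<close> at \<open>y\<close> itself
  gives \<open>y i \<le> 1 / \<kappa>\<close>, and a multiple of \<open>y\<close> turns the
  half-space of \<open>gauss_tail\<close> into a coordinate half-space.\<close>

lemma gauss_coord_tail:
  assumes sym: "sym_coeffs p A" and w: "w > 0"
    and k: "\<kappa> > 0" and low: "\<And>x. \<kappa> * (\<Sum>i<p. (x i)\<^sup>2) \<le> bil p A x x"
    and i: "i < p" and y: "\<And>x. bil p A y x = x i" and s: "\<bar>s\<bar> = 1" and t: "t > 0"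
  shows "(\<integral>\<^sup>+x. ennreal (exp (- bil p A (\<lambda>i. x i - m i) (\<lambda>i. x i - m i) / (2 * w))) *
            indicator {x. t \<le> s * (x i - m i)} x \<partial>Lb {..<p})
     \<le> ennreal (exp (- \<kappa> * t\<^sup>2 / (2 * w))) *
        (\<integral>\<^sup>+x. ennreal (exp (- bil p A (\<lambda>i. x i - m i) (\<lambda>i. x i - m i) / (2 * w))) \<partial>Lb {..<p})"
proof -
  have yi: "bil p A y y = y i" by (rule y)
  have "(y i)\<^sup>2 \<le> (\<Sum>i<p. (y i)\<^sup>2)" using i by (intro member_le_sum[of i "{..<p}" "\<lambda>i. (y i)\<^sup>2"]) auto
  with low[of y] yi k have le: "\<kappa> * (y i)\<^sup>2 \<le> y i" by (smt (verit) mult_left_mono)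
  have y0: "y i \<noteq> 0"
  proof
    assume 0: "y i = 0"
    have "(\<Sum>i<p. (y i)\<^sup>2) \<le> 0" using low[of y] yi 0 k by (simp add: mult_le_0_iff)
    then have "\<forall>i<p. y i = 0"
      by (meson finite_lessThan lessThan_iff order_antisym sum_nonneg sum_nonneg_eq_0_iff zero_eq_power2 zero_le_power2)
    then have "bil p A y (\<lambda>_. 1) = bil p A (\<lambda>_. 0) (\<lambda>_. 1)" by (intro bil_cong) auto
    then show False using y[of "\<lambda>_. 1"] by (simp add: bil_def)
  qed
  have ypos: "y i > 0" using le k y0 by (smt (verit) zero_less_mult_iff zero_less_power2)
  have ki: "\<kappa> * y i \<le> 1" using le ypos by (simp add: power2_eq_square)
  \<comment> \<open>With this factor, \<open>c * y\<close> lies on the hyperplane where coordinate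
    \<open>i\<close> equals \<open>s * t\<close>, and the form takes its smallest value there,
    \<open>t\<^sup>2 / y i\<close>.\<close>
  define c where "c = s * t / y i"
  have ss: "s * s = 1" using s by (metis abs_mult_self_eq mult_1)
  have q: "bil p A (\<lambda>i. c * y i) (\<lambda>i. c * y i) = t\<^sup>2 / y i"
    unfolding bil_scale yi using ss y0 by (simp add: c_def power2_eq_square field_simps)
  have b: "bil p A (\<lambda>i. c * y i) x = s * t * x i / y i" for x
    using bil_scale[of p A c y 1 x] y[of x] by (simp add: c_def)
  have iff: "t\<^sup>2 / y i \<le> s * t * (x i - m i) / y i \<longleftrightarrow> t \<le> s * (x i - m i)" for x
    using t ypos by (simp add: divide_le_cancel power2_eq_square)
  have "\<kappa> * t\<^sup>2 = (\<kappa> * y i) * t\<^sup>2 / y i" using y0 by simp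
  also have "\<dots> \<le> 1 * t\<^sup>2 / y i" using ki ypos by (intro divide_right_mono mult_right_mono) auto
  finally have "- (t\<^sup>2 / y i) / (2 * w) \<le> - \<kappa> * t\<^sup>2 / (2 * w)" using w by (intro divide_right_mono) auto
  then have e: "ennreal (exp (- (t\<^sup>2 / y i) / (2 * w))) \<le> ennreal (exp (- \<kappa> * t\<^sup>2 / (2 * w)))"
    by (intro ennreal_leI) (simp only: exp_le_cancel_iff)
  show ?thesis
    using gauss_tail[where p = p and A = A, OF sym w, where y = "\<lambda>i. c * y i" and m = m]
    unfolding q b iff by (rule order_trans) (intro mult_right_mono e, simp)
qed

section \<open>Upper bounds for the Gaussian mass of boxes with arbitrary centre\<close>

lemma normal_outside_interval:
  assumes s: "s > 0" and e: "\<epsilon> \<ge> 0"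
  shows "(\<integral>\<^sup>+z. ennreal (normal_density \<mu> s z) * indicator {z. \<bar>z - c\<bar> \<le> \<epsilon>} z \<partial>lborel)
    \<le> ennreal (1 - exp (- 1 - \<epsilon>\<^sup>2 / s\<^sup>2) / sqrt (2 * pi))"
proof -
  define d where "d = exp (- 1 - \<epsilon>\<^sup>2 / s\<^sup>2) / sqrt (2 * pi)"
  have d0: "d \<ge> 0" by (simp add: d_def)
  let ?f = "normal_density \<mu> s"
  \<comment> \<open>An interval of length \<open>s\<close> on the side of \<mu> facing away from
    \<open>c\<close>, at distance \<epsilon> from \<mu>, cannot meet the interval around
    \<open>c\<close>. Its points are within \<open>\<epsilon> + s\<close> of \<mu>, and
    \<open>(\<epsilon> + s)\<^sup>2 \<le> 2 * \<epsilon>\<^sup>2 + 2 * s\<^sup>2\<close> bounds the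
    density from below, so its mass is at least \<open>d\<close>.\<close>
  define J where "J = (if c \<le> \<mu> then {\<mu> + \<epsilon> <.. \<mu> + \<epsilon> + s} else {\<mu> - \<epsilon> - s ..< \<mu> - \<epsilon>})"
  have Jm[measurable]: "J \<in> sets borel" by (simp add: J_def)
  have Je: "emeasure lborel J = ennreal s" using s by (simp add: J_def)
  have low: "d / s \<le> ?f z" if "z \<in> J" for z
  proof -
    have "\<bar>z - \<mu>\<bar> \<le> \<epsilon> + s" using that s e by (auto simp: J_def split: if_splits)
    then have "(z - \<mu>)\<^sup>2 \<le> (\<epsilon> + s)\<^sup>2" using e s by (intro abs_le_square_iff[THEN iffD1]) simp
    also have "\<dots> \<le> 2 * \<epsilon>\<^sup>2 + 2 * s\<^sup>2" using sum_squares_bound[of \<epsilon> s] by (simp add: power2_sum)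
    finally have "(z - \<mu>)\<^sup>2 / (2 * s\<^sup>2) \<le> (2 * \<epsilon>\<^sup>2 + 2 * s\<^sup>2) / (2 * s\<^sup>2)" using s by (intro divide_right_mono) auto
    also have "\<dots> = 1 + \<epsilon>\<^sup>2 / s\<^sup>2" using s by (simp add: field_simps)
    finally have "exp (- 1 - \<epsilon>\<^sup>2 / s\<^sup>2) \<le> exp (- (z - \<mu>)\<^sup>2 / (2 * s\<^sup>2))" by simp
    then show ?thesis using s by (simp add: d_def normal_density_def real_sqrt_mult field_simps)
  qed
  have disj: "indicator {z. \<bar>z - c\<bar> \<le> \<epsilon>} z + indicator J z \<le> (1::ennreal)" for z
    using s by (auto simp: J_def indicator_def)
  have "(\<integral>\<^sup>+z. ennreal (?f z) * indicator {z. \<bar>z - c\<bar> \<le> \<epsilon>} z \<partial>lborel) + ennreal d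
     = (\<integral>\<^sup>+z. ennreal (?f z) * indicator {z. \<bar>z - c\<bar> \<le> \<epsilon>} z \<partial>lborel) + (\<integral>\<^sup>+z. ennreal (d / s) * indicator J z \<partial>lborel)"
    using s d0 by (simp add: nn_integral_cmult_indicator Je ennreal_mult[symmetric])
  also have "\<dots> \<le> (\<integral>\<^sup>+z. ennreal (?f z) * indicator {z. \<bar>z - c\<bar> \<le> \<epsilon>} z \<partial>lborel) + (\<integral>\<^sup>+z. ennreal (?f z) * indicator J z \<partial>lborel)"
    by (intro add_left_mono nn_integral_mono) (auto simp: indicator_def intro!: ennreal_leI low)
  also have "\<dots> = (\<integral>\<^sup>+z. ennreal (?f z) * indicator {z. \<bar>z - c\<bar> \<le> \<epsilon>} z + ennreal (?f z) * indicator J z \<partial>lborel)"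
    by (rule nn_integral_add[symmetric]) auto
  also have "\<dots> \<le> (\<integral>\<^sup>+z. ennreal (?f z) * 1 \<partial>lborel)"
    unfolding distrib_left[symmetric] by (intro nn_integral_mono mult_left_mono disj) simp
  also have "\<dots> = 1"
    using s by (simp add: nn_integral_eq_integral integrable_normal_density integral_normal_density)
  finally have le: "(\<integral>\<^sup>+z. ennreal (?f z) * indicator {z. \<bar>z - c\<bar> \<le> \<epsilon>} z \<partial>lborel) + ennreal d \<le> 1" .
  then show ?thesis
    using d0 unfolding d_def[symmetric]
    by (cases "\<integral>\<^sup>+z. ennreal (?f z) * indicator {z. \<bar>z - c\<bar> \<le> \<epsilon>} z \<partial>lborel")
       (auto simp: ennreal_plus[symmetric] top_unique simp del: ennreal_plus intro!: ennreal_leI)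
qed

text \<open>Bound for the mass that a normal law of standard deviation \<open>s\<close> gives to any
  interval of half-width \<epsilon>, where
  \<open>r = \<epsilon>\<^sup>2 / s\<^sup>2\<close>.\<close>

definition box_factor :: "real \<Rightarrow> real" where
  "box_factor r = 1 - exp (- 1 - r) / sqrt (2 * pi)"

lemma box_factor_nonneg: "r \<ge> 0 \<Longrightarrow> box_factor r \<ge> 0"
proof -
  assume "r \<ge> 0"
  then have "exp (-1 - r) \<le> 1" by simp
  moreover have "1 \<le> sqrt (2 * pi)" using pi_gt3 by (intro real_le_rsqrt) simp
  ultimately have "exp (-1 - r) \<le> sqrt (2 * pi)" by (rule order_trans)
  then show ?thesis unfolding box_factor_def by (simp add: divide_le_eq)
qed

lemma box_factor_mono: "r \<le> r' \<Longrightarrow> box_factor r \<le> box_factor r'"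
  by (simp add: box_factor_def divide_right_mono)

text \<open>Since 1 - d <= exp (- d). In this form the threshold is visible: the bound stays away
  from 1 as long as p exp (- r) stays away from 0, that is, for r up to log p plus a
  constant.\<close>

lemma box_factor_power_le:
  assumes "r \<ge> 0" shows "box_factor r ^ p \<le> exp (- real p * (exp (- 1 - r) / sqrt (2 * pi)))"
proof -
  have "box_factor r \<le> exp (- (exp (- 1 - r) / sqrt (2 * pi)))"
    unfolding box_factor_def using exp_ge_add_one_self[of "- (exp (- 1 - r) / sqrt (2 * pi))"] by simp
  then have "box_factor r ^ p \<le> exp (- (exp (- 1 - r) / sqrt (2 * pi))) ^ p"
    using box_factor_nonneg[OF assms] by (intro power_mono)
  then show ?thesis by (simp add: exp_of_nat_mult[symmetric])
qed

lemma quadratic_exp_interval: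
  assumes a: "a > 0" and e: "\<epsilon> \<ge> 0" and w: "w > 0"
  shows "(\<integral>\<^sup>+z. ennreal (exp (- (a * z\<^sup>2 + 2 * z * b + d) / (2 * w))) * indicator {z. \<bar>z - c\<bar> \<le> \<epsilon>} z \<partial>lborel)
    \<le> ennreal (box_factor (\<epsilon>\<^sup>2 * a / w)) * (\<integral>\<^sup>+z. ennreal (exp (- (a * z\<^sup>2 + 2 * z * b + d) / (2 * w))) \<partial>lborel)"
proof -
  define s where "s = sqrt (w / a)"
  have s: "s > 0" and s2: "s\<^sup>2 = w / a" using a w by (auto simp: s_def)
  \<comment> \<open>Completing the square leaves a normal density of mean \<open>- b / a\<close> and
    variance \<open>w / a\<close>; \<open>K\<close> collects the remaining constant and the
    normalisation, and cancels between the two sides.\<close>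
  define K where "K = exp (- (d - b\<^sup>2 / a) / (2 * w)) * sqrt (2 * pi * s\<^sup>2)"
  have K: "K > 0" using s by (simp add: K_def)
  have *: "- (a * z\<^sup>2 + 2 * z * b + d) / (2 * w) = - (d - b\<^sup>2 / a) / (2 * w) + - (z - (- b / a))\<^sup>2 / (2 * s\<^sup>2)" for z
    using a w unfolding s2 by (simp add: field_simps power2_eq_square)
  have eq: "exp (- (a * z\<^sup>2 + 2 * z * b + d) / (2 * w)) = K * normal_density (- b / a) s z" for z
    unfolding * exp_add K_def normal_density_def using s by simp
  have box: "box_factor (\<epsilon>\<^sup>2 * a / w) = 1 - exp (- 1 - \<epsilon>\<^sup>2 / s\<^sup>2) / sqrt (2 * pi)"
    by (simp add: box_factor_def s2)
  have "(\<integral>\<^sup>+z. ennreal (K * normal_density (- b / a) s z) \<partial>lborel) = ennreal K * (\<integral>\<^sup>+z. ennreal (normal_density (- b / a) s z) \<partial>lborel)"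
    using K by (subst nn_integral_cmult[symmetric]) (auto simp: ennreal_mult)
  also have "\<dots> = ennreal K"
    using s by (simp add: nn_integral_eq_integral integrable_normal_density integral_normal_density)
  finally have 1: "(\<integral>\<^sup>+z. ennreal (K * normal_density (- b / a) s z) \<partial>lborel) = ennreal K" .
  have "(\<integral>\<^sup>+z. ennreal (K * normal_density (- b / a) s z) * indicator {z. \<bar>z - c\<bar> \<le> \<epsilon>} z \<partial>lborel) =
     ennreal K * (\<integral>\<^sup>+z. ennreal (normal_density (- b / a) s z) * indicator {z. \<bar>z - c\<bar> \<le> \<epsilon>} z \<partial>lborel)"
    using K by (subst nn_integral_cmult[symmetric]) (auto simp: ennreal_mult mult.assoc)
  also have "\<dots> \<le> ennreal K * ennreal (box_factor (\<epsilon>\<^sup>2 * a / w))"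
    unfolding box by (intro mult_left_mono normal_outside_interval s e) simp
  finally show ?thesis unfolding eq 1 by (simp add: mult.commute)
qed

text \<open>Given the other coordinates, coordinate \<open>k\<close> is Gaussian with precision \<open>A k k / w\<close> and some centre;
  since the constraints on the other coordinates do not involve it, restricting it costs a factor.\<close>

lemma gauss_box_step:
  assumes sym: "sym_coeffs p A" and w: "w > 0" and e: "\<epsilon> \<ge> 0"
    and k: "k < p" and pos: "A k k > 0" and up: "A k k \<le> K"
  shows "(\<integral>\<^sup>+x. ennreal (exp (- bil p A x x / (2 * w))) * indicator {x. \<forall>i<Suc k. \<bar>x i - c i\<bar> \<le> \<epsilon>} x \<partial>Lb {..<p})
     \<le> ennreal (box_factor (\<epsilon>\<^sup>2 * K / w)) *
       (\<integral>\<^sup>+x. ennreal (exp (- bil p A x x / (2 * w))) * indicator {x. \<forall>i<k. \<bar>x i - c i\<bar> \<le> \<epsilon>} x \<partial>Lb {..<p})"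
proof -
  let ?I = "{..<p} - {k}"
  let ?g = "\<lambda>x. ennreal (exp (- bil p A x x / (2 * w)))"
  let ?B = "\<lambda>k. {x. \<forall>i<k. \<bar>x i - c i\<bar> \<le> \<epsilon>}"
  have ins: "{..<p} = insert k ?I" using k by auto
  have mB: "(\<lambda>x. indicator (?B j) x :: ennreal) \<in> borel_measurable (Lb {..<p})" if "j \<le> p" for j
  proof -
    have "(\<lambda>x. indicator (?B j) x :: ennreal) = (\<lambda>x. \<Prod>i<j. indicator {z. \<bar>z - c i\<bar> \<le> \<epsilon>} (x i))"
    proof
      fix x show "indicator (?B j) x = (\<Prod>i<j. indicator {z. \<bar>z - c i\<bar> \<le> \<epsilon>} (x i) :: ennreal)"
        by (cases "x \<in> ?B j") (auto simp: indicator_def)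
    qed
    also have "\<dots> \<in> borel_measurable (Lb {..<p})"
      using that by (intro borel_measurable_prod_ennreal) auto
    finally show ?thesis .
  qed
  have gm: "?g \<in> borel_measurable (Lb {..<p})" by measurable
  have gB: "(\<lambda>x. ?g x * indicator (?B j) x) \<in> borel_measurable (Lb {..<p})" if "j \<le> p" for j
    by (intro borel_measurable_times_ennreal gm mB that)
  have split: "(\<integral>\<^sup>+x. ?g x * indicator (?B j) x \<partial>Lb {..<p})
      = (\<integral>\<^sup>+x. (\<integral>\<^sup>+z. ?g (x(k := z)) * indicator (?B j) (x(k := z)) \<partial>lborel) \<partial>Lb ?I)" if "j \<le> p" for j
  proof -
    from gB[OF that] have m: "(\<lambda>x. ?g x * indicator (?B j) x) \<in> borel_measurable (Lb (insert k ?I))"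
      unfolding ins[symmetric] .
    have "finite ?I" "k \<notin> ?I" by auto
    from lborel_PiM.product_nn_integral_insert[OF this m] show ?thesis
      unfolding ins[symmetric] .
  qed
  have inner: "(\<integral>\<^sup>+z. ?g (x(k := z)) * indicator (?B (Suc k)) (x(k := z)) \<partial>lborel) \<le>
       ennreal (box_factor (\<epsilon>\<^sup>2 * K / w)) * (\<integral>\<^sup>+z. ?g (x(k := z)) * indicator (?B k) (x(k := z)) \<partial>lborel)" for x
  proof -
    have B1: "indicator (?B (Suc k)) (x(k := z)) = (indicator (?B k) x * indicator {z. \<bar>z - c k\<bar> \<le> \<epsilon>} z :: ennreal)" for z
      by (auto simp: indicator_def less_Suc_eq)
    have B2: "indicator (?B k) (x(k := z)) = (indicator (?B k) x :: ennreal)" for z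
      by (auto simp: indicator_def)
    define b where "b = bil p A (\<lambda>i. if i = k then 1 else 0) (x(k := 0))"
    define d where "d = bil p A (x(k := 0)) (x(k := 0))"
    have q: "bil p A (x(k := z)) (x(k := z)) = A k k * z\<^sup>2 + 2 * z * b + d" for z
      unfolding b_def d_def by (rule bil_upd[OF sym k])
    let ?h = "\<lambda>z. ennreal (exp (- (A k k * z\<^sup>2 + 2 * z * b + d) / (2 * w)))"
    have "(\<integral>\<^sup>+z. ?g (x(k := z)) * indicator (?B (Suc k)) (x(k := z)) \<partial>lborel)
       = indicator (?B k) x * (\<integral>\<^sup>+z. ?h z * indicator {z. \<bar>z - c k\<bar> \<le> \<epsilon>} z \<partial>lborel)"
      unfolding B1 q by (subst nn_integral_cmult[symmetric]) (auto simp: mult_ac)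
    also have "\<dots> \<le> indicator (?B k) x * (ennreal (box_factor (\<epsilon>\<^sup>2 * K / w)) * (\<integral>\<^sup>+z. ?h z \<partial>lborel))"
    proof (intro mult_left_mono order_trans[OF quadratic_exp_interval[OF pos e w]] mult_right_mono ennreal_leI box_factor_mono)
      show "\<epsilon>\<^sup>2 * A k k / w \<le> \<epsilon>\<^sup>2 * K / w" using up w by (intro divide_right_mono mult_left_mono) auto
    qed auto
    also have "\<dots> = ennreal (box_factor (\<epsilon>\<^sup>2 * K / w)) * (\<integral>\<^sup>+z. ?g (x(k := z)) * indicator (?B k) (x(k := z)) \<partial>lborel)"
      unfolding B2 q by (subst nn_integral_multc) (auto simp: mult_ac)
    finally show ?thesis .
  qed
  have "(\<integral>\<^sup>+x. ?g x * indicator (?B (Suc k)) x \<partial>Lb {..<p})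
     \<le> (\<integral>\<^sup>+x. ennreal (box_factor (\<epsilon>\<^sup>2 * K / w)) * (\<integral>\<^sup>+z. ?g (x(k := z)) * indicator (?B k) (x(k := z)) \<partial>lborel) \<partial>Lb ?I)"
    using k by (subst split) (simp, intro nn_integral_mono inner)
  also have "\<dots> = ennreal (box_factor (\<epsilon>\<^sup>2 * K / w)) * (\<integral>\<^sup>+x. (\<integral>\<^sup>+z. ?g (x(k := z)) * indicator (?B k) (x(k := z)) \<partial>lborel) \<partial>Lb ?I)"
  proof (rule nn_integral_cmult)
    have "(\<lambda>(x, z). x(k := z)) \<in> measurable (Lb ?I \<Otimes>\<^sub>M lborel) (Lb (insert k ?I))"
      by (rule measurable_add_dim)
    then have "(\<lambda>(x, z). x(k := z)) \<in> measurable (Lb ?I \<Otimes>\<^sub>M lborel) (Lb {..<p})"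
      unfolding ins[symmetric] .
    from measurable_compose[OF this gB[of k]] k
    have "(\<lambda>(x, z). ?g (x(k := z)) * indicator (?B k) (x(k := z))) \<in> borel_measurable (Lb ?I \<Otimes>\<^sub>M lborel)"
      by (simp only: split_def less_imp_le)
    then show "(\<lambda>x. (\<integral>\<^sup>+z. ?g (x(k := z)) * indicator (?B k) (x(k := z)) \<partial>lborel)) \<in> borel_measurable (Lb ?I)"
      by (rule lborel.borel_measurable_nn_integral)
  qed
  also have "\<dots> = ennreal (box_factor (\<epsilon>\<^sup>2 * K / w)) * (\<integral>\<^sup>+x. ?g x * indicator (?B k) x \<partial>Lb {..<p})"
    using k by (simp only: split less_imp_le)
  finally show ?thesis .
qed

text \<open>Adding the constraints one coordinate at a time costs the same factor each time,
  whatever the correlations, because \<open>gauss_box_step\<close> sees only the diagonal of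
  \<open>A\<close>.\<close>

lemma gauss_box:
  assumes sym: "sym_coeffs p A" and w: "w > 0" and e: "\<epsilon> \<ge> 0"
    and diag: "\<And>k. k < p \<Longrightarrow> 0 < A k k \<and> A k k \<le> K" and K: "K \<ge> 0"
  shows "(\<integral>\<^sup>+x. ennreal (exp (- bil p A (\<lambda>i. x i - m i) (\<lambda>i. x i - m i) / (2 * w))) * indicator {x. \<forall>i<p. \<bar>x i - c i\<bar> \<le> \<epsilon>} x \<partial>Lb {..<p})
     \<le> ennreal (box_factor (\<epsilon>\<^sup>2 * K / w) ^ p) *
       (\<integral>\<^sup>+x. ennreal (exp (- bil p A (\<lambda>i. x i - m i) (\<lambda>i. x i - m i) / (2 * w))) \<partial>Lb {..<p})"
proof -
  let ?g = "\<lambda>x. ennreal (exp (- bil p A x x / (2 * w)))"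
  let ?th = "box_factor (\<epsilon>\<^sup>2 * K / w)"
  \<comment> \<open>Centring the Gaussian at 0 moves the box, which is harmless because its centre
    is arbitrary.\<close>
  let ?c = "\<lambda>i. c i - m i"
  have th: "?th \<ge> 0" using K w by (intro box_factor_nonneg) auto
  have *: "(\<integral>\<^sup>+x. ?g x * indicator {x. \<forall>i<k. \<bar>x i - ?c i\<bar> \<le> \<epsilon>} x \<partial>Lb {..<p}) \<le> ennreal (?th ^ k) * (\<integral>\<^sup>+x. ?g x \<partial>Lb {..<p})" if "k \<le> p" for k
    using that
  proof (induction k)
    case (Suc k)
    then have k: "k < p" by simp
    have "(\<integral>\<^sup>+x. ?g x * indicator {x. \<forall>i<Suc k. \<bar>x i - ?c i\<bar> \<le> \<epsilon>} x \<partial>Lb {..<p})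
      \<le> ennreal ?th * (\<integral>\<^sup>+x. ?g x * indicator {x. \<forall>i<k. \<bar>x i - ?c i\<bar> \<le> \<epsilon>} x \<partial>Lb {..<p})"
      using diag[OF k] by (intro gauss_box_step[OF sym w e k]) auto
    also have "\<dots> \<le> ennreal ?th * (ennreal (?th ^ k) * (\<integral>\<^sup>+x. ?g x \<partial>Lb {..<p}))"
      using Suc by (intro mult_left_mono) auto
    finally show ?case using th by (simp add: ennreal_mult mult.assoc)
  qed simp
  have shift: "(\<integral>\<^sup>+x. ?g (\<lambda>i. x i - m i) * indicator {x. \<forall>i<p. \<bar>x i - c i\<bar> \<le> \<epsilon>} x \<partial>Lb {..<p})
     = (\<integral>\<^sup>+x. ?g x * indicator {x. \<forall>i<p. \<bar>x i - ?c i\<bar> \<le> \<epsilon>} x \<partial>Lb {..<p})"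
  proof -
    have "bil p A (\<lambda>i. (\<lambda>i\<in>{..<p}. m i + 1 * x i) i - m i) (\<lambda>i. (\<lambda>i\<in>{..<p}. m i + 1 * x i) i - m i) = bil p A x x" for x
      by (rule bil_cong) auto
    moreover have "indicator {x. \<forall>i<p. \<bar>x i - c i\<bar> \<le> \<epsilon>} (\<lambda>i\<in>{..<p}. m i + 1 * x i) =
        (indicator {x. \<forall>i<p. \<bar>x i - ?c i\<bar> \<le> \<epsilon>} x :: ennreal)" for x
      by (auto simp: indicator_def algebra_simps)
    ultimately show ?thesis
      by (subst nn_integral_PiM_lborel_affine[where t = m and c = 1]) (simp_all only:, auto)
  qed
  have "(\<integral>\<^sup>+x. ?g (\<lambda>i. x i - m i) \<partial>Lb {..<p}) = (\<integral>\<^sup>+x. ?g x \<partial>Lb {..<p})"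
    using gauss_scale[OF w, of p A m] gauss_scale[OF w, of p A "\<lambda>_. 0"] by simp
  then show ?thesis using *[of p] shift by simp
qed

section \<open>Inverse gamma tails\<close>

text \<open>Unnormalised inverse gamma density with shape \<open>k\<close> and scale
  \<open>c\<close>. All later bounds are relative to its total mass
  \<open>igk_mass k c\<close>.\<close>

definition igk :: "real \<Rightarrow> real \<Rightarrow> real \<Rightarrow> real" where
  "igk k c v = (if v > 0 then v powr (- k - 1) * exp (- c / v) else 0)"

abbreviation igk_mass :: "real \<Rightarrow> real \<Rightarrow> ennreal" where
  "igk_mass k c \<equiv> (\<integral>\<^sup>+v. ennreal (igk k c v) \<partial>lborel)"

lemma igk_nonneg: "igk k c v \<ge> 0"
  by (simp add: igk_def)

lemma measurable_igk[measurable]: "igk k c \<in> borel_measurable borel"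
  unfolding igk_def by measurable

lemma igk_pos:
  shows "igk_mass k c > 0"
proof -
  have "\<not> (AE v in lborel. ennreal (igk k c v) = 0)"
  proof
    assume "AE v in lborel. ennreal (igk k c v) = 0"
    then have "AE v in lborel. v \<notin> {0<..<1::real}" by eventually_elim (auto simp: igk_def)
    then have "emeasure lborel {0<..<1::real} = 0"
      by (subst (asm) AE_iff_measurable[of "{0<..<1}"]) auto
    then show False by simp
  qed
  then show ?thesis
    by (subst (asm) nn_integral_0_iff_AE[symmetric]) (auto simp: zero_less_iff_neq_zero)
qed

text \<open>Near 0 the inequality \<open>exp (c / v) \<ge> (c / (j * v)) ^ j\<close> with
  \<open>j \<ge> k + 1\<close> beats the pole of the power; beyond 1 the kernel is at most
  \<open>1 / v\<^sup>2\<close> because \<open>k \<ge> 1\<close>.\<close>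

lemma igk_finite:
  assumes k: "k \<ge> 1" and c: "c > 0"
  shows "igk_mass k c < \<infinity>"
proof -
  obtain j :: nat where j: "k + 1 \<le> real j" using real_arch_simple by blast
  define D where "D = real j ^ j / c ^ j"
  have D: "D \<ge> 0" using c by (simp add: D_def)
  have b1: "igk k c v \<le> D" if "0 < v" "v \<le> 1" for v :: real
  proof -
    have "(c / v / real j) ^ j \<le> (1 + c / v / real j) ^ j" using c that by (intro power_mono) auto
    also have "\<dots> \<le> exp (c / v)"
      using j k c that exp_ge_one_plus_x_over_n_power_n[of j "c / v"]
      by (smt (verit) divide_pos_pos of_nat_0_less_iff)
    finally have "(c / v / real j) ^ j \<le> exp (c / v)" .
    then have e: "exp (- c / v) \<le> real j ^ j * v ^ j / c ^ j"
      using c that j k by (simp add: exp_minus field_simps power_divide)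
    have "v powr (- k - 1) * v ^ j = v powr (real j - k - 1)"
      using that by (simp add: powr_realpow[symmetric] powr_add[symmetric] algebra_simps)
    also have "\<dots> \<le> 1" using that j by (simp add: powr_le1)
    finally have p: "v powr (- k - 1) * v ^ j \<le> 1" .
    have "igk k c v \<le> v powr (- k - 1) * (real j ^ j * v ^ j / c ^ j)"
      using that e unfolding igk_def by (simp only: if_True mult_left_mono powr_ge_zero)
    also have "\<dots> = (v powr (- k - 1) * v ^ j) * D" by (simp add: D_def)
    also have "\<dots> \<le> 1 * D" using p D by (intro mult_right_mono)
    finally show ?thesis by simp
  qed
  have b2: "igk k c v \<le> 1 / v ^ 2" if "1 \<le> v" for v :: real
  proof -
    have "igk k c v \<le> v powr (- k - 1) * 1" using that c by (simp add: igk_def mult_left_le)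
    also have "\<dots> \<le> v powr (-2)" using that k by (simp add: powr_mono)
    also have "\<dots> = 1 / v ^ 2" using that powr_minus_divide[of v 2] by (simp add: powr_numeral)
    finally show ?thesis .
  qed
  have fin: "(\<integral>\<^sup>+v. ennreal (1 / v\<^sup>2) * indicator {1..} v \<partial>lborel) = ennreal (0 - - 1 / 1)"
  proof (rule nn_integral_FTC_atLeast[where F = "\<lambda>v. - 1 / v"])
    show "((\<lambda>v. - 1 / v) \<longlongrightarrow> (0::real)) at_top" by real_asymp
    show "\<And>x::real. 1 \<le> x \<Longrightarrow> DERIV (\<lambda>v. - 1 / v) x :> 1 / x\<^sup>2"
      by (auto intro!: derivative_eq_intros simp: power2_eq_square)
  qed auto
  have "igk_mass k c \<le> (\<integral>\<^sup>+v. ennreal D * indicator {0..1} v + ennreal (1 / v\<^sup>2) * indicator {1..} v \<partial>lborel)"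
  proof (intro nn_integral_mono)
    fix v :: real
    consider "v \<le> 0" | "0 < v" "v \<le> 1" | "v > 1" by linarith
    then show "ennreal (igk k c v) \<le> ennreal D * indicator {0..1} v + ennreal (1 / v\<^sup>2) * indicator {1..} v"
    proof cases
      case 1 then show ?thesis by (simp add: igk_def)
    next
      case 2
      have "ennreal (igk k c v) \<le> ennreal D" by (intro ennreal_leI b1 2)
      also have "\<dots> \<le> ennreal D * indicator {0..1} v + ennreal (1 / v\<^sup>2) * indicator {1..} v" using 2 by simp
      finally show ?thesis .
    next
      case 3 then show ?thesis using b2[of v] by (simp add: ennreal_leI)
    qed
  qed
  also have "\<dots> = ennreal D + 1"
    by (subst nn_integral_add) (auto simp: nn_integral_cmult_indicator fin)
  also have "\<dots> < \<infinity>" by simp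
  finally show ?thesis .
qed

text \<open>Both tails come from comparing the kernel at \<open>v\<close> with the kernel at \<open>v/2\<close> or \<open>2v\<close>.\<close>

lemma igk_upper_tail:
  assumes k: "k \<ge> 1" and c: "c > 0"
  shows "(\<integral>\<^sup>+v. ennreal (igk k c v) * indicator {2 * c / k<..} v \<partial>lborel)
    \<le> ennreal (exp (- k / 10)) * igk_mass k c"
proof -
  \<comment> \<open>The kernel at \<open>v\<close> is \<open>2 powr (- k - 1) * exp (c / v)\<close>
    times the kernel at \<open>v / 2\<close>, and \<open>c / v \<le> k / 2\<close> beyond the
    cutoff. The Jacobian contributes a factor 2, and \<open>ln 2 \<ge> 2 / 3\<close> leaves the rate
    1/6, more than the 1/10 claimed.\<close>
  define R where "R = 2 powr (- k - 1) * exp (k / 2)"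
  have R: "2 * R \<le> exp (- k / 10)"
  proof -
    have "2 * R = 2 powr (- k) * exp (k / 2)" by (simp add: R_def powr_diff)
    also have "\<dots> = exp (- (k * ln 2) + k / 2)" by (simp add: powr_def exp_add[symmetric])
    also have "\<dots> \<le> exp (- k / 10)"
    proof -
      have "k * (2 / 3) \<le> k * ln 2" using ln2_ge_two_thirds k by (intro mult_left_mono) auto
      then have "- (k * ln 2) + k / 2 \<le> - k / 10" using k by linarith
      then show ?thesis by (simp only: exp_le_cancel_iff)
    qed
    finally show ?thesis .
  qed
  have R0: "R \<ge> 0" by (simp add: R_def)
  have pt: "igk k c v \<le> R * igk k c (v / 2)" if "2 * c / k < v" for v :: real
  proof -
    have v: "v > 0" using that k c by (smt (verit) divide_pos_pos)
    have "c / v \<le> k / 2" using that v k by (simp add: field_simps)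
    then have e: "exp (- c / v) \<le> exp (k / 2) * exp (- c / (v / 2))"
      unfolding exp_add[symmetric] by (simp add: field_simps)
    have p: "v powr (- k - 1) = 2 powr (- k - 1) * (v / 2) powr (- k - 1)"
      using v by (simp add: powr_mult[symmetric])
    show ?thesis using v e by (simp add: igk_def R_def p mult_left_mono mult.assoc mult.left_commute)
  qed
  have "(\<integral>\<^sup>+v. ennreal (igk k c v) * indicator {2 * c / k<..} v \<partial>lborel)
     \<le> (\<integral>\<^sup>+v. ennreal R * ennreal (igk k c (v / 2)) \<partial>lborel)"
    using R0 by (intro nn_integral_mono) (auto simp: indicator_def ennreal_mult[symmetric] igk_nonneg intro!: ennreal_leI pt)
  also have "\<dots> = ennreal R * (\<integral>\<^sup>+v. ennreal (igk k c (v / 2)) \<partial>lborel)"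
    by (rule nn_integral_cmult) measurable
  also have "(\<integral>\<^sup>+v. ennreal (igk k c (v / 2)) \<partial>lborel) = ennreal 2 * igk_mass k c"
    using nn_integral_real_affine[of "\<lambda>v. ennreal (igk k c (v / 2))" 2 0] by simp
  also have "ennreal R * (ennreal 2 * igk_mass k c) = ennreal (2 * R) * igk_mass k c"
    using R0 by (simp add: ennreal_mult mult_ac)
  also have "\<dots> \<le> ennreal (exp (- k / 10)) * igk_mass k c"
    by (intro mult_right_mono ennreal_leI R) simp
  finally show ?thesis .
qed

lemma igk_lower_tail:
  assumes k: "k \<ge> 1" and c: "c > 0"
  shows "(\<integral>\<^sup>+v. ennreal (igk k c v) * indicator {..<c / (4 * k)} v \<partial>lborel)
    \<le> ennreal (exp (- k / 10)) * igk_mass k c"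
proof -
  \<comment> \<open>The kernel at \<open>v\<close> is
    \<open>2 powr (k + 1) * exp (- c / (2 * v))\<close> times the kernel at \<open>2 * v\<close>,
    and \<open>c / (2 * v) \<ge> 2 * k\<close> below the cutoff. The Jacobian contributes 1/2, and
    \<open>ln 2 < 1\<close> leaves the rate 1; the weaker 1/10 is shared with the upper
    tail.\<close>
  define R where "R = 2 powr (k + 1) * exp (- (2 * k))"
  have R: "R / 2 \<le> exp (- k / 10)"
  proof -
    have "R / 2 = 2 powr k * exp (- (2 * k))" by (simp add: R_def powr_add)
    also have "\<dots> = exp (k * ln 2 + - (2 * k))" by (simp add: powr_def exp_add[symmetric])
    also have "\<dots> \<le> exp (- k / 10)"
    proof -
      have "k * ln 2 \<le> k * 1" using ln_2_less_1 k by (intro mult_left_mono) auto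
      then have "k * ln 2 + - (2 * k) \<le> - k / 10" using k by linarith
      then show ?thesis by (simp only: exp_le_cancel_iff)
    qed
    finally show ?thesis .
  qed
  have R0: "R \<ge> 0" by (simp add: R_def)
  have pt: "igk k c v \<le> R * igk k c (2 * v)" if "v < c / (4 * k)" for v :: real
  proof (cases "v > 0")
    case v: True
    have "4 * k * v \<le> c" using that k by (simp add: field_simps)
    then have "2 * k \<le> c / (2 * v)" using v by (simp add: field_simps)
    then have e: "exp (- c / v) \<le> exp (- (2 * k)) * exp (- c / (2 * v))"
      unfolding exp_add[symmetric] by (simp add: field_simps)
    have p: "v powr (- k - 1) = 2 powr (k + 1) * (2 * v) powr (- k - 1)"
    proof -
      have "2 powr (k + 1) * 2 powr (- k - 1) = (1::real)" by (simp add: powr_add[symmetric])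
      then show ?thesis using v by (simp add: powr_mult mult.assoc[symmetric])
    qed
    show ?thesis using v e by (simp add: igk_def R_def p mult_left_mono mult.assoc mult.left_commute)
  qed (simp add: igk_def)
  have "(\<integral>\<^sup>+v. ennreal (igk k c v) * indicator {..<c / (4 * k)} v \<partial>lborel)
     \<le> (\<integral>\<^sup>+v. ennreal R * ennreal (igk k c (2 * v)) \<partial>lborel)"
    using R0 by (intro nn_integral_mono) (auto simp: indicator_def ennreal_mult[symmetric] igk_nonneg intro!: ennreal_leI pt)
  also have "\<dots> = ennreal R * (\<integral>\<^sup>+v. ennreal (igk k c (2 * v)) \<partial>lborel)"
    by (rule nn_integral_cmult) measurable
  also have "(\<integral>\<^sup>+v. ennreal (igk k c (2 * v)) \<partial>lborel) = ennreal (1/2) * igk_mass k c"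
    using nn_integral_real_affine[of "\<lambda>v. ennreal (igk k c (2 * v))" "1/2" 0] by simp
  also have "ennreal R * (ennreal (1/2) * igk_mass k c) = ennreal (R / 2) * igk_mass k c"
  proof -
    have "ennreal (R / 2) = ennreal R * ennreal (1/2)" using R0 ennreal_mult[of R "1/2"] by simp
    then show ?thesis by (simp add: mult.assoc)
  qed
  also have "\<dots> \<le> ennreal (exp (- k / 10)) * igk_mass k c"
    by (intro mult_right_mono ennreal_leI R) simp
  finally show ?thesis .
qed

text \<open>\<open>T\<close> is the exceptional set of variances: on it the trivial bound is used at
  the cost of the tail mass, off it the fraction \<open>r\<close> holds slice by slice.\<close>

lemma igk_split_bound:
  assumes r: "r \<ge> 0" and T[measurable]: "T \<in> sets borel"
    and tail: "(\<integral>\<^sup>+v. ennreal (igk k c v) * indicator T v \<partial>lborel) \<le> ennreal (exp (- k / 10)) * igk_mass k c"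
    and K1: "\<And>v. v > 0 \<Longrightarrow> K v \<le> ennreal (igk k c v)" and K0: "\<And>v. v \<le> 0 \<Longrightarrow> K v = 0"
    and K2: "\<And>v. v > 0 \<Longrightarrow> v \<notin> T \<Longrightarrow> K v \<le> ennreal r * ennreal (igk k c v)"
  shows "(\<integral>\<^sup>+v. K v \<partial>lborel) \<le> ennreal (r + exp (- k / 10)) * igk_mass k c"
proof -
  have "(\<integral>\<^sup>+v. K v \<partial>lborel) \<le> (\<integral>\<^sup>+v. ennreal r * ennreal (igk k c v) + ennreal (igk k c v) * indicator T v \<partial>lborel)"
  proof (intro nn_integral_mono)
    fix v :: real
    consider "v \<le> 0" | "v > 0" "v \<in> T" | "v > 0" "v \<notin> T" by linarith
    then show "K v \<le> ennreal r * ennreal (igk k c v) + ennreal (igk k c v) * indicator T v"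
      by cases (auto simp: K0 K2 intro: order_trans[OF K1])
  qed
  also have "\<dots> = ennreal r * igk_mass k c + (\<integral>\<^sup>+v. ennreal (igk k c v) * indicator T v \<partial>lborel)"
    by (subst nn_integral_add) (auto simp: nn_integral_cmult)
  also have "\<dots> \<le> ennreal r * igk_mass k c + ennreal (exp (- k / 10)) * igk_mass k c"
    by (intro add_left_mono tail)
  finally show ?thesis using r by (simp add: distrib_right)
qed

section \<open>Gaussian and inverse gamma mixtures\<close>

text \<open>The posterior up to normalisation, freed from matrices: given \<open>v\<close>, a
  Gaussian with mean \<open>m\<close> and precision \<open>A / (\<theta> * v)\<close>, where
  \<open>v\<close> is inverse gamma with shape \<open>k\<close> and scale \<open>c\<close>. The
  assumption \<open>dual\<close> provides the rows of the inverse of \<open>A\<close> as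
  representers of the coordinates.\<close>

locale gauss_igk =
  fixes p :: nat and A :: "nat \<Rightarrow> nat \<Rightarrow> real" and \<kappa> K \<theta> k c :: real and m :: "nat \<Rightarrow> real"
  assumes sym: "sym_coeffs p A"
    and kappa: "\<kappa> > 0" and low: "\<And>x. \<kappa> * (\<Sum>i<p. (x i)\<^sup>2) \<le> bil p A x x"
    and diag: "\<And>i. i < p \<Longrightarrow> A i i \<le> K" and K: "K \<ge> 0"
    and dual: "\<And>i. i < p \<Longrightarrow> \<exists>y. \<forall>x. bil p A y x = x i"
    and theta: "\<theta> > 0" and k: "k \<ge> 1" and c: "c > 0"
begin

text \<open>The additional \<open>p / 2\<close> in the exponent is the missing normalisation of the
  Gaussian factor; integrating over \<open>x\<close> cancels it and leaves a multiple of
  \<open>igk k c\<close>.\<close>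

definition kern :: "(nat \<Rightarrow> real) \<times> real \<Rightarrow> real" where
  "kern = (\<lambda>(x, v). if v > 0 then v powr (- (k + p / 2) - 1) *
     exp (- bil p A (\<lambda>i. x i - m i) (\<lambda>i. x i - m i) / (2 * (\<theta> * v)) - c / v) else 0)"

abbreviation PM :: "((nat \<Rightarrow> real) \<times> real) measure" where "PM \<equiv> param_measure p"

abbreviation kern_mass :: ennreal where
  "kern_mass \<equiv> (\<integral>\<^sup>+z. ennreal (kern z) \<partial>PM)"

lemma diag_pos: "i < p \<Longrightarrow> A i i > 0"
proof -
  assume i: "i < p"
  have "(\<Sum>j<p. (if j = i then 1 else 0 :: real)\<^sup>2) = 1"
    using i by (simp add: if_distrib[of "\<lambda>x. x\<^sup>2"] cong: if_cong)
  then show ?thesis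
    using low[of "\<lambda>j. if j = i then 1 else 0"] kappa bil_unit_unit[OF i, of A] by simp
qed

lemma kern_nonneg: "kern z \<ge> 0"
  by (simp add: kern_def split: prod.split)

lemma measurable_kern[measurable]: "kern \<in> borel_measurable PM"
  unfolding kern_def split_def
  by (intro measurable_If borel_measurable_times measurable_bil borel_measurable_exp borel_measurable_diff borel_measurable_divide borel_measurable_uminus) measurable

lemma pair_sigma_finite_param: "pair_sigma_finite (Lb {..<p}) (lborel :: real measure)"
  by (intro pair_sigma_finite.intro lborel_PiM.sigma_finite sigma_finite_lborel) simp

definition Z where "Z = (\<integral>\<^sup>+x. ennreal (exp (- bil p A x x / 2)) \<partial>Lb {..<p})"
definition C where "C = ennreal (sqrt \<theta> ^ p) * Z"

lemma Z: "0 < Z" "Z < \<infinity>"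
  unfolding Z_def using gauss_pos gauss_finite[OF kappa low] by auto

lemma C: "0 < C" "C < \<infinity>"
  using Z theta by (auto simp: C_def ennreal_zero_less_mult_iff ennreal_mult_less_top)

abbreviation gk where "gk v x \<equiv> ennreal (exp (- bil p A (\<lambda>i. x i - m i) (\<lambda>i. x i - m i) / (2 * (\<theta> * v))))"

lemma kern_slice:
  assumes v: "v > 0"
  shows "ennreal (kern (x, v)) = ennreal (v powr (- (k + p / 2) - 1) * exp (- c / v)) * gk v x"
proof -
  have "exp (- bil p A (\<lambda>i. x i - m i) (\<lambda>i. x i - m i) / (2 * (\<theta> * v)) - c / v) =
     exp (- c / v) * exp (- bil p A (\<lambda>i. x i - m i) (\<lambda>i. x i - m i) / (2 * (\<theta> * v)))"
    unfolding exp_add[symmetric] by simp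
  then show ?thesis using v by (simp add: kern_def ennreal_mult mult.assoc)
qed

lemma gk_total:
  assumes v: "v > 0"
  shows "ennreal (v powr (- (k + p / 2) - 1) * exp (- c / v)) * (\<integral>\<^sup>+x. gk v x \<partial>Lb {..<p}) = C * ennreal (igk k c v)"
proof -
  have "sqrt (\<theta> * v) ^ p = sqrt \<theta> ^ p * v powr (p / 2)"
    using v theta by (simp add: real_sqrt_mult power_mult_distrib powr_half_sqrt[symmetric] powr_realpow[symmetric] powr_powr)
  then have *: "ennreal (v powr (- (k + p / 2) - 1) * exp (- c / v)) * ennreal (sqrt (\<theta> * v) ^ p) =
     ennreal (v powr (- (k + p / 2) - 1) * exp (- c / v) * (sqrt \<theta> ^ p * v powr (p / 2)))"
    using theta by (simp only: ennreal_mult'[symmetric] mult_nonneg_nonneg powr_ge_zero exp_ge_zero)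
  also have "v powr (- (k + p / 2) - 1) * exp (- c / v) * (sqrt \<theta> ^ p * v powr (p / 2)) = sqrt \<theta> ^ p * ((v powr (- (k + p / 2) - 1) * v powr (p / 2)) * exp (- c / v))"
    by simp
  also have "v powr (- (k + p / 2) - 1) * v powr (p / 2) = v powr (- k - 1)"
    unfolding powr_add[symmetric] by (rule arg_cong[where f = "(powr) v"]) simp
  also have "sqrt \<theta> ^ p * (v powr (- k - 1) * exp (- c / v)) = sqrt \<theta> ^ p * igk k c v" using v by (simp add: igk_def)
  finally have e: "ennreal (v powr (- (k + p / 2) - 1) * exp (- c / v)) * ennreal (sqrt (\<theta> * v) ^ p) = ennreal (sqrt \<theta> ^ p * igk k c v)" .
  have w: "\<theta> * v > 0" using v theta by simp
  have "ennreal (sqrt \<theta> ^ p * igk k c v) = ennreal (sqrt \<theta> ^ p) * ennreal (igk k c v)"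
    using theta by (intro ennreal_mult) (auto simp: igk_nonneg)
  moreover have "ennreal (v powr (- (k + p / 2) - 1) * exp (- c / v)) * (\<integral>\<^sup>+x. gk v x \<partial>Lb {..<p})
    = (ennreal (v powr (- (k + p / 2) - 1) * exp (- c / v)) * ennreal (sqrt (\<theta> * v) ^ p)) * Z"
    unfolding gauss_scale[OF w] Z_def by (rule mult.assoc[symmetric])
  ultimately show ?thesis unfolding e C_def by (simp only: mult_ac)
qed

lemma kern_split:
  assumes E[measurable]: "E \<in> sets (Lb {..<p})"
  shows "(\<integral>\<^sup>+z. ennreal (kern z) * indicator E (fst z) \<partial>PM) =
    (\<integral>\<^sup>+v. (\<integral>\<^sup>+x. ennreal (kern (x, v)) * indicator E x \<partial>Lb {..<p}) \<partial>lborel)"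
proof -
  have "(\<lambda>z. ennreal (kern z) * indicator E (fst z)) \<in> borel_measurable PM" by measurable
  from pair_sigma_finite.nn_integral_snd[OF pair_sigma_finite_param this] show ?thesis by simp
qed

lemma kern_slice_ind:
  assumes v: "v > 0" and E[measurable]: "E \<in> sets (Lb {..<p})"
  shows "(\<integral>\<^sup>+x. ennreal (kern (x, v)) * indicator E x \<partial>Lb {..<p})
    = ennreal (v powr (- (k + p / 2) - 1) * exp (- c / v)) * (\<integral>\<^sup>+x. gk v x * indicator E x \<partial>Lb {..<p})"
proof -
  have gm: "gk v \<in> borel_measurable (Lb {..<p})" by measurable
  have "(\<lambda>x. gk v x * indicator E x) \<in> borel_measurable (Lb {..<p})"
    by (intro borel_measurable_times_ennreal gm borel_measurable_indicator E)
  from nn_integral_cmult[OF this] show ?thesis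
    by (simp add: kern_slice[OF v] mult.assoc)
qed

lemma kern_total: "kern_mass = C * igk_mass k c"
proof -
  have "kern_mass = (\<integral>\<^sup>+z. ennreal (kern z) * indicator (space (Lb {..<p})) (fst z) \<partial>PM)"
    by (intro nn_integral_cong) (auto simp: space_pair_measure)
  also have "\<dots> = (\<integral>\<^sup>+v. (\<integral>\<^sup>+x. ennreal (kern (x, v)) * indicator (space (Lb {..<p})) x \<partial>Lb {..<p}) \<partial>lborel)"
    by (rule kern_split) simp
  also have "\<dots> = (\<integral>\<^sup>+v. C * ennreal (igk k c v) \<partial>lborel)"
  proof (intro nn_integral_cong)
    fix v :: real
    show "(\<integral>\<^sup>+x. ennreal (kern (x, v)) * indicator (space (Lb {..<p})) x \<partial>Lb {..<p}) = C * ennreal (igk k c v)"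
    proof (cases "v > 0")
      case True
      have "(\<integral>\<^sup>+x. gk v x * indicator (space (Lb {..<p})) x \<partial>Lb {..<p}) = (\<integral>\<^sup>+x. gk v x \<partial>Lb {..<p})"
        by (intro nn_integral_cong) simp
      then show ?thesis using kern_slice_ind[OF True sets.top] gk_total[OF True] by simp
    qed (simp add: kern_def igk_def)
  qed
  also have "\<dots> = C * igk_mass k c" by (rule nn_integral_cmult) measurable
  finally show ?thesis .
qed

lemma kern_proper: "0 < kern_mass" "kern_mass < \<infinity>"
  unfolding kern_total using C igk_pos[of k c] igk_finite[OF k c]
  by (auto simp: ennreal_zero_less_mult_iff ennreal_mult_less_top)

text \<open>By Tonelli the mass is an integral over the variance of Gaussian masses. A bound by the
  same fraction of every slice survives the integration, up to the mass of the exceptional variances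
  \<open>T\<close>.\<close>

lemma kern_bound:
  assumes E[measurable]: "E \<in> sets (Lb {..<p})" and r: "r \<ge> 0" and T: "T \<in> sets borel"
    and tail: "(\<integral>\<^sup>+v. ennreal (igk k c v) * indicator T v \<partial>lborel) \<le> ennreal (exp (- k / 10)) * igk_mass k c"
    and le: "\<And>v. v > 0 \<Longrightarrow> v \<notin> T \<Longrightarrow> (\<integral>\<^sup>+x. gk v x * indicator E x \<partial>Lb {..<p}) \<le> ennreal r * (\<integral>\<^sup>+x. gk v x \<partial>Lb {..<p})"
  shows "(\<integral>\<^sup>+z. ennreal (kern z) * indicator E (fst z) \<partial>PM) \<le> ennreal (r + exp (- k / 10)) * kern_mass"
proof -
  define Q where "Q v = (\<integral>\<^sup>+x. ennreal (kern (x, v)) * indicator E x \<partial>Lb {..<p})" for v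
  have Q1: "Q v \<le> C * ennreal (igk k c v)" if v: "v > 0" for v
  proof -
    have "(\<integral>\<^sup>+x. gk v x * indicator E x \<partial>Lb {..<p}) \<le> (\<integral>\<^sup>+x. gk v x \<partial>Lb {..<p})"
      by (intro nn_integral_mono) (auto simp: indicator_def)
    then show ?thesis unfolding Q_def kern_slice_ind[OF v E] gk_total[OF v, symmetric] by (rule mult_left_mono) simp
  qed
  have Q2: "Q v \<le> ennreal r * (C * ennreal (igk k c v))" if v: "v > 0" "v \<notin> T" for v
  proof -
    have "Q v \<le> ennreal (v powr (- (k + p / 2) - 1) * exp (- c / v)) * (ennreal r * (\<integral>\<^sup>+x. gk v x \<partial>Lb {..<p}))"
      unfolding Q_def kern_slice_ind[OF v(1) E] by (intro mult_left_mono le v) simp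
    then show ?thesis unfolding gk_total[OF v(1), symmetric] by (simp add: mult_ac)
  qed
  have Q0: "Q v = 0" if "v \<le> 0" for v using that by (simp add: Q_def kern_def)
  \<comment> \<open>\<open>C\<close> lies strictly between 0 and infinity, so slices can be divided
    by it; the full slice at \<open>v\<close> then becomes \<open>igk k c v\<close>, as
    \<open>igk_split_bound\<close> expects.\<close>
  have inv: "inverse C * (C * x) = x" for x
  proof -
    have "C * inverse C = 1" using ennreal_divide_self[of C] C by (simp add: divide_ennreal_def)
    then show ?thesis by (metis mult.assoc mult.commute mult_1)
  qed
  have inv2: "inverse C * (ennreal r * (C * x)) = ennreal r * x" for x
    by (metis inv mult.left_commute)
  have Qm: "Q \<in> borel_measurable borel"
  proof -
    have "(\<lambda>z. ennreal (kern z) * indicator E (fst z)) \<in> borel_measurable PM" by measurable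
    then have "(\<lambda>v. \<integral>\<^sup>+x. ennreal (kern (fst (x, v), snd (x, v))) * indicator E (fst (x, v)) \<partial>Lb {..<p}) \<in> borel_measurable lborel"
      by (intro sigma_finite_measure.borel_measurable_nn_integral lborel_PiM.sigma_finite) measurable
    then show ?thesis by (simp add: Q_def[abs_def])
  qed
  have "(\<integral>\<^sup>+v. inverse C * Q v \<partial>lborel) \<le> ennreal (r + exp (- k / 10)) * igk_mass k c"
  proof (rule igk_split_bound[OF r T tail])
    fix v :: real assume "0 < v"
    from mult_left_mono[OF Q1[OF this], of "inverse C"] show "inverse C * Q v \<le> ennreal (igk k c v)" by (simp add: inv)
  next
    fix v :: real assume "0 < v" "v \<notin> T"
    from mult_left_mono[OF Q2[OF this], of "inverse C"]
    show "inverse C * Q v \<le> ennreal r * ennreal (igk k c v)" by (simp add: inv2)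
  qed (simp add: Q0)
  then have "C * (\<integral>\<^sup>+v. inverse C * Q v \<partial>lborel) \<le> C * (ennreal (r + exp (- k / 10)) * igk_mass k c)"
    by (rule mult_left_mono) simp
  also have "C * (\<integral>\<^sup>+v. inverse C * Q v \<partial>lborel) = (\<integral>\<^sup>+v. Q v \<partial>lborel)"
    using Qm inv by (subst nn_integral_cmult) (auto simp: mult.left_commute)
  finally show ?thesis unfolding kern_split[OF E] kern_total Q_def[symmetric] by (simp add: mult_ac)
qed

text \<open>Union bound over the \<open>2 * p\<close> coordinate half-spaces. Large variances are
  the harmful ones here; below the upper cutoff the worst is \<open>v = 2 * c / k\<close>, which
  produces the stated exponent.\<close>

lemma kern_concentration:
  assumes e: "\<epsilon> > 0"
  shows "(\<integral>\<^sup>+z. ennreal (kern z) * indicator {x \<in> space (Lb {..<p}). \<exists>i<p. \<epsilon> \<le> \<bar>x i - m i\<bar>} (fst z) \<partial>PM)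
    \<le> ennreal (2 * p * exp (- \<kappa> * \<epsilon>\<^sup>2 * k / (4 * \<theta> * c)) + exp (- k / 10)) * kern_mass"
proof (rule kern_bound[OF _ _ _ igk_upper_tail[OF k c]])
  let ?E = "{x \<in> space (Lb {..<p}). \<exists>i<p. \<epsilon> \<le> \<bar>x i - m i\<bar>}"
  show "?E \<in> sets (Lb {..<p})" by measurable
  fix v assume v: "0 < v" "v \<notin> {2 * c / k<..}"
  have w: "\<theta> * v > 0" using v theta by simp
  let ?t = "ennreal (exp (- \<kappa> * \<epsilon>\<^sup>2 / (2 * (\<theta> * v))))"
  let ?F = "\<lambda>s i x. gk v x * indicator {x. \<epsilon> \<le> s * (x i - m i)} x"
  have gm: "gk v \<in> borel_measurable (Lb {..<p})" by measurable
  have Fm: "?F s i \<in> borel_measurable (Lb {..<p})" if "i < p" for s i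
  proof -
    have "(\<lambda>x. indicator {z. \<epsilon> \<le> s * (z - m i)} (x i) :: ennreal) \<in> borel_measurable (Lb {..<p})"
      using that by measurable
    then have "(\<lambda>x. gk v x * indicator {z. \<epsilon> \<le> s * (z - m i)} (x i)) \<in> borel_measurable (Lb {..<p})"
      by (intro borel_measurable_times_ennreal gm)
    then show ?thesis by (simp add: indicator_def)
  qed
  have one: "(\<integral>\<^sup>+x. ?F s i x \<partial>Lb {..<p}) \<le> ?t * (\<integral>\<^sup>+x. gk v x \<partial>Lb {..<p})" if "i < p" "\<bar>s\<bar> = 1" for s i
  proof -
    from dual[OF that(1)] obtain y where "\<forall>x. bil p A y x = x i" by blast
    then have y: "\<And>x. bil p A y x = x i" by simp
    show ?thesis by (rule gauss_coord_tail[OF sym w kappa low that(1) y that(2) e])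
  qed
  have "(\<integral>\<^sup>+x. gk v x * indicator ?E x \<partial>Lb {..<p}) \<le> (\<integral>\<^sup>+x. (\<Sum>i<p. ?F 1 i x + ?F (-1) i x) \<partial>Lb {..<p})"
  proof (intro nn_integral_mono)
    fix x
    show "gk v x * indicator ?E x \<le> (\<Sum>i<p. ?F 1 i x + ?F (-1) i x)"
    proof (cases "x \<in> ?E")
      case True
      then obtain i where i: "i < p" "\<epsilon> \<le> \<bar>x i - m i\<bar>" by auto
      then have "1 \<le> (indicator {x. \<epsilon> \<le> 1 * (x i - m i)} x + indicator {x. \<epsilon> \<le> -1 * (x i - m i)} x :: ennreal)"
        by (auto simp: indicator_def abs_if split: if_splits)
      then have "gk v x * 1 \<le> gk v x * (indicator {x. \<epsilon> \<le> 1 * (x i - m i)} x + indicator {x. \<epsilon> \<le> -1 * (x i - m i)} x)"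
        by (rule mult_left_mono) simp
      also have "\<dots> = ?F 1 i x + ?F (-1) i x" by (simp add: distrib_left)
      also have "\<dots> \<le> (\<Sum>i<p. ?F 1 i x + ?F (-1) i x)"
        using i by (intro member_le_sum[of i "{..<p}" "\<lambda>i. ?F 1 i x + ?F (-1) i x"]) auto
      finally show ?thesis using True by simp
    qed simp
  qed
  also have "\<dots> = (\<Sum>i<p. (\<integral>\<^sup>+x. ?F 1 i x \<partial>Lb {..<p}) + (\<integral>\<^sup>+x. ?F (-1) i x \<partial>Lb {..<p}))"
  proof -
    have "(\<integral>\<^sup>+x. (\<Sum>i<p. ?F 1 i x + ?F (-1) i x) \<partial>Lb {..<p}) = (\<Sum>i<p. (\<integral>\<^sup>+x. ?F 1 i x + ?F (-1) i x \<partial>Lb {..<p}))"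
      by (intro nn_integral_sum borel_measurable_add Fm) auto
    also have "\<dots> = (\<Sum>i<p. (\<integral>\<^sup>+x. ?F 1 i x \<partial>Lb {..<p}) + (\<integral>\<^sup>+x. ?F (-1) i x \<partial>Lb {..<p}))"
      by (intro sum.cong refl nn_integral_add Fm) auto
    finally show ?thesis .
  qed
  also have "\<dots> \<le> (\<Sum>i<p. ?t * (\<integral>\<^sup>+x. gk v x \<partial>Lb {..<p}) + ?t * (\<integral>\<^sup>+x. gk v x \<partial>Lb {..<p}))"
    by (intro sum_mono add_mono one) auto
  also have "\<dots> = ennreal (2 * p) * (?t * (\<integral>\<^sup>+x. gk v x \<partial>Lb {..<p}))"
    by (simp add: mult_2[symmetric] ennreal_mult mult_ac ennreal_of_nat_eq_real_of_nat)
  also have "\<dots> \<le> ennreal (2 * p) * (ennreal (exp (- \<kappa> * \<epsilon>\<^sup>2 * k / (4 * \<theta> * c))) * (\<integral>\<^sup>+x. gk v x \<partial>Lb {..<p}))"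
  proof (intro mult_left_mono mult_right_mono ennreal_leI)
    have "v * k \<le> 2 * c" using v k by (simp add: field_simps not_less)
    have "k / (4 * \<theta> * c) = (v * k) / (4 * \<theta> * c * v)" using v by simp
    also have "\<dots> \<le> (2 * c) / (4 * \<theta> * c * v)" using \<open>v * k \<le> 2 * c\<close> v theta c by (intro divide_right_mono) auto
    also have "\<dots> = 1 / (2 * (\<theta> * v))" using v theta c by (simp add: field_simps)
    finally have "\<kappa> * \<epsilon>\<^sup>2 * (k / (4 * \<theta> * c)) \<le> \<kappa> * \<epsilon>\<^sup>2 * (1 / (2 * (\<theta> * v)))" using kappa by (intro mult_left_mono) auto
    then show "exp (- \<kappa> * \<epsilon>\<^sup>2 / (2 * (\<theta> * v))) \<le> exp (- \<kappa> * \<epsilon>\<^sup>2 * k / (4 * \<theta> * c))" by simp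
  qed auto
  finally show "(\<integral>\<^sup>+x. gk v x * indicator ?E x \<partial>Lb {..<p}) \<le> ennreal (2 * p * exp (- \<kappa> * \<epsilon>\<^sup>2 * k / (4 * \<theta> * c))) * (\<integral>\<^sup>+x. gk v x \<partial>Lb {..<p})"
    by (simp add: ennreal_mult mult.assoc)
qed auto

text \<open>Here small variances are the harmful ones, since they favour a box; above the lower
  cutoff the worst is \<open>v = c / (4 * k)\<close>.\<close>

lemma kern_box:
  assumes e: "\<epsilon> > 0"
  shows "(\<integral>\<^sup>+z. ennreal (kern z) * indicator {x \<in> space (Lb {..<p}). \<forall>i<p. \<bar>x i - b i\<bar> \<le> \<epsilon>} (fst z) \<partial>PM)
    \<le> ennreal (exp (- real p * (exp (- 1 - \<epsilon>\<^sup>2 * K * (4 * k) / (\<theta> * c)) / sqrt (2 * pi))) + exp (- k / 10)) * kern_mass"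
proof (rule kern_bound[OF _ _ _ igk_lower_tail[OF k c]])
  let ?E = "{x \<in> space (Lb {..<p}). \<forall>i<p. \<bar>x i - b i\<bar> \<le> \<epsilon>}"
  show "?E \<in> sets (Lb {..<p})" by measurable
  fix v assume v: "0 < v" "v \<notin> {..<c / (4 * k)}"
  have w: "\<theta> * v > 0" using v theta by simp
  have r: "\<epsilon>\<^sup>2 * K / (\<theta> * v) \<le> \<epsilon>\<^sup>2 * K * (4 * k) / (\<theta> * c)"
  proof -
    have "c \<le> v * (4 * k)" using v k by (simp add: field_simps not_less)
    have "1 / (\<theta> * v) = c / (\<theta> * c * v)" using c by simp
    also have "\<dots> \<le> (v * (4 * k)) / (\<theta> * c * v)" using \<open>c \<le> v * (4 * k)\<close> v theta c by (intro divide_right_mono) auto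
    also have "\<dots> = 4 * k / (\<theta> * c)" using v by (simp add: field_simps)
    finally have "\<epsilon>\<^sup>2 * K * (1 / (\<theta> * v)) \<le> \<epsilon>\<^sup>2 * K * (4 * k / (\<theta> * c))" using K by (intro mult_left_mono) auto
    then show ?thesis by simp
  qed
  have r0: "\<epsilon>\<^sup>2 * K / (\<theta> * v) \<ge> 0" using K w by simp
  have "(\<integral>\<^sup>+x. gk v x * indicator ?E x \<partial>Lb {..<p}) \<le> (\<integral>\<^sup>+x. gk v x * indicator {x. \<forall>i<p. \<bar>x i - b i\<bar> \<le> \<epsilon>} x \<partial>Lb {..<p})"
    by (intro nn_integral_mono) (auto simp: indicator_def)
  also have "\<dots> \<le> ennreal (box_factor (\<epsilon>\<^sup>2 * K / (\<theta> * v)) ^ p) * (\<integral>\<^sup>+x. gk v x \<partial>Lb {..<p})"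
    using e by (intro gauss_box[OF sym w]) (auto simp: diag diag_pos K)
  also have "\<dots> \<le> ennreal (exp (- real p * (exp (- 1 - \<epsilon>\<^sup>2 * K * (4 * k) / (\<theta> * c)) / sqrt (2 * pi)))) * (\<integral>\<^sup>+x. gk v x \<partial>Lb {..<p})"
  proof (intro mult_right_mono ennreal_leI)
    have "box_factor (\<epsilon>\<^sup>2 * K / (\<theta> * v)) ^ p \<le> box_factor (\<epsilon>\<^sup>2 * K * (4 * k) / (\<theta> * c)) ^ p"
      by (intro power_mono box_factor_mono box_factor_nonneg r r0)
    also have "\<dots> \<le> exp (- real p * (exp (- 1 - \<epsilon>\<^sup>2 * K * (4 * k) / (\<theta> * c)) / sqrt (2 * pi)))"
      by (intro box_factor_power_le order_trans[OF r0 r])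
    finally show "box_factor (\<epsilon>\<^sup>2 * K / (\<theta> * v)) ^ p \<le> exp (- real p * (exp (- 1 - \<epsilon>\<^sup>2 * K * (4 * k) / (\<theta> * c)) / sqrt (2 * pi)))" .
  qed auto
  finally show "(\<integral>\<^sup>+x. gk v x * indicator ?E x \<partial>Lb {..<p}) \<le> ennreal (exp (- real p * (exp (- 1 - \<epsilon>\<^sup>2 * K * (4 * k) / (\<theta> * c)) / sqrt (2 * pi)))) * (\<integral>\<^sup>+x. gk v x \<partial>Lb {..<p})" .
qed auto

end

section \<open>Extreme eigenvalues and the design matrix\<close>

lemma mult_mat_vec_index:
  assumes "A \<in> carrier_mat r p" "i < r"
  shows "vec_index (A *\<^sub>v Matrix.vec p x) i = (\<Sum>j<p. A $$ (i, j) * (x j :: real))"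
  using assms by (simp add: mult_mat_vec_def scalar_prod_def atLeast0LessThan)

lemma scalar_prod_vec: "scalar_prod (Matrix.vec p x) (Matrix.vec p y) = (\<Sum>i<p. x i * y i)"
  by (simp add: scalar_prod_def atLeast0LessThan)

lemma vec_eta: "v \<in> carrier_vec p \<Longrightarrow> Matrix.vec p (vec_index v) = v"
  by auto

lemma bil_mat:
  assumes "A \<in> carrier_mat p p"
  shows "bil p (\<lambda>i j. A $$ (i, j)) x y = scalar_prod (Matrix.vec p x) (A *\<^sub>v Matrix.vec p y)"
proof -
  have "scalar_prod (Matrix.vec p x) (A *\<^sub>v Matrix.vec p y) = (\<Sum>i<p. x i * (\<Sum>j<p. A $$ (i, j) * y j))"
    using assms by (simp add: scalar_prod_def atLeast0LessThan mult_mat_vec_index[of A p p])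
  then show ?thesis by (simp add: bil_def sum_distrib_left mult_ac)
qed

text \<open>A crude bound that makes the Rayleigh quotients bounded above; the sharp constant is
  then found as an eigenvalue.\<close>

lemma bil_le_sum_abs: "bil p A x x \<le> (\<Sum>i<p. \<Sum>j<p. \<bar>A i j\<bar>) * (\<Sum>i<p. (x i)\<^sup>2)"
proof -
  have "bil p A x x \<le> (\<Sum>i<p. \<Sum>j<p. \<bar>A i j\<bar> * (\<Sum>l<p. (x l)\<^sup>2))"
    unfolding bil_def
  proof (intro sum_mono)
    fix i j assume ij: "i \<in> {..<p}" "j \<in> {..<p}"
    have m: "(x l)\<^sup>2 \<le> (\<Sum>l<p. (x l)\<^sup>2)" if "l \<in> {..<p}" for l
      using that by (intro member_le_sum[of l "{..<p}" "\<lambda>l. (x l)\<^sup>2"]) auto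
    have "\<bar>x i * x j\<bar> \<le> ((x i)\<^sup>2 + (x j)\<^sup>2) / 2"
      using sum_squares_bound[of "\<bar>x i\<bar>" "\<bar>x j\<bar>"] by (simp add: abs_mult)
    also have "\<dots> \<le> (\<Sum>l<p. (x l)\<^sup>2)" using m[OF ij(1)] m[OF ij(2)] by simp
    finally have "\<bar>A i j\<bar> * \<bar>x i * x j\<bar> \<le> \<bar>A i j\<bar> * (\<Sum>l<p. (x l)\<^sup>2)" by (rule mult_left_mono) simp
    then show "A i j * x i * x j \<le> \<bar>A i j\<bar> * (\<Sum>l<p. (x l)\<^sup>2)"
      using abs_ge_self[of "A i j * (x i * x j)"] by (simp add: abs_mult mult.assoc)
  qed
  then show ?thesis by (simp add: sum_distrib_right)
qed

lemma smult_mat_mult_vec: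
  assumes "A \<in> carrier_mat r p" "x \<in> carrier_vec p"
  shows "(k \<cdot>\<^sub>m A) *\<^sub>v x = k \<cdot>\<^sub>v (A *\<^sub>v (x :: real Matrix.vec))"
proof (intro eq_vecI)
  fix i assume "i < dim_vec (k \<cdot>\<^sub>v (A *\<^sub>v x))"
  then have i: "i < r" using assms by simp
  then have "Matrix.row (k \<cdot>\<^sub>m A) i = k \<cdot>\<^sub>v Matrix.row A i" using assms by auto
  then show "vec_index ((k \<cdot>\<^sub>m A) *\<^sub>v x) i = vec_index (k \<cdot>\<^sub>v (A *\<^sub>v x)) i"
    using i assms by (simp add: smult_scalar_prod_distrib[of _ p])
qed (use assms in auto)

lemma mult_mat_vec_bounded:
  fixes R :: "real Matrix.mat"
  assumes R: "R \<in> carrier_mat p p"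
  shows "\<exists>r>0. \<forall>x. (\<Sum>i<p. (vec_index (R *\<^sub>v Matrix.vec p x) i)\<^sup>2) \<le> r * (\<Sum>i<p. (x i)\<^sup>2)"
proof -
  let ?c = "\<Sum>i<p. \<Sum>j<p. (R $$ (i, j))\<^sup>2"
  have "(\<Sum>i<p. (vec_index (R *\<^sub>v Matrix.vec p x) i)\<^sup>2) \<le> (?c + 1) * (\<Sum>i<p. (x i)\<^sup>2)" for x
  proof -
    have "(\<Sum>i<p. (vec_index (R *\<^sub>v Matrix.vec p x) i)\<^sup>2) = (\<Sum>i<p. (\<Sum>j<p. R $$ (i, j) * x j)\<^sup>2)"
      by (intro sum.cong refl) (simp add: mult_mat_vec_index[OF R] del: index_mult_mat_vec)
    also have "\<dots> \<le> (\<Sum>i<p. (\<Sum>j<p. (R $$ (i, j))\<^sup>2) * (\<Sum>j<p. (x j)\<^sup>2))"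
      by (intro sum_mono Cauchy_Schwarz_ineq_sum)
    also have "\<dots> = ?c * (\<Sum>i<p. (x i)\<^sup>2)" by (simp add: sum_distrib_right)
    also have "\<dots> \<le> (?c + 1) * (\<Sum>i<p. (x i)\<^sup>2)" by (intro mult_right_mono sum_nonneg) auto
    finally show ?thesis .
  qed
  moreover have "?c + 1 > 0" by (smt (verit) sum_nonneg zero_le_power2)
  ultimately show ?thesis by blast
qed

text \<open>If the supremum \<open>M\<close> of the Rayleigh quotient were no eigenvalue, then \<open>M I - A\<close> would be
  positive semidefinite and invertible, hence bounded below, and \<open>M\<close> could be decreased.\<close>

lemma rayleigh_sup_eigenvector:
  fixes A :: "real Matrix.mat"
  assumes A: "A \<in> carrier_mat p p" and sym: "sym_coeffs p (\<lambda>i j. A $$ (i, j))" and p: "p > 0"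
  obtains M v where "v \<in> carrier_vec p" "v \<noteq> 0\<^sub>v p" "A *\<^sub>v v = M \<cdot>\<^sub>v v"
    "\<And>x. bil p (\<lambda>i j. A $$ (i, j)) x x \<le> M * (\<Sum>i<p. (x i)\<^sup>2)"
proof -
  let ?A = "\<lambda>i j. A $$ (i, j)"
  let ?Q = "\<lambda>x. bil p ?A x x"
  let ?N = "\<lambda>x. \<Sum>i<p. (x i :: real)\<^sup>2"
  have N0: "?N x \<ge> 0" for x by (simp add: sum_nonneg)
  define S where "S = {?Q x / ?N x | x. ?N x > 0}"
  have bdd: "bdd_above S"
    unfolding bdd_above_def S_def
    by (intro exI[of _ "\<Sum>i<p. \<Sum>j<p. \<bar>?A i j\<bar>"]) (auto simp: pos_divide_le_eq bil_le_sum_abs)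
  have "?N (\<lambda>_. 1) > 0" using p by simp
  then have "?Q (\<lambda>_. 1) / ?N (\<lambda>_. 1) \<in> S"
    unfolding S_def by (intro CollectI exI[of _ "\<lambda>_. 1"] conjI refl)
  then have ne: "S \<noteq> {}" by (metis empty_iff)
  define M where "M = Sup S"
  have Q_le: "?Q x \<le> M * ?N x" for x
  proof (cases "?N x > 0")
    case True
    then have "?Q x / ?N x \<in> S" unfolding S_def by (intro CollectI exI[of _ x] conjI refl)
    then have "?Q x / ?N x \<le> M" unfolding M_def by (rule cSup_upper[OF _ bdd])
    then show ?thesis using True by (simp add: pos_divide_le_eq)
  next
    case False
    then have "?N x = 0" using N0[of x] by simp
    then show ?thesis using bil_le_sum_abs[of p ?A x] by simp
  qed
  define B where "B = M \<cdot>\<^sub>m 1\<^sub>m p - A"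
  have B: "B \<in> carrier_mat p p" unfolding B_def by (rule minus_carrier_mat[OF A])
  have Bx: "B *\<^sub>v x = M \<cdot>\<^sub>v x - A *\<^sub>v x" if "x \<in> carrier_vec p" for x
  proof -
    have "B *\<^sub>v x = (M \<cdot>\<^sub>m 1\<^sub>m p) *\<^sub>v x - A *\<^sub>v x"
      unfolding B_def by (rule minus_mult_distrib_mat_vec[OF _ A that]) simp
    then show ?thesis using smult_mat_mult_vec[of "1\<^sub>m p" p p x M] that by simp
  qed
  have "Determinant.det B = 0"
  proof (rule ccontr)
    assume "Determinant.det B \<noteq> 0"
    then have "B \<in> Units (ring_mat TYPE(real) p ())" by (rule det_non_zero_imp_unit[OF B])
    then obtain R where R: "R \<in> carrier_mat p p" "R * B = 1\<^sub>m p"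
      by (auto simp: Units_def ring_mat_def)
    from mult_mat_vec_bounded[OF R(1)] obtain r where r: "r > 0"
      "\<And>x. ?N (vec_index (R *\<^sub>v Matrix.vec p x)) \<le> r * ?N x" by blast
    let ?B = "\<lambda>i j. B $$ (i, j)"
    have symB: "sym_coeffs p ?B" using sym A by (auto simp: sym_coeffs_def B_def)
    have QB: "bil p ?B x x = M * ?N x - ?Q x" for x
    proof -
      have "bil p ?B x x = scalar_prod (Matrix.vec p x) (M \<cdot>\<^sub>v Matrix.vec p x - A *\<^sub>v Matrix.vec p x)"
        unfolding bil_mat[OF B] by (simp add: Bx)
      also have "\<dots> = M * scalar_prod (Matrix.vec p x) (Matrix.vec p x) - ?Q x"
        unfolding bil_mat[OF A] using A by (subst scalar_prod_minus_distrib[of _ p]) auto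
      finally show ?thesis by (simp add: scalar_prod_vec power2_eq_square)
    qed
    define b where "b = (\<Sum>i<p. \<Sum>j<p. \<bar>?B i j\<bar>) + 1"
    have b: "b > 0" unfolding b_def by (smt (verit) sum_nonneg abs_ge_zero)
    have b_le: "bil p ?B x x \<le> b * ?N x" for x
      using bil_le_sum_abs[of p ?B x] N0[of x] by (simp add: b_def distrib_right)
    \<comment> \<open>An inverse \<open>R\<close> of \<open>B\<close> bounds the length of
      \<open>x\<close> by that of \<open>y = B x\<close>. It remains to bound the length of
      \<open>y\<close> by the form of \<open>B\<close> at \<open>x\<close>.\<close>
    have key: "?N x \<le> r * b * (M * ?N x - ?Q x)" for x
    proof -
      define y where "y = vec_index (B *\<^sub>v Matrix.vec p x)"
      have yv: "Matrix.vec p y = B *\<^sub>v Matrix.vec p x" unfolding y_def using B by (intro vec_eta) auto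
      have xy: "bil p ?B y x = ?N y"
        unfolding bil_mat[OF B] yv[symmetric] scalar_prod_vec by (simp add: power2_eq_square)
      \<comment> \<open>Nonnegativity of the form at \<open>x - y / b\<close> yields
        \<open>?N y / b \<le> bil p ?B x x\<close>, without a square root of \<open>B\<close>; the
        step length \<open>1 / b\<close> minimises the upper bound.\<close>
      have "0 \<le> bil p ?B (\<lambda>i. x i - (1/b) * y i) (\<lambda>i. x i - (1/b) * y i)"
        unfolding QB using Q_le by simp
      also have "\<dots> = bil p ?B x x - 2 * (1/b) * ?N y + (1/b)\<^sup>2 * bil p ?B y y"
      proof -
        have 1: "bil p ?B (\<lambda>i. (1/b) * y i) x = (1/b) * ?N y" using bil_scale[of p ?B "1/b" y 1 x] xy by simp
        have 2: "bil p ?B x (\<lambda>i. (1/b) * y i) = (1/b) * ?N y" using bil_commute[OF symB] 1 by metis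
        show ?thesis unfolding bil_diff_left bil_diff_right 1 2 bil_scale by (simp add: power2_eq_square)
      qed
      also have "(1/b)\<^sup>2 * bil p ?B y y \<le> (1/b)\<^sup>2 * (b * ?N y)" by (intro mult_left_mono b_le) simp
      finally have "?N y / b \<le> bil p ?B x x" using b by (simp add: power2_eq_square)
      then have 1: "?N y \<le> b * (M * ?N x - ?Q x)" using b by (simp add: pos_divide_le_eq QB mult.commute)
      have "R *\<^sub>v Matrix.vec p y = (R * B) *\<^sub>v Matrix.vec p x"
        unfolding yv by (rule assoc_mult_mat_vec[OF R(1) B, symmetric]) simp
      then have "R *\<^sub>v Matrix.vec p y = Matrix.vec p x" unfolding R(2) by simp
      then have "?N x \<le> r * ?N y" using r(2)[of y] by simp
      also have "\<dots> \<le> r * (b * (M * ?N x - ?Q x))" using 1 r(1) by (intro mult_left_mono) auto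
      finally show ?thesis by (simp add: mult.assoc)
    qed
    \<comment> \<open>By \<open>key\<close> every Rayleigh quotient is at most
      \<open>M - 1 / (r * b)\<close>, contradicting the choice of \<open>M\<close> as their
      supremum.\<close>
    have "M \<le> M - 1 / (r * b)"
      unfolding M_def
    proof (rule cSup_least[OF ne])
      fix s assume "s \<in> S"
      then obtain x where x: "s = ?Q x / ?N x" "?N x > 0" by (auto simp: S_def)
      have rb: "r * b > 0" using r b by simp
      have "?N x / (r * b) \<le> M * ?N x - ?Q x" using key[of x] rb by (simp add: pos_divide_le_eq mult.commute)
      then have "?Q x \<le> (M - 1 / (r * b)) * ?N x" by (simp add: left_diff_distrib)
      then show "s \<le> Sup S - 1 / (r * b)" using x by (simp add: pos_divide_le_eq M_def)
    qed
    then show False using mult_pos_pos[OF r(1) b] by simp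
  qed
  then obtain v where v: "v \<in> carrier_vec p" "v \<noteq> 0\<^sub>v p" "B *\<^sub>v v = 0\<^sub>v p"
    using det_0_iff_vec_prod_zero[OF B] by blast
  have "A *\<^sub>v v = M \<cdot>\<^sub>v v"
  proof (intro eq_vecI)
    fix i assume i: "i < dim_vec (M \<cdot>\<^sub>v v)"
    have "vec_index (M \<cdot>\<^sub>v v - A *\<^sub>v v) i = vec_index (0\<^sub>v p) i" using v Bx[OF v(1)] by simp
    then show "vec_index (A *\<^sub>v v) i = vec_index (M \<cdot>\<^sub>v v) i" using i v A by auto
  qed (use v A in auto)
  with v Q_le that show ?thesis by blast
qed

lemma inv_mat_eq:
  assumes A: "A \<in> carrier_mat p p" and B: "B \<in> carrier_mat p p" and AB: "A * B = 1\<^sub>m p"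
  shows "inv_mat A = B"
proof -
  have BA: "B * A = 1\<^sub>m p" by (rule mat_mult_left_right_inverse[OF A B AB])
  have "A \<in> Units (ring_mat TYPE(real) p ())"
    using A B AB BA by (auto simp: Units_def ring_mat_def)
  then obtain C where C: "mat_inverse A = Some C"
    using mat_inverse(1)[OF A, where b = "()"] by (cases "mat_inverse A") auto
  from mat_inverse(2)[OF A C] have "C * A = 1\<^sub>m p" "C \<in> carrier_mat p p" by auto
  then have "C = C * (A * B)" unfolding AB by simp
  also have "\<dots> = B" using \<open>C * A = 1\<^sub>m p\<close> \<open>C \<in> carrier_mat p p\<close> A B
    by (simp add: assoc_mult_mat[of C p p A p B p, symmetric])
  finally show ?thesis using C by (simp add: inv_mat_def)
qed

text \<open>Positive dimension guarantees that eigenvalues exist; dimension 0 is treated directly in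
  \<open>theorem1\<close>.\<close>

locale design =
  fixes X :: "real Matrix.mat" and n p :: nat and lmin lmax :: real
  assumes X: "X \<in> carrier_mat n p" and rank: "vec_space.rank n X = p"
    and pn: "p < n" and p0: "p > 0" and lmin: "lmin > 0"
    and eig: "\<And>l. eigenvalue (real n \<cdot>\<^sub>m gram_inv X) l \<Longrightarrow> lmin \<le> l \<and> l \<le> lmax"
begin

abbreviation "Gr \<equiv> transpose_mat X * X"
definition "A = (\<lambda>i j. Gr $$ (i, j))"

lemma Gr: "Gr \<in> carrier_mat p p" using X by simp

lemma X_kernel:
  assumes v: "v \<in> carrier_vec p" and z: "X *\<^sub>v v = 0\<^sub>v n"
  shows "v = 0\<^sub>v p"
proof (rule ccontr)
  assume ne: "v \<noteq> 0\<^sub>v p"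
  interpret vec_space "TYPE(real)" n .
  \<comment> \<open>Independence is a statement about the set of columns, so repeated columns must
    be excluded first: a maximal independent subset has \<open>p\<close> elements, and there are
    only \<open>p\<close> columns.\<close>
  have d: "distinct (cols X)"
  proof -
    obtain S where S: "maximal S (\<lambda>T. T \<subseteq> set (cols X) \<and> lin_indpt T)"
      using maximal_exists_superset[of "set (cols X)" "\<lambda>T. T \<subseteq> set (cols X) \<and> lin_indpt T" "{}"]
      by (meson List.finite_set empty_subsetI finite_lin_indpt2 ex_in_conv finite.emptyI)
    then have "S \<subseteq> set (cols X)" by (simp add: maximal_def)
    then have "p \<le> card (set (cols X))"
      using rank_card_indpt[OF X S] rank by (metis card_mono List.finite_set)
    moreover have "length (cols X) = p" using X by simp
    ultimately show ?thesis using card_distinct[of "cols X"] card_length[of "cols X"] by simp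
  qed
  have "lin_indpt (set (cols X))" using full_rank_lin_indpt[OF X rank d] .
  moreover have "lin_dep (set (cols X))" using lin_depI[OF X v ne z d] by simp
  ultimately show False by blast
qed

lemma Gr_scalar:
  assumes x: "x \<in> carrier_vec p" and y: "y \<in> carrier_vec p"
  shows "scalar_prod x (Gr *\<^sub>v y) = scalar_prod (X *\<^sub>v x) (X *\<^sub>v y)"
proof -
  have "scalar_prod x (Gr *\<^sub>v y) = scalar_prod x (transpose_mat X *\<^sub>v (X *\<^sub>v y))"
    using X y by (simp add: assoc_mult_mat_vec[of _ p n _ p])
  also have "\<dots> = scalar_prod (transpose_mat X *\<^sub>v (X *\<^sub>v y)) x"
    using X x y by (intro comm_scalar_prod[of _ p]) auto
  also have "\<dots> = scalar_prod (X *\<^sub>v y) (X *\<^sub>v x)" using X x y by (intro transpose_vec_mult_scalar) auto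
  also have "\<dots> = scalar_prod (X *\<^sub>v x) (X *\<^sub>v y)" using X x y by (intro comm_scalar_prod[of _ n]) auto
  finally show ?thesis .
qed

lemma scalar_prod_self_0:
  assumes "x \<in> carrier_vec m" "scalar_prod x x = (0::real)" shows "x = 0\<^sub>v m"
proof -
  have "(\<Sum>i<m. (vec_index x i)\<^sup>2) = 0" using assms by (auto simp: scalar_prod_def atLeast0LessThan power2_eq_square)
  then have "\<forall>i<m. vec_index x i = 0" by (subst (asm) sum_nonneg_eq_0_iff) auto
  then show ?thesis using assms(1) by (intro eq_vecI) auto
qed

lemma det_Gr: "Determinant.det Gr \<noteq> 0"
proof
  assume "Determinant.det Gr = 0"
  then obtain v where v: "v \<in> carrier_vec p" "v \<noteq> 0\<^sub>v p" "Gr *\<^sub>v v = 0\<^sub>v p"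
    using det_0_iff_vec_prod_zero[OF Gr] by blast
  have "scalar_prod (X *\<^sub>v v) (X *\<^sub>v v) = 0"
    unfolding Gr_scalar[OF v(1) v(1), symmetric] v(3) using v by simp
  then have "X *\<^sub>v v = 0\<^sub>v n" using X v by (intro scalar_prod_self_0) auto
  then show False using X_kernel v by blast
qed

lemma gram_inv: "gram_inv X \<in> carrier_mat p p" "Gr * gram_inv X = 1\<^sub>m p" "gram_inv X * Gr = 1\<^sub>m p"
proof -
  have "Gr \<in> Units (ring_mat TYPE(real) p ())" by (rule det_non_zero_imp_unit[OF Gr det_Gr])
  then obtain B where B: "mat_inverse Gr = Some B"
    using mat_inverse(1)[OF Gr, where b = "()"] by (cases "mat_inverse Gr") auto
  from mat_inverse(2)[OF Gr this]
  show "gram_inv X \<in> carrier_mat p p" "Gr * gram_inv X = 1\<^sub>m p" "gram_inv X * Gr = 1\<^sub>m p"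
    by (auto simp: gram_inv_def inv_mat_def B)
qed

lemma det_gram_inv: "Determinant.det (gram_inv X) \<noteq> 0"
  using det_mult[OF Gr gram_inv(1)] gram_inv(2) by auto

lemma sym_A: "sym_coeffs p A"
  unfolding sym_coeffs_def A_def
proof (intro allI impI)
  fix i j assume ij: "i < p" "j < p"
  have t: "transpose_mat Gr = Gr" using X by (simp add: transpose_mult[of _ p n])
  have "Gr $$ (i, j) = transpose_mat Gr $$ (j, i)" using Gr ij by (subst index_transpose_mat) auto
  then show "Gr $$ (i, j) = Gr $$ (j, i)" unfolding t .
qed

lemma bil_A: "bil p A x y = scalar_prod (X *\<^sub>v Matrix.vec p x) (X *\<^sub>v Matrix.vec p y)"
  unfolding A_def bil_mat[OF Gr] by (rule Gr_scalar) auto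

text \<open>Inverting the Gram matrix turns an eigenvalue \<mu> into \<open>1 / \<mu>\<close> with
  the same eigenvector, so \<open>eig\<close> applies to \<open>n / \<mu>\<close>; positivity of
  \<open>lmin\<close> then gives the sign of \<mu>.\<close>

lemma gram_eigen:
  assumes v: "v \<in> carrier_vec p" "v \<noteq> 0\<^sub>v p" "Gr *\<^sub>v v = \<mu> \<cdot>\<^sub>v v"
  shows "\<mu> > 0" "lmin \<le> n / \<mu>" "n / \<mu> \<le> lmax"
proof -
  have gv: "v = \<mu> \<cdot>\<^sub>v (gram_inv X *\<^sub>v v)"
  proof -
    have "v = (gram_inv X * Gr) *\<^sub>v v" using v gram_inv by simp
    also have "\<dots> = gram_inv X *\<^sub>v (Gr *\<^sub>v v)" using gram_inv(1) Gr v by (simp only: assoc_mult_mat_vec)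
    also have "\<dots> = \<mu> \<cdot>\<^sub>v (gram_inv X *\<^sub>v v)" unfolding v(3) using gram_inv(1) v by (simp add: mult_mat_vec)
    finally show ?thesis .
  qed
  have mu: "\<mu> \<noteq> 0"
  proof
    assume "\<mu> = 0"
    define w where "w = gram_inv X *\<^sub>v v"
    have w: "w \<in> carrier_vec p" unfolding w_def by (rule mult_mat_vec_carrier[OF gram_inv(1) v(1)])
    have "v = 0 \<cdot>\<^sub>v w" using gv \<open>\<mu> = 0\<close> by (simp add: w_def)
    also have "\<dots> = 0\<^sub>v p" using w by (intro eq_vecI) auto
    finally have "v = 0\<^sub>v p" .
    with v show False by simp
  qed
  have "gram_inv X *\<^sub>v v = (1 / \<mu>) \<cdot>\<^sub>v (\<mu> \<cdot>\<^sub>v (gram_inv X *\<^sub>v v))" using mu by (simp add: smult_smult_assoc)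
  then have g: "gram_inv X *\<^sub>v v = (1 / \<mu>) \<cdot>\<^sub>v v" using gv by simp
  have "(real n \<cdot>\<^sub>m gram_inv X) *\<^sub>v v = (n / \<mu>) \<cdot>\<^sub>v v"
    unfolding smult_mat_mult_vec[OF gram_inv(1) v(1)] g by (simp add: smult_smult_assoc)
  then have "eigenvalue (real n \<cdot>\<^sub>m gram_inv X) (n / \<mu>)"
    unfolding eigenvalue_def eigenvector_def using v gram_inv(1) by (intro exI[of _ v]) auto
  from eig[OF this] show b: "lmin \<le> n / \<mu>" "n / \<mu> \<le> lmax" by auto
  then have "n / \<mu> > 0" using lmin by simp
  then show "\<mu> > 0" by (simp add: zero_less_divide_iff)
qed

lemma bil_upper: "bil p A x x \<le> n / lmin * (\<Sum>i<p. (x i)\<^sup>2)"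
proof -
  obtain M v where M: "v \<in> carrier_vec p" "v \<noteq> 0\<^sub>v p" "Gr *\<^sub>v v = M \<cdot>\<^sub>v v"
    "\<And>x. bil p A x x \<le> M * (\<Sum>i<p. (x i)\<^sup>2)"
    by (rule rayleigh_sup_eigenvector[OF Gr sym_A[unfolded A_def] p0, folded A_def]) (rule that)
  note e = gram_eigen[OF M(1-3)]
  have "lmin * M \<le> n" using e(1,2) by (simp only: pos_le_divide_eq)
  then have "M \<le> n / lmin" using lmin by (simp only: pos_le_divide_eq mult.commute)
  then have "M * (\<Sum>i<p. (x i)\<^sup>2) \<le> n / lmin * (\<Sum>i<p. (x i)\<^sup>2)" by (intro mult_right_mono sum_nonneg) auto
  with M(4)[of x] show ?thesis by linarith
qed

text \<open>The smallest eigenvalue is obtained as the largest one of the negated Gram matrix. Its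
  existence also shows \<open>lmin \<le> lmax\<close>, whence \<open>lmax\<close> is
  positive.\<close>

lemma lmax_pos: "lmax > 0" and bil_lower: "n / lmax * (\<Sum>i<p. (x i)\<^sup>2) \<le> bil p A x x"
proof -
  have mG: "(-1) \<cdot>\<^sub>m Gr \<in> carrier_mat p p" using Gr by simp
  have s: "sym_coeffs p (\<lambda>i j. ((-1) \<cdot>\<^sub>m Gr) $$ (i, j))" using sym_A Gr unfolding sym_coeffs_def A_def by auto
  obtain M v where M: "v \<in> carrier_vec p" "v \<noteq> 0\<^sub>v p" "((-1) \<cdot>\<^sub>m Gr) *\<^sub>v v = M \<cdot>\<^sub>v v"
    "\<And>x. bil p (\<lambda>i j. ((-1) \<cdot>\<^sub>m Gr) $$ (i, j)) x x \<le> M * (\<Sum>i<p. (x i)\<^sup>2)"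
    by (rule rayleigh_sup_eigenvector[OF mG s p0]) (rule that)
  have "bil p (\<lambda>i j. ((-1) \<cdot>\<^sub>m Gr) $$ (i, j)) x x = bil p (\<lambda>i j. - A i j) x x"
    unfolding bil_def A_def using Gr by (intro sum.cong) auto
  then have q: "- bil p A x x \<le> M * (\<Sum>i<p. (x i)\<^sup>2)"
    using M(4)[of x] by (simp add: bil_def sum_negf)
  have "(-1) \<cdot>\<^sub>v (Gr *\<^sub>v v) = M \<cdot>\<^sub>v v" using M(3) unfolding smult_mat_mult_vec[OF Gr M(1)] .
  then have "(-1) \<cdot>\<^sub>v ((-1) \<cdot>\<^sub>v (Gr *\<^sub>v v)) = (-1) \<cdot>\<^sub>v (M \<cdot>\<^sub>v v)" by simp
  then have "Gr *\<^sub>v v = (- M) \<cdot>\<^sub>v v" by (simp add: smult_smult_assoc)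
  note e = gram_eigen[OF M(1,2) this]
  show l: "lmax > 0" using e(2,3) lmin by linarith
  have "n \<le> lmax * (- M)" using e(1,3) by (simp only: pos_divide_le_eq)
  then have "n / lmax \<le> - M" using l by (simp only: pos_divide_le_eq mult.commute)
  then have "n / lmax * (\<Sum>i<p. (x i)\<^sup>2) \<le> - M * (\<Sum>i<p. (x i)\<^sup>2)" by (intro mult_right_mono sum_nonneg) auto
  with q show "n / lmax * (\<Sum>i<p. (x i)\<^sup>2) \<le> bil p A x x" by simp
qed

end

section \<open>Inverse Gram matrix, normal densities, least squares estimate and residual\<close>

context design
begin

definition ginv_row :: "nat \<Rightarrow> nat \<Rightarrow> real" where "ginv_row i j = gram_inv X $$ (i, j)"

lemma vec_ginv_row: "i < p \<Longrightarrow> Matrix.vec p (ginv_row i) = Matrix.row (gram_inv X) i"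
  using gram_inv(1) by (auto simp: ginv_row_def)

text \<open>These rows are the representers asked for by the assumption \<open>dual\<close> of
  \<open>gauss_igk\<close>.\<close>

lemma bil_ginv_row:
  assumes i: "i < p"
  shows "bil p A (ginv_row i) x = x i"
proof -
  have "bil p A (ginv_row i) x = scalar_prod (Matrix.row (gram_inv X) i) (Gr *\<^sub>v Matrix.vec p x)"
    unfolding A_def bil_mat[OF Gr] vec_ginv_row[OF i] ..
  also have "\<dots> = vec_index (gram_inv X *\<^sub>v (Gr *\<^sub>v Matrix.vec p x)) i"
    using gram_inv(1) i by simp
  also have "gram_inv X *\<^sub>v (Gr *\<^sub>v Matrix.vec p x) = (gram_inv X * Gr) *\<^sub>v Matrix.vec p x"
    by (rule assoc_mult_mat_vec[OF gram_inv(1) Gr, symmetric]) simp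
  also have "\<dots> = Matrix.vec p x" unfolding gram_inv(3) by simp
  finally show ?thesis using i by simp
qed

lemma diag_A: "i < p \<Longrightarrow> A i i \<le> n / lmin"
proof -
  assume i: "i < p"
  have "(\<Sum>j<p. (if j = i then 1 else 0 :: real)\<^sup>2) = 1"
    using i by (simp add: if_distrib[of "\<lambda>x. x\<^sup>2"] cong: if_cong)
  then show ?thesis
    using bil_upper[of "\<lambda>j. if j = i then 1 else 0"] bil_unit_unit[OF i, of A] by simp
qed

text \<open>Testing \<open>bil_lower\<close> with the row itself gives
  \<open>n / lmax * d\<^sup>2 \<le> d\<close> for the diagonal entry \<open>d\<close>, which is the
  variance of a coordinate of the least squares estimate at unit noise.\<close>

lemma ginv_row_diag: "i < p \<Longrightarrow> ginv_row i i \<le> lmax / n"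
proof -
  assume i: "i < p"
  have "(ginv_row i i)\<^sup>2 \<le> (\<Sum>j<p. (ginv_row i j)\<^sup>2)"
    using i by (intro member_le_sum[of i "{..<p}" "\<lambda>j. (ginv_row i j)\<^sup>2"]) auto
  then have "n / lmax * (ginv_row i i)\<^sup>2 \<le> n / lmax * (\<Sum>j<p. (ginv_row i j)\<^sup>2)"
    using lmax_pos by (intro mult_left_mono) auto
  also have "\<dots> \<le> ginv_row i i" using bil_lower[of "ginv_row i"] bil_ginv_row[OF i] by simp
  finally have le: "n / lmax * (ginv_row i i)\<^sup>2 \<le> ginv_row i i" .
  show ?thesis
  proof (cases "ginv_row i i > 0")
    case True
    have "(n / lmax * ginv_row i i) * ginv_row i i \<le> 1 * ginv_row i i" using le by (simp add: power2_eq_square mult.assoc)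
    then have "n / lmax * ginv_row i i \<le> 1" using True by (rule mult_right_le_imp_le)
    then show ?thesis using lmax_pos pn by (simp add: field_simps)
  next
    case False
    then show ?thesis using lmax_pos by (meson divide_nonneg_nonneg less_eq_real_def linorder_not_le of_nat_0_le_iff order_trans)
  qed
qed

lemma inv_mat_smult_gram_inv:
  assumes s: "s > 0"
  shows "inv_mat (s \<cdot>\<^sub>m gram_inv X) = (1 / s) \<cdot>\<^sub>m Gr"
proof (rule inv_mat_eq)
  have "(s \<cdot>\<^sub>m gram_inv X) * ((1 / s) \<cdot>\<^sub>m Gr) = (1 / s) \<cdot>\<^sub>m (s \<cdot>\<^sub>m (gram_inv X * Gr))"
    using gram_inv(1) Gr by (simp add: mult_smult_assoc_mat[of _ p p _ p] mult_smult_distrib[of _ p p _ p])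
  also have "\<dots> = 1\<^sub>m p" unfolding gram_inv(3) using s by (intro eq_matI) auto
  finally show "(s \<cdot>\<^sub>m gram_inv X) * ((1 / s) \<cdot>\<^sub>m Gr) = 1\<^sub>m p" .
qed (use gram_inv(1) Gr in auto)

lemma mvn_density_gram_inv:
  assumes s: "s > 0"
  shows "mvn_density (Matrix.vec p \<mu>) (s \<cdot>\<^sub>m gram_inv X) (Matrix.vec p x) =
    exp (- bil p A (\<lambda>i. x i - \<mu> i) (\<lambda>i. x i - \<mu> i) / (2 * s)) / sqrt ((2 * pi) ^ p * (s ^ p * Determinant.det (gram_inv X)))"
proof -
  let ?d = "Matrix.vec p (\<lambda>i. x i - \<mu> i)"
  have d: "Matrix.vec p x - Matrix.vec p \<mu> = ?d" by auto
  have "scalar_prod ?d (((1 / s) \<cdot>\<^sub>m Gr) *\<^sub>v ?d) = (1 / s) * bil p A (\<lambda>i. x i - \<mu> i) (\<lambda>i. x i - \<mu> i)"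
    unfolding A_def bil_mat[OF Gr] smult_mat_mult_vec[OF Gr vec_carrier]
    by (rule scalar_prod_smult_distrib[of _ p]) (auto intro!: mult_mat_vec_carrier[OF Gr])
  then show ?thesis
    using s gram_inv(1) unfolding mvn_density_def d inv_mat_smult_gram_inv[OF s] by simp
qed

definition ols_weight :: "nat \<Rightarrow> nat \<Rightarrow> real" where
  "ols_weight i = vec_index (X *\<^sub>v Matrix.vec p (ginv_row i))"

text \<open>The squared length of the weights is the form at row \<open>i\<close> of the inverse
  Gram matrix, hence its diagonal entry.\<close>

lemma ols_weight_norm: "i < p \<Longrightarrow> (\<Sum>k<n. (ols_weight i k)\<^sup>2) \<le> lmax / n"
proof -
  assume i: "i < p"
  have e: "Matrix.vec n (ols_weight i) = X *\<^sub>v Matrix.vec p (ginv_row i)"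
    unfolding ols_weight_def by (rule vec_eta) (use X in auto)
  have "(\<Sum>k<n. (ols_weight i k)\<^sup>2) = scalar_prod (Matrix.vec n (ols_weight i)) (Matrix.vec n (ols_weight i))"
    unfolding scalar_prod_vec by (simp add: power2_eq_square)
  also have "\<dots> = ginv_row i i" unfolding e bil_A[symmetric] by (rule bil_ginv_row[OF i])
  finally show ?thesis using ginv_row_diag[OF i] by simp
qed

definition ols_noise :: "(nat \<Rightarrow> real) \<Rightarrow> real Matrix.vec" where
  "ols_noise e = gram_inv X *\<^sub>v (transpose_mat X *\<^sub>v Matrix.vec n e)"

lemma ols_noise_carrier: "ols_noise e \<in> carrier_vec p"
  unfolding ols_noise_def by (intro mult_mat_vec_carrier[OF gram_inv(1)] mult_mat_vec_carrier[of _ p n]) (use X in auto)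

lemma ols_eq:
  assumes b: "\<beta> \<in> carrier_vec p"
  shows "ols X (X *\<^sub>v \<beta> + Matrix.vec n e) = \<beta> + ols_noise e"
proof -
  have tX: "transpose_mat X \<in> carrier_mat p n" using X by simp
  have Xb: "X *\<^sub>v \<beta> \<in> carrier_vec n" using X b by simp
  have "transpose_mat X *\<^sub>v (X *\<^sub>v \<beta> + Matrix.vec n e) = transpose_mat X *\<^sub>v (X *\<^sub>v \<beta>) + transpose_mat X *\<^sub>v Matrix.vec n e"
    by (rule mult_add_distrib_mat_vec[OF tX Xb]) simp
  also have "transpose_mat X *\<^sub>v (X *\<^sub>v \<beta>) = Gr *\<^sub>v \<beta>"
    by (rule assoc_mult_mat_vec[OF tX X b, symmetric])
  finally have "ols X (X *\<^sub>v \<beta> + Matrix.vec n e) = gram_inv X *\<^sub>v (Gr *\<^sub>v \<beta> + transpose_mat X *\<^sub>v Matrix.vec n e)"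
    unfolding ols_def by simp
  also have "\<dots> = gram_inv X *\<^sub>v (Gr *\<^sub>v \<beta>) + ols_noise e"
    unfolding ols_noise_def by (rule mult_add_distrib_mat_vec[OF gram_inv(1)]) (use X b in \<open>auto intro!: mult_mat_vec_carrier[OF Gr] mult_mat_vec_carrier[OF tX]\<close>)
  also have "gram_inv X *\<^sub>v (Gr *\<^sub>v \<beta>) = (gram_inv X * Gr) *\<^sub>v \<beta>"
    by (rule assoc_mult_mat_vec[OF gram_inv(1) Gr b, symmetric])
  also have "\<dots> = \<beta>" unfolding gram_inv(3) using b by simp
  finally show ?thesis .
qed

lemma ols_noise_index:
  assumes i: "i < p"
  shows "vec_index (ols_noise e) i = (\<Sum>k<n. ols_weight i k * e k)"
proof -
  have tX: "transpose_mat X \<in> carrier_mat p n" using X by simp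
  have e: "Matrix.vec n (ols_weight i) = X *\<^sub>v Matrix.vec p (ginv_row i)"
    unfolding ols_weight_def by (rule vec_eta) (use X in auto)
  have "vec_index (ols_noise e) i = scalar_prod (Matrix.vec p (ginv_row i)) (transpose_mat X *\<^sub>v Matrix.vec n e)"
    unfolding ols_noise_def vec_ginv_row[OF i] using gram_inv(1) i by simp
  also have "\<dots> = scalar_prod (transpose_mat X *\<^sub>v Matrix.vec n e) (Matrix.vec p (ginv_row i))"
    by (rule comm_scalar_prod[of _ p]) (auto intro!: mult_mat_vec_carrier[OF tX])
  also have "\<dots> = scalar_prod (Matrix.vec n e) (X *\<^sub>v Matrix.vec p (ginv_row i))"
    by (rule transpose_vec_mult_scalar[OF X]) auto
  also have "\<dots> = (\<Sum>k<n. ols_weight i k * e k)"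
    unfolding e[symmetric] scalar_prod_vec by (simp add: mult.commute)
  finally show ?thesis .
qed

definition resid :: "(nat \<Rightarrow> real) \<Rightarrow> real Matrix.vec" where
  "resid e = Matrix.vec n e - X *\<^sub>v ols_noise e"

lemma resid_carrier: "resid e \<in> carrier_vec n"
  unfolding resid_def using X ols_noise_carrier[of e] by simp

lemma rss_eq:
  assumes b: "\<beta> \<in> carrier_vec p"
  shows "rss X (X *\<^sub>v \<beta> + Matrix.vec n e) = scalar_prod (resid e) (resid e)"
proof -
  have "X *\<^sub>v \<beta> + Matrix.vec n e - X *\<^sub>v (\<beta> + ols_noise e) = resid e"
    unfolding mult_add_distrib_mat_vec[OF X b ols_noise_carrier] resid_def
    using X b ols_noise_carrier[of e] by (intro eq_vecI) auto
  then show ?thesis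
    unfolding rss_def ols_eq[OF b] l2_norm_def
    by (simp add: sum_nonneg scalar_prod_def atLeast0LessThan power2_eq_square)
qed

lemma resid_orth: "transpose_mat X *\<^sub>v resid e = 0\<^sub>v p"
proof -
  have tX: "transpose_mat X \<in> carrier_mat p n" using X by simp
  have t: "transpose_mat X *\<^sub>v Matrix.vec n e \<in> carrier_vec p" by (rule mult_mat_vec_carrier[OF tX]) simp
  have "transpose_mat X *\<^sub>v resid e = transpose_mat X *\<^sub>v Matrix.vec n e - transpose_mat X *\<^sub>v (X *\<^sub>v ols_noise e)"
    unfolding resid_def by (rule mult_minus_distrib_mat_vec[OF tX]) (use X ols_noise_carrier[of e] in auto)
  also have "transpose_mat X *\<^sub>v (X *\<^sub>v ols_noise e) = Gr *\<^sub>v ols_noise e"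
    by (rule assoc_mult_mat_vec[OF tX X ols_noise_carrier, symmetric])
  also have "\<dots> = (Gr * gram_inv X) *\<^sub>v (transpose_mat X *\<^sub>v Matrix.vec n e)"
    unfolding ols_noise_def by (rule assoc_mult_mat_vec[OF Gr gram_inv(1) t, symmetric])
  also have "\<dots> = transpose_mat X *\<^sub>v Matrix.vec n e" unfolding gram_inv(2) using t by simp
  finally show ?thesis using t by (intro eq_vecI) auto
qed

text \<open>The noise splits into the residual and its projection onto the column space, orthogonal
  by \<open>resid_orth\<close>. Both terms are therefore bounded by the squared length of the
  noise.\<close>

lemma rss_pythagoras:
  assumes b: "\<beta> \<in> carrier_vec p"
  shows "rss X (X *\<^sub>v \<beta> + Matrix.vec n e) + bil p A (vec_index (ols_noise e)) (vec_index (ols_noise e)) = (\<Sum>k<n. (e k)\<^sup>2)"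
proof -
  let ?f = "X *\<^sub>v ols_noise e"
  have f: "?f \<in> carrier_vec n" using X ols_noise_carrier[of e] by simp
  have r: "resid e \<in> carrier_vec n" by (rule resid_carrier)
  have o: "scalar_prod (resid e) ?f = 0"
    unfolding transpose_vec_mult_scalar[OF X ols_noise_carrier r, symmetric] resid_orth using ols_noise_carrier[of e] by simp
  then have o': "scalar_prod ?f (resid e) = 0" using comm_scalar_prod[OF f r] by simp
  have ev: "Matrix.vec n e = resid e + ?f" using f X by (intro eq_vecI) (auto simp: resid_def)
  have "(\<Sum>k<n. (e k)\<^sup>2) = scalar_prod (Matrix.vec n e) (Matrix.vec n e)"
    unfolding scalar_prod_vec by (simp add: power2_eq_square)
  also have "\<dots> = scalar_prod (resid e) (resid e) + scalar_prod ?f ?f"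
    unfolding ev using o o' f r by (simp add: add_scalar_prod_distrib[of _ n] scalar_prod_add_distrib[of _ n])
  also have "scalar_prod ?f ?f = bil p A (vec_index (ols_noise e)) (vec_index (ols_noise e))"
    unfolding bil_A vec_eta[OF ols_noise_carrier] ..
  finally show ?thesis unfolding rss_eq[OF b] by simp
qed

text \<open>A vanishing residual forces the noise into the column space. As \<open>p < n\<close>,
  some nonzero \<open>z\<close> is orthogonal to all columns, so the noise must lie in the
  hyperplane orthogonal to \<open>z\<close>, an event of probability 0.\<close>

lemma rss_zero_functional:
  "\<exists>z. (\<exists>k<n. z k \<noteq> 0) \<and> (\<forall>\<beta> e. \<beta> \<in> carrier_vec p \<longrightarrow> rss X (X *\<^sub>v \<beta> + Matrix.vec n e) = 0 \<longrightarrow> (\<Sum>k<n. z k * e k) = 0)"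
proof -
  \<comment> \<open>The transpose of \<open>X\<close> padded with zero rows to a square matrix. Row
    \<open>p\<close> (indices start at 0) is zero because \<open>p < n\<close>, so the determinant
    vanishes and yields a kernel vector.\<close>
  define M where "M = Matrix.mat n n (\<lambda>(i, k). if i < p then X $$ (k, i) else 0)"
  have M: "M \<in> carrier_mat n n" by (simp add: M_def)
  have "transpose_mat M *\<^sub>v unit_vec n p = 0\<^sub>v n"
    using pn M by (intro eq_vecI) (auto simp: M_def)
  moreover have "unit_vec n p \<noteq> (0\<^sub>v n :: real Matrix.vec)" using pn by (auto dest!: arg_cong[where f = "\<lambda>v. vec_index v p"])
  ultimately have "Determinant.det (transpose_mat M) = 0"
    using det_0_iff_vec_prod_zero[of "transpose_mat M" n] M by (auto intro!: exI[of _ "unit_vec n p"])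
  then have "Determinant.det M = 0" using det_transpose[OF M] by simp
  then obtain z where z: "z \<in> carrier_vec n" "z \<noteq> 0\<^sub>v n" "M *\<^sub>v z = 0\<^sub>v n"
    using det_0_iff_vec_prod_zero[OF M] by blast
  have Xz: "transpose_mat X *\<^sub>v z = 0\<^sub>v p"
  proof (intro eq_vecI)
    fix i assume "i < dim_vec (0\<^sub>v p :: real Matrix.vec)"
    then have i: "i < p" by simp
    have "Matrix.row M i = Matrix.row (transpose_mat X) i" using i pn X by (intro eq_vecI) (auto simp: M_def)
    then have "vec_index (transpose_mat X *\<^sub>v z) i = vec_index (M *\<^sub>v z) i" using i pn X M by simp
    then show "vec_index (transpose_mat X *\<^sub>v z) i = vec_index (0\<^sub>v p) i" using i pn z by simp
  qed (use X in auto)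
  have "(\<Sum>k<n. vec_index z k * e k) = 0" if b: "\<beta> \<in> carrier_vec p" and 0: "rss X (X *\<^sub>v \<beta> + Matrix.vec n e) = 0" for \<beta> e
  proof -
    have "resid e = 0\<^sub>v n" using 0 unfolding rss_eq[OF b] by (rule scalar_prod_self_0[OF resid_carrier])
    have ev: "Matrix.vec n e = X *\<^sub>v ols_noise e"
    proof (intro eq_vecI)
      fix k assume "k < dim_vec (X *\<^sub>v ols_noise e)"
      then have k: "k < n" using X by simp
      then have "vec_index (resid e) k = vec_index (Matrix.vec n e) k - vec_index (X *\<^sub>v ols_noise e) k"
        unfolding resid_def using X by (intro index_minus_vec(1)) simp
      then show "vec_index (Matrix.vec n e) k = vec_index (X *\<^sub>v ols_noise e) k"
        using k \<open>resid e = 0\<^sub>v n\<close> by simp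
    qed (use X in simp)
    have "(\<Sum>k<n. vec_index z k * e k) = scalar_prod z (Matrix.vec n e)"
      by (simp add: scalar_prod_def atLeast0LessThan)
    also have "\<dots> = scalar_prod (transpose_mat X *\<^sub>v z) (ols_noise e)"
      unfolding ev by (rule transpose_vec_mult_scalar[OF X ols_noise_carrier z(1), symmetric])
    finally show ?thesis unfolding Xz using ols_noise_carrier[of e] by simp
  qed
  moreover have "\<exists>k<n. vec_index z k \<noteq> 0"
  proof (rule ccontr)
    assume "\<not> ?thesis"
    then have "z = 0\<^sub>v n" using z(1) by (intro eq_vecI) auto
    with z(2) show False by simp
  qed
  ultimately show ?thesis by (intro exI[of _ "vec_index z"]) blast
qed

end

section \<open>The posterior\<close>

lemma linf_norm_gt_iff:
  assumes "\<epsilon> \<ge> 0"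
  shows "linf_norm x > \<epsilon> \<longleftrightarrow> (\<exists>i<dim_vec x. \<bar>vec_index x i\<bar> > \<epsilon>)"
proof -
  have "finite {\<bar>vec_index x i\<bar> | i. i < dim_vec x}" by simp
  then show ?thesis unfolding linf_norm_def using assms by (subst Max_gr_iff) auto
qed

lemma linf_norm_le_iff:
  assumes "\<epsilon> \<ge> 0"
  shows "linf_norm x \<le> \<epsilon> \<longleftrightarrow> (\<forall>i<dim_vec x. \<bar>vec_index x i\<bar> \<le> \<epsilon>)"
  using linf_norm_gt_iff[OF assms, of x] by (auto simp: not_less[symmetric])

lemma mult_fractions_regroup:
  fixes e1 :: real
  shows "(e1 / A) * (s / G * (w * e2)) * (e3 / B) * (y * e4) = s / G * (w * y) / (A * B) * (e1 * e2 * e3 * e4)"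
  by (simp add: divide_inverse mult_ac)

text \<open>\<open>n \<ge> 4\<close> and \<open>a \<ge> -2\<close> make the shape
  \<open>(n + a) / 2\<close> at least 1, and \<open>S > 0\<close> keeps the scale positive even if
  \<open>b = 0\<close>; so the posterior is proper also for improper priors.\<close>

locale g_prior = design +
  fixes \<gamma> bh :: "nat \<Rightarrow> real" and g a b S :: real
  assumes g: "g > 0" and a: "a \<ge> -2" and b: "b \<ge> 0" and S: "S > 0" and n4: "n \<ge> 4"
begin

definition "post_mean = (\<lambda>i. (\<gamma> i + g * bh i) / (g + 1))"
definition "post_scale = b + S + bil p A (\<lambda>i. bh i - \<gamma> i) (\<lambda>i. bh i - \<gamma> i) / (g + 1)"

lemma bil_nonneg: "bil p A x x \<ge> 0"
  using bil_lower[of x] lmax_pos by (smt (verit) divide_nonneg_pos mult_nonneg_nonneg of_nat_0_le_iff sum_nonneg zero_le_power2)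

lemma post_scale_pos: "post_scale > 0"
proof -
  have "bil p A (\<lambda>i. bh i - \<gamma> i) (\<lambda>i. bh i - \<gamma> i) / (g + 1) \<ge> 0" using g bil_nonneg by simp
  then show ?thesis using S b by (simp add: post_scale_def)
qed

sublocale K: gauss_igk p A "n / lmax" "n / lmin" "g / (g + 1)" "(n + a) / 2" "post_scale / 2" post_mean
proof
  show "sym_coeffs p A" by (rule sym_A)
  show "0 < real n / lmax" using lmax_pos pn by simp
  show "\<And>x. n / lmax * (\<Sum>i<p. (x i)\<^sup>2) \<le> bil p A x x" by (rule bil_lower)
  show "\<And>i. i < p \<Longrightarrow> A i i \<le> n / lmin" by (rule diag_A)
  show "0 \<le> n / lmin" using lmin by simp
  show "\<exists>y. \<forall>x. bil p A y x = x i" if "i < p" for i using bil_ginv_row[OF that] by blast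
  show "0 < g / (g + 1)" using g by simp
  show "1 \<le> (n + a) / 2" using n4 a by simp
  show "0 < post_scale / 2" using post_scale_pos by simp
qed

lemma complete_square:
  "bil p A (\<lambda>i. bh i - x i) (\<lambda>i. bh i - x i) + bil p A (\<lambda>i. x i - \<gamma> i) (\<lambda>i. x i - \<gamma> i) / g
   = (g + 1) / g * bil p A (\<lambda>i. x i - post_mean i) (\<lambda>i. x i - post_mean i) + bil p A (\<lambda>i. bh i - \<gamma> i) (\<lambda>i. bh i - \<gamma> i) / (g + 1)"
proof -
  define s where "s i = x i - post_mean i" for i
  define d where "d i = bh i - \<gamma> i" for i
  define u where "u = 1 / (g + 1)"
  have u: "u * (g + 1) = 1" using g by (simp add: u_def)
  have "u * g + u = 1" using u by (simp only: distrib_left mult_1_right)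
  then have gu: "g * u = 1 - u" by (simp add: mult.commute)
  have pm: "post_mean i = bh i - u * d i" for i
    using g by (simp add: d_def post_mean_def u_def field_simps)
  \<comment> \<open>Seen from the posterior mean, \<open>bh\<close> lies at \<open>u * d\<close> and
    \<gamma> at \<open>- (g * u) * d\<close>. These offsets are weighted 1 and \<open>1 / g\<close>,
    so the cross terms with \<open>s\<close> cancel.\<close>
  have e1: "bh i - x i = u * d i - s i" for i
    by (simp add: s_def pm)
  have e2: "x i - \<gamma> i = s i + (g * u) * d i" for i
    unfolding gu by (simp add: s_def pm d_def algebra_simps)
  have sd: "bil p A d s = bil p A s d" by (rule bil_commute[OF sym_A])
  have s1: "bil p A (\<lambda>i. t * d i) s = t * bil p A s d" for t
    using bil_scale[of p A t d 1 s] sd by simp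
  have s2: "bil p A s (\<lambda>i. t * d i) = t * bil p A s d" for t
    using bil_scale[of p A 1 s t d] by simp
  have q1: "bil p A (\<lambda>i. bh i - x i) (\<lambda>i. bh i - x i) = u * u * bil p A d d - 2 * u * bil p A s d + bil p A s s"
    unfolding e1 bil_diff_left bil_diff_right s1 s2 bil_scale by simp
  have q2: "bil p A (\<lambda>i. x i - \<gamma> i) (\<lambda>i. x i - \<gamma> i) = bil p A s s + 2 * (g * u) * bil p A s d + (g * u) * (g * u) * bil p A d d"
    unfolding e2 bil_add_left bil_add_right s1 s2 bil_scale by simp
  have "bil p A (\<lambda>i. bh i - x i) (\<lambda>i. bh i - x i) + bil p A (\<lambda>i. x i - \<gamma> i) (\<lambda>i. x i - \<gamma> i) / g
     = (1 + 1 / g) * bil p A s s + (u * (g + 1)) * u * bil p A d d"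
    unfolding q1 q2 using g by (simp add: field_simps)
  also have "\<dots> = (g + 1) / g * bil p A s s + bil p A d d / (g + 1)"
    unfolding u using g by (simp add: u_def field_simps)
  finally show ?thesis by (simp add: s_def[abs_def] d_def[abs_def])
qed

definition "joint = (\<lambda>z. g_prior_joint X (Matrix.vec p \<gamma>) g a b (Matrix.vec p bh) S (Matrix.vec p (fst z)) (snd z))"

text \<open>Only \<open>|det|\<close> of \<open>(X\<^sup>T X)\<^sup>-\<^sup>1\<close> appears, from the product of the two square roots in the normal
  densities; so its sign is not needed.\<close>

definition "joint_const = S powr (real (n - p) / 2 - 1) / (2 powr (real (n - p) / 2) * Gamma (real (n - p) / 2))
   / ((2 * pi) ^ p * sqrt (g ^ p) * \<bar>Determinant.det (gram_inv X)\<bar>)"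

lemma joint_const_pos: "joint_const > 0"
  unfolding joint_const_def using S pn g det_gram_inv by (intro divide_pos_pos mult_pos_pos) (auto intro!: Gamma_real_pos)

text \<open>Completing the square merges the exponents. The powers of \<open>v\<close> add up as
  \<open>- (n - p) / 2\<close> from the chi-square density, \<open>- p\<close> from the two normal
  densities and \<open>- a / 2 - 1\<close> from the prior, which is the exponent in
  \<open>kern\<close>.\<close>

lemma joint_eq: "joint z = joint_const * K.kern z"
proof (cases z)
  case (Pair x v)
  show ?thesis
  proof (cases "v > 0")
    case v: True
    let ?D = "Determinant.det (gram_inv X)"
    let ?q1 = "bil p A (\<lambda>i. bh i - x i) (\<lambda>i. bh i - x i)"
    let ?q2 = "bil p A (\<lambda>i. x i - \<gamma> i) (\<lambda>i. x i - \<gamma> i)"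
    let ?G = "2 powr (real (n - p) / 2) * Gamma (real (n - p) / 2)"
    have gv: "g * v > 0" using g v by simp
    have dims: "dim_row X = n" using X by simp
    have sq: "sqrt ((2 * pi) ^ p * (v ^ p * ?D)) * sqrt ((2 * pi) ^ p * ((g * v) ^ p * ?D)) = (2 * pi) ^ p * sqrt (g ^ p) * \<bar>?D\<bar> * v ^ p"
    proof -
      have "sqrt ((2 * pi) ^ p * (v ^ p * ?D)) * sqrt ((2 * pi) ^ p * ((g * v) ^ p * ?D)) =
        sqrt (g ^ p * ((2 * pi) ^ p * v ^ p * ?D)\<^sup>2)"
        unfolding real_sqrt_mult[symmetric] by (simp add: power_mult_distrib power2_eq_square mult_ac)
      also have "\<dots> = sqrt (g ^ p) * ((2 * pi) ^ p * v ^ p * \<bar>?D\<bar>)"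
        using v by (simp add: real_sqrt_mult abs_mult)
      finally show ?thesis by simp
    qed
    have chi: "scaled_chi_square_density v (n - p) S = S powr (real (n - p) / 2 - 1) / ?G * (v powr (- (real (n - p) / 2)) * exp (- S / (2 * v)))"
    proof -
      have "v powr (real (n - p) / 2 - 1) * v = v powr (real (n - p) / 2)"
        using v powr_add[of v "real (n - p) / 2 - 1" 1] by simp
      then have "(S / v) powr (real (n - p) / 2 - 1) / v = S powr (real (n - p) / 2 - 1) * v powr (- (real (n - p) / 2))"
        using S v by (simp add: powr_divide powr_minus_divide divide_simps)
      then show ?thesis
        using S v unfolding scaled_chi_square_density_def chi_square_density_def
        by (simp add: divide_simps mult_ac)
    qed
    have ex: "exp (- ?q1 / (2 * v)) * exp (- S / (2 * v)) * exp (- ?q2 / (2 * (g * v))) * exp (- b / (2 * v))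
      = exp (- bil p A (\<lambda>i. x i - post_mean i) (\<lambda>i. x i - post_mean i) / (2 * (g / (g + 1) * v)) - post_scale / 2 / v)"
    proof -
      have "- ?q1 / (2 * v) + - S / (2 * v) + - ?q2 / (2 * (g * v)) + - b / (2 * v) = - ((?q1 + ?q2 / g) + S + b) / (2 * v)"
        using v g by (simp add: field_simps)
      also have "\<dots> = - bil p A (\<lambda>i. x i - post_mean i) (\<lambda>i. x i - post_mean i) / (2 * (g / (g + 1) * v)) - post_scale / 2 / v"
      proof -
        have "bil p A (\<lambda>i. x i - post_mean i) (\<lambda>i. x i - post_mean i) / (2 * (g / (g + 1) * v)) = (g + 1) / g * bil p A (\<lambda>i. x i - post_mean i) (\<lambda>i. x i - post_mean i) / (2 * v)"
          using v g by (simp add: divide_simps)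
        then show ?thesis
          unfolding complete_square post_scale_def minus_divide_left[symmetric] by (simp only: add_divide_distrib) (simp add: field_simps)
      qed
      finally show ?thesis unfolding exp_add[symmetric] by simp
    qed
    have pw: "v powr (- (real (n - p) / 2)) * v powr (- a / 2 - 1) / v ^ p = v powr (- ((n + a) / 2 + p / 2) - 1)"
    proof -
      have "v powr (- (real (n - p) / 2)) * v powr (- a / 2 - 1) / v ^ p = v powr (- (real (n - p) / 2)) * v powr (- a / 2 - 1) * v powr (- real p)"
        using v by (simp add: powr_minus_divide powr_realpow)
      also have "\<dots> = v powr (- ((n + a) / 2 + p / 2) - 1)"
        unfolding powr_add[symmetric] using pn by (intro arg_cong[where f = "(powr) v"]) (simp add: of_nat_diff field_simps)
      finally show ?thesis .
    qed
    have "joint z = (exp (- ?q1 / (2 * v)) / sqrt ((2 * pi) ^ p * (v ^ p * ?D)))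
        * (S powr (real (n - p) / 2 - 1) / ?G * (v powr (- (real (n - p) / 2)) * exp (- S / (2 * v))))
        * (exp (- ?q2 / (2 * (g * v))) / sqrt ((2 * pi) ^ p * ((g * v) ^ p * ?D)))
        * (v powr (- a / 2 - 1) * exp (- b / (2 * v)))"
      using v X unfolding joint_def g_prior_joint_def Pair inverse_gamma_kernel_def
      by (simp add: mvn_density_gram_inv[OF v] mvn_density_gram_inv[OF gv] chi)
    also have "\<dots> = S powr (real (n - p) / 2 - 1) / ?G
        * (v powr (- (real (n - p) / 2)) * v powr (- a / 2 - 1)) / (sqrt ((2 * pi) ^ p * (v ^ p * ?D)) * sqrt ((2 * pi) ^ p * ((g * v) ^ p * ?D)))
        * (exp (- ?q1 / (2 * v)) * exp (- S / (2 * v)) * exp (- ?q2 / (2 * (g * v))) * exp (- b / (2 * v)))"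
      by (rule mult_fractions_regroup)
    also have "\<dots> = joint_const * ((v powr (- (real (n - p) / 2)) * v powr (- a / 2 - 1) / v ^ p)
        * exp (- bil p A (\<lambda>i. x i - post_mean i) (\<lambda>i. x i - post_mean i) / (2 * (g / (g + 1) * v)) - post_scale / 2 / v))"
      unfolding sq ex joint_const_def by simp
    also have "\<dots> = joint_const * K.kern z"
      unfolding pw using v by (simp add: K.kern_def Pair)
    finally show ?thesis .
  qed (simp add: Pair joint_def g_prior_joint_def K.kern_def)
qed

definition "post = g_prior_posterior X (Matrix.vec p \<gamma>) g a b (Matrix.vec p bh) S"

lemma post_eq: "post = density (param_measure p) (\<lambda>z. ennreal (joint_const * K.kern z) / (ennreal joint_const * K.kern_mass))"
proof -
  have d: "dim_col X = p" using X by simp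
  have j: "(\<lambda>(\<beta>, v). ennreal (g_prior_joint X (Matrix.vec p \<gamma>) g a b (Matrix.vec p bh) S (Matrix.vec p \<beta>) v)) = (\<lambda>z. ennreal (joint_const * K.kern z))"
    unfolding joint_eq[symmetric] joint_def by (simp add: split_def)
  have "g_prior_evidence X (Matrix.vec p \<gamma>) g a b (Matrix.vec p bh) S = (\<integral>\<^sup>+z. ennreal (joint_const * K.kern z) \<partial>param_measure p)"
    unfolding g_prior_evidence_def d j ..
  also have "\<dots> = ennreal joint_const * K.kern_mass"
    using joint_const_pos by (subst nn_integral_cmult[symmetric]) (auto simp: ennreal_mult K.kern_nonneg)
  finally have ev: "g_prior_evidence X (Matrix.vec p \<gamma>) g a b (Matrix.vec p bh) S = ennreal joint_const * K.kern_mass" .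
  have j2: "(\<lambda>(\<beta>, v). ennreal (g_prior_joint X (Matrix.vec p \<gamma>) g a b (Matrix.vec p bh) S (Matrix.vec p \<beta>) v) / E) = (\<lambda>z. ennreal (joint_const * K.kern z) / E)" for E
    using fun_cong[OF j] by (auto simp: fun_eq_iff split_def)
  show ?thesis unfolding post_def g_prior_posterior_def d ev j2 ..
qed

lemma emeasure_post:
  assumes E[measurable]: "E \<in> sets (Lb {..<p})"
  shows "emeasure post {z \<in> space (param_measure p). fst z \<in> E}
    = (\<integral>\<^sup>+z. ennreal (K.kern z) * indicator E (fst z) \<partial>param_measure p) / K.kern_mass"
proof -
  let ?I = "\<integral>\<^sup>+z. ennreal (K.kern z) \<partial>param_measure p"
  let ?E = "{z \<in> space (param_measure p). fst z \<in> E}"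
  have Em: "?E \<in> sets (param_measure p)" by measurable
  have C: "ennreal joint_const \<noteq> 0" "ennreal joint_const < \<infinity>" using joint_const_pos by auto
  have I: "?I \<noteq> 0" "?I < \<infinity>" using K.kern_proper by auto
  have r: "ennreal (joint_const * K.kern z) / (ennreal joint_const * ?I) = ennreal (K.kern z) / ?I" for z
  proof -
    have 1: "ennreal (joint_const * K.kern z) = ennreal joint_const * ennreal (K.kern z)" using joint_const_pos by (simp add: ennreal_mult K.kern_nonneg)
    have 2: "ennreal joint_const * inverse (ennreal joint_const) = 1" using ennreal_divide_self[of "ennreal joint_const"] C by (simp add: divide_ennreal_def)
    have 3: "inverse (ennreal joint_const * ?I) = inverse (ennreal joint_const) * inverse ?I"
      using C(2) I(2) unfolding infinity_ennreal_def by (rule ennreal_inverse_mult)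
    have "ennreal (joint_const * K.kern z) / (ennreal joint_const * ?I) = (ennreal joint_const * inverse (ennreal joint_const)) * (ennreal (K.kern z) * inverse ?I)"
      unfolding divide_ennreal_def 1 3 by (simp only: mult_ac)
    then show ?thesis unfolding 2 divide_ennreal_def by simp
  qed
  have "emeasure post ?E = (\<integral>\<^sup>+z. ennreal (K.kern z) / ?I * indicator ?E z \<partial>param_measure p)"
    unfolding post_eq r using Em by (intro emeasure_density) measurable
  also have "\<dots> = (\<integral>\<^sup>+z. ennreal (K.kern z) * indicator E (fst z) / ?I \<partial>param_measure p)"
    by (intro nn_integral_cong) (auto simp: indicator_def)
  also have "\<dots> = (\<integral>\<^sup>+z. ennreal (K.kern z) * indicator E (fst z) \<partial>param_measure p) / ?I"
    by (rule nn_integral_divide) measurable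
  finally show ?thesis .
qed

lemma sets_post[simp]: "sets post = sets (param_measure p)" and space_post[simp]: "space post = space (param_measure p)"
  by (simp_all add: post_eq)

lemma prob_space_post: "prob_space post"
proof
  have i: "indicator (space (Lb {..<p})) (fst z) = (1 :: ennreal)" if "z \<in> space (param_measure p)" for z :: "(nat \<Rightarrow> real) \<times> real"
    using that by (simp add: space_pair_measure mem_Times_iff)
  have "space post = {z \<in> space (param_measure p). fst z \<in> space (Lb {..<p})}"
    unfolding space_post by (simp add: space_pair_measure set_eq_iff mem_Times_iff)
  then have "emeasure post (space post) = (\<integral>\<^sup>+z. ennreal (K.kern z) * indicator (space (Lb {..<p})) (fst z) \<partial>param_measure p) / K.kern_mass"
    using emeasure_post[OF sets.top] by (simp only:)
  also have "(\<integral>\<^sup>+z. ennreal (K.kern z) * indicator (space (Lb {..<p})) (fst z) \<partial>param_measure p) = K.kern_mass"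
    by (intro nn_integral_cong) (simp only: i mult_1_right)
  also have "K.kern_mass / K.kern_mass = 1"
    using K.kern_proper by (intro ennreal_divide_self) auto
  finally show "emeasure post (space post) = 1" .
qed

lemma measure_post_le:
  assumes E: "E \<in> sets (Lb {..<p})" and R: "R \<ge> 0"
    and le: "(\<integral>\<^sup>+z. ennreal (K.kern z) * indicator E (fst z) \<partial>param_measure p) \<le> ennreal R * K.kern_mass"
  shows "measure post {z \<in> space (param_measure p). fst z \<in> E} \<le> R"
proof -
  have "emeasure post {z \<in> space (param_measure p). fst z \<in> E} \<le> ennreal R * K.kern_mass / K.kern_mass"
    unfolding emeasure_post[OF E] by (rule divide_right_mono_ennreal[OF le])
  also have "\<dots> = ennreal R"
    using K.kern_proper by (simp add: ennreal_mult_divide_eq less_top)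
  finally show ?thesis unfolding measure_def by (intro enn2real_leI R)
qed

lemma post_concentration:
  fixes \<epsilon> :: real assumes e: "\<epsilon> > 0"
  shows "measure post {z \<in> space (param_measure p). \<exists>i<p. \<epsilon> \<le> \<bar>fst z i - post_mean i\<bar>}
    \<le> 2 * p * exp (- (\<epsilon>\<^sup>2 * n * (g + 1) * (n + a) / (4 * lmax * g * post_scale))) + exp (- (n + a) / 20)"
proof -
  let ?E = "{x \<in> space (Lb {..<p}). \<exists>i<p. \<epsilon> \<le> \<bar>x i - post_mean i\<bar>}"
  have s: "{z \<in> space (param_measure p). \<exists>i<p. \<epsilon> \<le> \<bar>fst z i - post_mean i\<bar>} = {z \<in> space (param_measure p). fst z \<in> ?E}"
    by (intro Collect_cong) (auto simp: space_pair_measure mem_Times_iff)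
  have m: "?E \<in> sets (Lb {..<p})" by measurable
  have h: "- ((n + a) / 2) / 10 = - (n + a) / 20" by (simp add: field_simps)
  have q: "- (n / lmax) * \<epsilon>\<^sup>2 * ((n + a) / 2) / (4 * (g / (g + 1)) * (post_scale / 2)) = - (\<epsilon>\<^sup>2 * n * (g + 1) * (n + a) / (4 * lmax * g * post_scale))"
    using g post_scale_pos lmax_pos by (simp add: field_simps)
  have "measure post {z \<in> space (param_measure p). fst z \<in> ?E} \<le> 2 * p * exp (- (n / lmax) * \<epsilon>\<^sup>2 * ((n + a) / 2) / (4 * (g / (g + 1)) * (post_scale / 2))) + exp (- ((n + a) / 2) / 10)"
    by (rule measure_post_le[OF m _ K.kern_concentration[OF e]]) (intro add_nonneg_nonneg mult_nonneg_nonneg of_nat_0_le_iff exp_ge_zero)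
  then show ?thesis unfolding s h q .
qed

lemma post_box:
  fixes \<epsilon> :: real assumes e: "\<epsilon> > 0"
  shows "measure post {z \<in> space (param_measure p). \<forall>i<p. \<bar>fst z i - c i\<bar> \<le> \<epsilon>}
    \<le> exp (- real p * (exp (- 1 - 4 * \<epsilon>\<^sup>2 * n * (g + 1) * (n + a) / (lmin * g * post_scale)) / sqrt (2 * pi))) + exp (- (n + a) / 20)"
proof -
  let ?E = "{x \<in> space (Lb {..<p}). \<forall>i<p. \<bar>x i - c i\<bar> \<le> \<epsilon>}"
  have s: "{z \<in> space (param_measure p). \<forall>i<p. \<bar>fst z i - c i\<bar> \<le> \<epsilon>} = {z \<in> space (param_measure p). fst z \<in> ?E}"
    by (intro Collect_cong) (auto simp: space_pair_measure mem_Times_iff)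
  have m: "?E \<in> sets (Lb {..<p})" by measurable
  have h: "- ((n + a) / 2) / 10 = - (n + a) / 20" by (simp add: field_simps)
  have q: "\<epsilon>\<^sup>2 * (n / lmin) * (4 * ((n + a) / 2)) / (g / (g + 1) * (post_scale / 2)) = 4 * \<epsilon>\<^sup>2 * n * (g + 1) * (n + a) / (lmin * g * post_scale)"
    using g post_scale_pos lmin by (simp add: field_simps)
  have "measure post {z \<in> space (param_measure p). fst z \<in> ?E} \<le> exp (- real p * (exp (- 1 - \<epsilon>\<^sup>2 * (n / lmin) * (4 * ((n + a) / 2)) / (g / (g + 1) * (post_scale / 2))) / sqrt (2 * pi))) + exp (- ((n + a) / 2) / 10)"
    by (rule measure_post_le[OF m _ K.kern_box[OF e]]) (intro add_nonneg_nonneg exp_ge_zero)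
  then show ?thesis unfolding s h q .
qed

lemma posterior_linf_prob_eq:
  assumes e: "\<epsilon> > 0" and c: "\<beta> \<in> carrier_vec p"
  shows "posterior_linf_prob X (Matrix.vec p \<gamma>) g a b (Matrix.vec p bh) S \<beta> \<epsilon> =
    measure post {z \<in> space (param_measure p). \<exists>i<p. \<epsilon> < \<bar>fst z i - vec_index \<beta> i\<bar>}"
proof -
  have d: "dim_col X = p" using X by simp
  have "linf_norm (Matrix.vec p x - \<beta>) > \<epsilon> \<longleftrightarrow> (\<exists>i<p. \<epsilon> < \<bar>x i - vec_index \<beta> i\<bar>)" for x
    using e c by (subst linf_norm_gt_iff) auto
  then show ?thesis
    unfolding posterior_linf_prob_def d post_def[symmetric] by (intro arg_cong2[where f = measure] refl) auto
qed

end

section \<open>Noise\<close>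

text \<open>The identity form, which makes \<open>gauss_tail\<close> applicable to the
  noise.\<close>

abbreviation idm :: "nat \<Rightarrow> nat \<Rightarrow> real" where "idm \<equiv> \<lambda>i j. if i = j then 1 else 0"

lemma bil_idm: "bil n idm x y = (\<Sum>i<n. x i * y i)"
  unfolding bil_def by (intro sum.cong refl) (simp add: if_distrib if_distribR cong: if_cong)

lemma inv_mat_smult_one:
  assumes "\<sigma> \<noteq> 0"
  shows "inv_mat (\<sigma> \<cdot>\<^sub>m 1\<^sub>m n) = (1 / \<sigma>) \<cdot>\<^sub>m 1\<^sub>m n"
proof (rule inv_mat_eq)
  have "(\<sigma> \<cdot>\<^sub>m 1\<^sub>m n) * ((1 / \<sigma>) \<cdot>\<^sub>m 1\<^sub>m n) = \<sigma> \<cdot>\<^sub>m ((1 / \<sigma>) \<cdot>\<^sub>m (1\<^sub>m n * 1\<^sub>m n))"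
    by (subst mult_smult_assoc_mat[of _ n n _ n]) (auto simp: mult_smult_distrib[of _ n n _ n])
  also have "\<dots> = 1\<^sub>m n" using assms by (intro eq_matI) auto
  finally show "(\<sigma> \<cdot>\<^sub>m 1\<^sub>m n) * ((1 / \<sigma>) \<cdot>\<^sub>m 1\<^sub>m n) = 1\<^sub>m n" .
qed auto

lemma mvn_density_iso:
  assumes s: "\<sigma> > 0"
  shows "mvn_density (0\<^sub>v n) (\<sigma> \<cdot>\<^sub>m 1\<^sub>m n) (Matrix.vec n x) =
    exp (- bil n idm x x / (2 * \<sigma>)) / sqrt ((2 * pi * \<sigma>) ^ n)"
proof -
  have d: "Matrix.vec n x - 0\<^sub>v n = Matrix.vec n x" by auto
  have "scalar_prod (Matrix.vec n x) (((1 / \<sigma>) \<cdot>\<^sub>m 1\<^sub>m n) *\<^sub>v Matrix.vec n x) = (1 / \<sigma>) * bil n idm x x"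
    unfolding bil_idm smult_mat_mult_vec[OF one_carrier_mat vec_carrier] scalar_prod_vec[symmetric] by simp
  then show ?thesis
    using s unfolding mvn_density_def d inv_mat_smult_one[OF less_imp_neq[OF s, symmetric]] by (simp add: power_mult_distrib)
qed

locale noise = prob_space M for M :: "'w measure" +
  fixes e :: "'w \<Rightarrow> nat \<Rightarrow> real" and n :: nat and \<sigma> :: real
  assumes sigma: "\<sigma> > 0"
    and law: "distributed M (Lb {..<n}) e (\<lambda>x. ennreal (mvn_density (0\<^sub>v n) (\<sigma> \<cdot>\<^sub>m 1\<^sub>m n) (Matrix.vec n x)))"
begin

lemma measurable_e: "e \<in> measurable M (Lb {..<n})"
  using law by (rule distributed_measurable)

text \<open>The subtraction of 0 keeps the shape of \<open>gauss_tail\<close> with mean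
  \<open>m = 0\<close>.\<close>

definition "dens = (\<lambda>x. ennreal (1 / sqrt ((2 * pi * \<sigma>) ^ n)) * ennreal (exp (- bil n idm (\<lambda>i. x i - 0) (\<lambda>i. x i - 0) / (2 * \<sigma>))))"

lemma emeasure_e:
  assumes "E \<in> sets (Lb {..<n})"
  shows "emeasure M (e -` E \<inter> space M) = (\<integral>\<^sup>+x. dens x * indicator E x \<partial>Lb {..<n})"
proof -
  have "(\<lambda>x. ennreal (mvn_density (0\<^sub>v n) (\<sigma> \<cdot>\<^sub>m 1\<^sub>m n) (Matrix.vec n x))) = dens"
    unfolding dens_def mvn_density_iso[OF sigma] using sigma by (auto simp: ennreal_mult[symmetric])
  with law have "distributed M (Lb {..<n}) e dens" by simp
  from distributed_emeasure[OF this assms] show ?thesis .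
qed

lemma measurable_dens: "dens \<in> borel_measurable (Lb {..<n})"
  unfolding dens_def by measurable

lemma dens_total: "(\<integral>\<^sup>+x. dens x \<partial>Lb {..<n}) = 1"
proof -
  have "(\<integral>\<^sup>+x. dens x \<partial>Lb {..<n}) = (\<integral>\<^sup>+x. dens x * indicator (space (Lb {..<n})) x \<partial>Lb {..<n})"
    by (intro nn_integral_cong) simp
  also have "\<dots> = emeasure M (e -` space (Lb {..<n}) \<inter> space M)" by (rule emeasure_e[symmetric]) simp
  also have "e -` space (Lb {..<n}) \<inter> space M = space M" using measurable_space[OF measurable_e] by auto
  finally show ?thesis by (simp add: emeasure_space_1)
qed

lemma noise_tail1:
  assumes c: "(\<Sum>k<n. (c k)\<^sup>2) \<le> s" and s: "s > 0" and t: "t > 0"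
  shows "measure M (e -` {x \<in> space (Lb {..<n}). t \<le> (\<Sum>k<n. c k * x k)} \<inter> space M) \<le> exp (- t\<^sup>2 / (2 * \<sigma> * s))"
proof -
  let ?E = "{x \<in> space (Lb {..<n}). t \<le> (\<Sum>k<n. c k * x k)}"
  define N where "N = (\<Sum>k<n. (c k)\<^sup>2)"
  have Em: "?E \<in> sets (Lb {..<n})" by measurable
  have N0: "N \<ge> 0" unfolding N_def by (rule sum_nonneg) simp
  show ?thesis
  proof (cases "N = 0")
    case True
    then have "\<forall>k<n. c k = 0" unfolding N_def by (subst (asm) sum_nonneg_eq_0_iff) auto
    then have E0: "?E = {}" using t by auto
    show ?thesis unfolding E0 by simp
  next
    case False
    then have N: "N > 0" using N0 by simp
    \<comment> \<open>The foot of the perpendicular from the origin to the hyperplane where the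
      linear functional equals \<open>t\<close>; division by \<open>N\<close> is why vanishing
      coefficients are treated separately.\<close>
    define y where "y k = t / N * c k" for k
    have yx: "bil n idm y x = t / N * (\<Sum>k<n. c k * x k)" for x
      unfolding bil_idm y_def by (simp add: sum_distrib_left mult.assoc)
    have yy: "bil n idm y y = t\<^sup>2 / N"
    proof -
      have "(\<Sum>k<n. c k * y k) = (\<Sum>k<n. t / N * (c k)\<^sup>2)"
        by (intro sum.cong refl) (simp add: y_def power2_eq_square)
      also have "\<dots> = t / N * N" unfolding sum_distrib_left[symmetric] N_def[symmetric] ..
      finally show ?thesis unfolding yx using N by (simp add: power2_eq_square)
    qed
    let ?g = "\<lambda>x. ennreal (exp (- bil n idm (\<lambda>i. x i - 0) (\<lambda>i. x i - 0) / (2 * \<sigma>)))"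
    let ?H = "{x. bil n idm y y \<le> bil n idm y (\<lambda>i. x i - 0)}"
    let ?C = "ennreal (1 / sqrt ((2 * pi * \<sigma>) ^ n))"
    have EH: "indicator ?E x \<le> (indicator ?H x :: ennreal)" for x
    proof -
      have "x \<in> ?H" if "x \<in> ?E"
      proof -
        have "t / N * t \<le> t / N * (\<Sum>k<n. c k * x k)" using that t N by (intro mult_left_mono) auto
        then show ?thesis unfolding yy by (simp add: yx power2_eq_square)
      qed
      then show ?thesis by (auto simp: indicator_def)
    qed
    have gm: "(\<lambda>x. ?g x * indicator ?E x) \<in> borel_measurable (Lb {..<n})"
      using Em by measurable
    have "sym_coeffs n idm" by (simp add: sym_coeffs_def)
    from gauss_tail[OF this sigma, of "\<lambda>_. 0" y]
    have tl: "(\<integral>\<^sup>+x. ?g x * indicator ?H x \<partial>Lb {..<n}) \<le> ennreal (exp (- bil n idm y y / (2 * \<sigma>))) * (\<integral>\<^sup>+x. ?g x \<partial>Lb {..<n})" .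
    have "emeasure M (e -` ?E \<inter> space M) = ?C * (\<integral>\<^sup>+x. ?g x * indicator ?E x \<partial>Lb {..<n})"
      unfolding emeasure_e[OF Em] dens_def mult.assoc by (rule nn_integral_cmult[OF gm])
    also have "\<dots> \<le> ?C * (ennreal (exp (- bil n idm y y / (2 * \<sigma>))) * (\<integral>\<^sup>+x. ?g x \<partial>Lb {..<n}))"
      by (intro mult_left_mono order_trans[OF _ tl] nn_integral_mono EH) auto
    also have "\<dots> = ennreal (exp (- bil n idm y y / (2 * \<sigma>))) * (?C * (\<integral>\<^sup>+x. ?g x \<partial>Lb {..<n}))"
      by (simp only: mult_ac)
    also have "?C * (\<integral>\<^sup>+x. ?g x \<partial>Lb {..<n}) = (\<integral>\<^sup>+x. dens x \<partial>Lb {..<n})"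
      unfolding dens_def by (rule nn_integral_cmult[symmetric]) measurable
    also have "ennreal (exp (- bil n idm y y / (2 * \<sigma>))) * (\<integral>\<^sup>+x. dens x \<partial>Lb {..<n}) = ennreal (exp (- bil n idm y y / (2 * \<sigma>)))"
      unfolding dens_total by simp
    also have "\<dots> \<le> ennreal (exp (- t\<^sup>2 / (2 * \<sigma> * s)))"
    proof (rule ennreal_leI)
      have "t\<^sup>2 / (2 * \<sigma> * s) \<le> t\<^sup>2 / (2 * \<sigma> * N)"
        using c N s sigma by (intro divide_left_mono mult_left_mono mult_pos_pos) (auto simp: N_def)
      then show "exp (- bil n idm y y / (2 * \<sigma>)) \<le> exp (- t\<^sup>2 / (2 * \<sigma> * s))"
        unfolding yy by (simp add: mult_ac)
    qed
    finally show ?thesis unfolding measure_def by (intro enn2real_leI) auto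
  qed
qed

lemma noise_tail:
  assumes c: "(\<Sum>k<n. (c k)\<^sup>2) \<le> s" and s: "s > 0" and t: "t > 0"
  shows "measure M (e -` {x \<in> space (Lb {..<n}). t \<le> \<bar>\<Sum>k<n. c k * x k\<bar>} \<inter> space M) \<le> 2 * exp (- t\<^sup>2 / (2 * \<sigma> * s))"
proof -
  let ?E = "\<lambda>c. {x \<in> space (Lb {..<n}). t \<le> (\<Sum>k<n. c k * x k)}"
  have m: "e -` ?E c \<inter> space M \<in> sets M" for c :: "nat \<Rightarrow> real"
    by (rule measurable_sets[OF measurable_e]) measurable
  have sub: "e -` {x \<in> space (Lb {..<n}). t \<le> \<bar>\<Sum>k<n. c k * x k\<bar>} \<inter> space M \<subseteq> (e -` ?E c \<inter> space M) \<union> (e -` ?E (\<lambda>k. - c k) \<inter> space M)"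
    by (auto simp: sum_negf abs_if split: if_splits)
  have "measure M (e -` {x \<in> space (Lb {..<n}). t \<le> \<bar>\<Sum>k<n. c k * x k\<bar>} \<inter> space M) \<le>
     measure M ((e -` ?E c \<inter> space M) \<union> (e -` ?E (\<lambda>k. - c k) \<inter> space M))"
    by (rule finite_measure_mono[OF sub]) (intro sets.Un m)
  also have "\<dots> \<le> measure M (e -` ?E c \<inter> space M) + measure M (e -` ?E (\<lambda>k. - c k) \<inter> space M)"
    by (rule measure_Un_le[OF m m])
  also have "\<dots> \<le> exp (- t\<^sup>2 / (2 * \<sigma> * s)) + exp (- t\<^sup>2 / (2 * \<sigma> * s))"
    using c by (intro add_mono noise_tail1[OF _ s t]) auto
  finally show ?thesis by simp
qed

text \<open>Once the other coordinates are fixed, at most one value of coordinate \<open>k\<close>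
  lies on the hyperplane, so it is a Lebesgue null set; the noise has a density.\<close>

lemma noise_functional_nonzero:
  assumes k: "k < n" and z: "z k \<noteq> 0"
  shows "AE \<omega> in M. (\<Sum>i<n. z i * e \<omega> i) \<noteq> 0"
proof -
  let ?E = "{x \<in> space (Lb {..<n}). (\<Sum>i<n. z i * x i) = 0}"
  let ?I = "{..<n} - {k}"
  have ins: "{..<n} = insert k ?I" using k by auto
  have Em: "?E \<in> sets (Lb {..<n})" by measurable
  then have "(indicator ?E :: _ \<Rightarrow> ennreal) \<in> borel_measurable (Lb {..<n})" by (rule borel_measurable_indicator)
  then have m: "(indicator ?E :: _ \<Rightarrow> ennreal) \<in> borel_measurable (Lb (insert k ?I))" unfolding ins[symmetric] .
  have "finite ?I" "k \<notin> ?I" by auto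
  from lborel_PiM.product_nn_integral_insert[OF this m]
  have "(\<integral>\<^sup>+x. indicator ?E x \<partial>Lb {..<n}) = (\<integral>\<^sup>+x. (\<integral>\<^sup>+y. indicator ?E (x(k := y)) \<partial>lborel) \<partial>Lb ?I)"
    unfolding ins[symmetric] .
  also have "\<dots> = (\<integral>\<^sup>+x. 0 \<partial>Lb ?I)"
  proof (rule nn_integral_cong)
    fix x
    define r where "r = - (\<Sum>i\<in>?I. z i * x i) / z k"
    have "(\<integral>\<^sup>+y. indicator ?E (x(k := y)) \<partial>lborel) \<le> (\<integral>\<^sup>+y. indicator {r} y \<partial>lborel)"
    proof (rule nn_integral_mono)
      fix y :: real
      have "(\<Sum>i<n. z i * (x(k := y)) i) = z k * y + (\<Sum>i\<in>?I. z i * x i)"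
        by (subst sum.remove[of _ k]) (use k in \<open>auto intro!: sum.cong\<close>)
      then have "y = r" if "x(k := y) \<in> ?E" using that z by (simp add: r_def field_simps)
      then show "indicator ?E (x(k := y)) \<le> (indicator {r} y :: ennreal)" by (auto simp: indicator_def)
    qed
    also have "\<dots> = 0" by simp
    finally show "(\<integral>\<^sup>+y. indicator ?E (x(k := y)) \<partial>lborel) = 0" by simp
  qed
  finally have "emeasure (Lb {..<n}) ?E = 0" using Em by simp
  then have "AE x in Lb {..<n}. x \<notin> ?E" using Em by (intro AE_not_in) (simp add: null_sets_def)
  then have "(\<integral>\<^sup>+x. dens x * indicator ?E x \<partial>Lb {..<n}) = (\<integral>\<^sup>+x. 0 \<partial>Lb {..<n})"
    by (intro nn_integral_cong_AE) auto
  then have "emeasure M (e -` ?E \<inter> space M) = 0" unfolding emeasure_e[OF Em] by simp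
  moreover have "e -` ?E \<inter> space M \<in> sets M" by (rule measurable_sets[OF measurable_e Em])
  ultimately have "AE \<omega> in M. \<omega> \<notin> e -` ?E \<inter> space M" by (intro AE_not_in) (simp add: null_sets_def)
  with AE_space show ?thesis
  proof eventually_elim
    case (elim \<omega>)
    then have "e \<omega> \<in> space (Lb {..<n})" using measurable_space[OF measurable_e] by blast
    with elim show ?case by auto
  qed
qed

end

locale noisy_design = design X n p lmin lmax + noise M e n \<sigma>
  for X n p lmin lmax and M :: "'w measure" and e \<sigma>
begin

text \<open>The thresholds are n^(1/4) for single errors, of variance \<sigma>, and n^(-1/4) for
  estimation errors, of variance at most \<open>\<sigma> * lmax / n\<close>. Both give tail
  exponents of order sqrt n, which is summable, while off the event the estimation error tends to
  0.\<close>

definition large_noise :: "'w set" where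
  "large_noise = {\<omega> \<in> space M. (\<exists>k<n. sqrt (sqrt n) \<le> \<bar>e \<omega> k\<bar>) \<or> (\<exists>i<p. 1 / sqrt (sqrt n) \<le> \<bar>vec_index (ols_noise (e \<omega>)) i\<bar>)}"

definition exceed :: "(nat \<Rightarrow> real) \<Rightarrow> real \<Rightarrow> 'w set" where
  "exceed c t = e -` {x \<in> space (Lb {..<n}). t \<le> \<bar>\<Sum>k<n. c k * x k\<bar>} \<inter> space M"

lemma large_noise_eq: "large_noise = (\<Union>k<n. exceed (\<lambda>j. if j = k then 1 else 0) (sqrt (sqrt n))) \<union> (\<Union>i<p. exceed (ols_weight i) (1 / sqrt (sqrt n)))"
proof -
  have "(\<Sum>j<n. (if j = k then 1 else 0) * e \<omega> j) = e \<omega> k" if "k < n" for k \<omega>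
    using that by (simp add: if_distrib if_distribR cong: if_cong)
  then show ?thesis
    using measurable_space[OF measurable_e] by (auto simp: large_noise_def exceed_def ols_noise_index)
qed

lemma exceed_sets: "exceed c t \<in> sets M"
  unfolding exceed_def by (rule measurable_sets[OF measurable_e]) measurable

lemma large_noise_sets: "large_noise \<in> sets M"
  unfolding large_noise_eq by (intro sets.Un sets.finite_UN exceed_sets) auto

lemma large_noise_small: "measure M large_noise \<le> 4 * n * exp (- sqrt n / (2 * \<sigma> * max 1 lmax))"
proof -
  let ?x = "exp (- sqrt n / (2 * \<sigma> * max 1 lmax))"
  have n: "n > 0" using pn by simp
  \<comment> \<open>\<open>max 1 lmax\<close> covers both families: the coordinate functionals have
    squared length 1, the weights at most \<open>lmax / n\<close>.\<close>
  have le: "sqrt n / (2 * \<sigma> * max 1 lmax) \<le> sqrt n / (2 * \<sigma> * s)" if "0 < s" "s \<le> max 1 lmax" for s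
    using that sigma by (intro divide_left_mono mult_left_mono mult_pos_pos) auto
  have 1: "measure M (exceed (\<lambda>j. if j = k then 1 else 0) (sqrt (sqrt n))) \<le> 2 * ?x" if k: "k < n" for k
  proof -
    have "(\<Sum>j<n. (if j = k then 1 else 0 :: real)\<^sup>2) = 1"
      using k by (simp add: if_distrib[of "\<lambda>x. x\<^sup>2"] cong: if_cong)
    then have "measure M (exceed (\<lambda>j. if j = k then 1 else 0) (sqrt (sqrt n))) \<le> 2 * exp (- (sqrt (sqrt n))\<^sup>2 / (2 * \<sigma> * 1))"
      unfolding exceed_def using n by (intro noise_tail) auto
    also have "\<dots> \<le> 2 * ?x" using le[of 1] by simp
    finally show ?thesis .
  qed
  have 2: "measure M (exceed (ols_weight i) (1 / sqrt (sqrt n))) \<le> 2 * ?x" if i: "i < p" for i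
  proof -
    have "measure M (exceed (ols_weight i) (1 / sqrt (sqrt n))) \<le> 2 * exp (- (1 / sqrt (sqrt n))\<^sup>2 / (2 * \<sigma> * (lmax / n)))"
      unfolding exceed_def using n lmax_pos by (intro noise_tail ols_weight_norm i) auto
    also have "- (1 / sqrt (sqrt n))\<^sup>2 / (2 * \<sigma> * (lmax / n)) = - (n / sqrt n) / (2 * \<sigma> * lmax)"
      using n by (simp add: power_divide)
    also have "n / sqrt n = sqrt n" by (rule real_div_sqrt) simp
    also have "2 * exp (- sqrt n / (2 * \<sigma> * lmax)) \<le> 2 * ?x" using le[of lmax] lmax_pos by simp
    finally show ?thesis .
  qed
  have "measure M large_noise \<le> measure M (\<Union>k<n. exceed (\<lambda>j. if j = k then 1 else 0) (sqrt (sqrt n))) + measure M (\<Union>i<p. exceed (ols_weight i) (1 / sqrt (sqrt n)))"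
    unfolding large_noise_eq by (intro measure_Un_le sets.finite_UN exceed_sets) auto
  also have "\<dots> \<le> (\<Sum>k<n. measure M (exceed (\<lambda>j. if j = k then 1 else 0) (sqrt (sqrt n)))) + (\<Sum>i<p. measure M (exceed (ols_weight i) (1 / sqrt (sqrt n))))"
    by (intro add_mono measure_UNION_le) (auto simp: exceed_sets)
  also have "\<dots> \<le> (\<Sum>k<n. 2 * ?x) + (\<Sum>i<p. 2 * ?x)" by (intro add_mono sum_mono 1 2) auto
  also have "\<dots> = (n + p) * (2 * ?x)" by (simp add: algebra_simps)
  also have "\<dots> \<le> (2 * n) * (2 * ?x)" using pn by (intro mult_right_mono) auto
  finally show ?thesis by simp
qed

lemma rss_pos_AE:
  assumes "\<beta> \<in> carrier_vec p"
  shows "AE \<omega> in M. rss X (X *\<^sub>v \<beta> + Matrix.vec n (e \<omega>)) \<noteq> 0"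
proof -
  obtain z k where "k < n" "z k \<noteq> 0" and
    z: "\<And>\<beta> e. \<beta> \<in> carrier_vec p \<Longrightarrow> rss X (X *\<^sub>v \<beta> + Matrix.vec n e) = 0 \<Longrightarrow> (\<Sum>k<n. z k * e k) = 0"
    using rss_zero_functional by blast
  from noise_functional_nonzero[of k z, OF this(1,2)] show ?thesis
    by eventually_elim (use z[OF assms] in blast)
qed

end

section \<open>Borel--Cantelli for tails of order exp (- \<kappa> sqrt n)\<close>

lemma summable_nat_exp_sqrt:
  assumes "\<kappa> > (0::real)"
  shows "summable (\<lambda>n. 4 * real n * exp (- \<kappa> * sqrt n))"
proof (rule summable_comparison_test_ev)
  have "(\<lambda>n. 4 * real n * exp (- \<kappa> * sqrt n) * real n ^ 2) \<longlonglongrightarrow> 0"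
    using assms by real_asymp
  then have "\<forall>\<^sub>F n in sequentially. 4 * real n * exp (- \<kappa> * sqrt n) * real n ^ 2 < 1"
    by (rule order_tendstoD) simp
  then show "\<forall>\<^sub>F n in sequentially. norm (4 * real n * exp (- \<kappa> * sqrt n)) \<le> 1 / real n ^ 2"
    using eventually_gt_at_top[of 0] by eventually_elim (simp add: field_simps)
  show "summable (\<lambda>n. 1 / real n ^ 2)"
    using inverse_power_summable[of 2] by (simp add: divide_inverse)
qed

lemma borel_cantelli_bound:
  assumes M: "prob_space M" and k: "\<kappa> > (0::real)"
    and B: "\<And>n. n \<ge> N \<Longrightarrow> B n \<in> sets M" "\<And>n. n \<ge> N \<Longrightarrow> measure M (B n) \<le> 4 * real n * exp (- \<kappa> * sqrt n)"
  shows "AE \<omega> in M. \<forall>\<^sub>F n in sequentially. \<omega> \<notin> B n"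
proof -
  interpret prob_space M by (rule M)
  define B' where "B' n = (if n \<ge> N then B n else {})" for n
  have s: "summable (\<lambda>n. measure M (B' n))"
  proof (rule summable_comparison_test_ev[OF _ summable_nat_exp_sqrt[OF k]])
    show "\<forall>\<^sub>F n in sequentially. norm (measure M (B' n)) \<le> 4 * real n * exp (- \<kappa> * sqrt n)"
      using eventually_ge_at_top[of N] by eventually_elim (use B in \<open>simp add: B'_def\<close>)
  qed
  have "AE \<omega> in M. \<forall>\<^sub>F n in sequentially. \<omega> \<in> space M - B' n"
    by (rule borel_cantelli_AE1[OF _ _ s]) (use B in \<open>auto simp: B'_def emeasure_eq_measure\<close>)
  then show ?thesis
  proof eventually_elim
    case (elim \<omega>)
    then show ?case using eventually_ge_at_top[of N] by eventually_elim (auto simp: B'_def)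
  qed
qed

section \<open>Asymptotics\<close>

text \<open>This and \<open>box_bound\<close> are the right-hand sides of
  \<open>post_concentration\<close> and \<open>post_box\<close> as functions of numbers only, so
  that limits can be taken apart from the posterior measure.\<close>

definition conc_bound :: "real \<Rightarrow> real \<Rightarrow> nat \<Rightarrow> nat \<Rightarrow> real \<Rightarrow> real \<Rightarrow> real \<Rightarrow> real" where
  "conc_bound lmax a n p g B \<epsilon> =
    real (2 * p) * exp (- (\<epsilon>\<^sup>2 * n * (g + 1) * (n + a) / (4 * lmax * g * B))) + exp (- (n + a) / 20)"

definition box_bound :: "real \<Rightarrow> real \<Rightarrow> nat \<Rightarrow> nat \<Rightarrow> real \<Rightarrow> real \<Rightarrow> real \<Rightarrow> real" where
  "box_bound lmin a n p g B \<epsilon> =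
    exp (- real p * (exp (- 1 - 4 * \<epsilon>\<^sup>2 * n * (g + 1) * (n + a) / (lmin * g * B)) / sqrt (2 * pi))) + exp (- (n + a) / 20)"

text \<open>\<open>b0\<close> is the true parameter, \<open>h\<close> the error of the least squares estimate, and \<open>E\<close> the squared
  length of the noise vector, which bounds \<open>q(h)\<close> and \<open>S\<close> by Pythagoras.\<close>

locale g_prior_truth = g_prior +
  fixes b0 h :: "nat \<Rightarrow> real" and E \<eta> :: real
  assumes bh_eq: "\<And>i. bh i = b0 i + h i" and hE: "bil p A h h \<le> E" and SE: "S \<le> E"
    and eta: "\<And>i. i < p \<Longrightarrow> \<bar>h i\<bar> \<le> \<eta>"
begin

definition "dev = (\<lambda>i. \<gamma> i - b0 i)"
definition "D2 = (\<Sum>i<p. (dev i)\<^sup>2)"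
definition "Pr \<epsilon> = measure post {z \<in> space (param_measure p). \<exists>i<p. \<epsilon> < \<bar>fst z i - b0 i\<bar>}"

lemma bil_diff_le: "bil p A (\<lambda>i. x i - y i) (\<lambda>i. x i - y i) \<le> 2 * bil p A x x + 2 * bil p A y y"
proof -
  have "0 \<le> bil p A (\<lambda>i. x i + y i) (\<lambda>i. x i + y i)" by (rule bil_nonneg)
  then show ?thesis unfolding bil_add_left bil_add_right bil_diff_left bil_diff_right by simp
qed

lemma bil_gamma_bh: "bil p A (\<lambda>i. bh i - \<gamma> i) (\<lambda>i. bh i - \<gamma> i) = bil p A (\<lambda>i. h i - dev i) (\<lambda>i. h i - dev i)"
  by (simp add: bh_eq dev_def algebra_simps)

text \<open>With \<open>D2_le\<close> this compares the scale with \<open>n * D2 / (g + 1)\<close>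
  in both directions, up to noise; this links \<tau> log p with the second condition of the
  theorem.\<close>

lemma post_scale_le: "post_scale \<le> b + E + (2 * E + 2 * (n / lmin) * D2) / (g + 1)"
proof -
  have "bil p A (\<lambda>i. h i - dev i) (\<lambda>i. h i - dev i) \<le> 2 * E + 2 * (n / lmin) * D2"
    using bil_diff_le[of h dev] hE bil_upper[of dev] by (simp add: D2_def)
  then have "bil p A (\<lambda>i. h i - dev i) (\<lambda>i. h i - dev i) / (g + 1) \<le> (2 * E + 2 * (n / lmin) * D2) / (g + 1)"
    using g by (intro divide_right_mono) auto
  then show ?thesis unfolding post_scale_def bil_gamma_bh using SE by linarith
qed

lemma D2_le: "n / lmax * D2 \<le> 2 * E + 2 * (g + 1) * post_scale"
proof -
  \<comment> \<open>The deviation is recovered as the estimation error minus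
    \<open>bh - \<gamma>\<close>, whose form is part of the posterior scale.\<close>
  have "bil p A dev dev = bil p A (\<lambda>i. h i - (h i - dev i)) (\<lambda>i. h i - (h i - dev i))" by simp
  also have "\<dots> \<le> 2 * bil p A h h + 2 * bil p A (\<lambda>i. h i - dev i) (\<lambda>i. h i - dev i)" by (rule bil_diff_le)
  also have "bil p A (\<lambda>i. h i - dev i) (\<lambda>i. h i - dev i) = (g + 1) * (post_scale - b - S)"
    unfolding bil_gamma_bh[symmetric] post_scale_def using g by simp
  also have "(g + 1) * (post_scale - b - S) \<le> (g + 1) * post_scale" using g b S by (intro mult_left_mono) auto
  finally have "bil p A dev dev \<le> 2 * bil p A h h + 2 * ((g + 1) * post_scale)" by simp
  then have "bil p A dev dev \<le> 2 * E + 2 * (g + 1) * post_scale" using hE unfolding mult.assoc by linarith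
  then show ?thesis using bil_lower[of dev] by (simp add: D2_def)
qed

lemma post_mean_dev: "post_mean i - b0 i = dev i / (g + 1) + g / (g + 1) * h i"
proof -
  have "post_mean i - b0 i = ((\<gamma> i + g * bh i) - (g + 1) * b0 i) / (g + 1)"
    using g by (simp add: post_mean_def diff_divide_distrib)
  also have "(\<gamma> i + g * bh i) - (g + 1) * b0 i = dev i + g * h i" by (simp add: bh_eq dev_def algebra_simps)
  finally show ?thesis by (simp add: add_divide_distrib)
qed

lemma shrunk_noise: "i < p \<Longrightarrow> \<bar>g / (g + 1) * h i\<bar> \<le> \<eta>"
proof -
  assume i: "i < p"
  have "\<bar>g / (g + 1) * h i\<bar> = g / (g + 1) * \<bar>h i\<bar>" using g by (simp add: abs_mult)
  also have "\<dots> \<le> 1 * \<bar>h i\<bar>" using g by (intro mult_right_mono) (auto simp: divide_simps)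
  finally show ?thesis using eta[OF i] by simp
qed

lemma measurable_event1: "{z \<in> space (param_measure p). \<exists>i<p. \<epsilon> < \<bar>fst z i - c i\<bar>} \<in> sets post"
  and measurable_event2: "{z \<in> space (param_measure p). \<exists>i<p. \<epsilon> \<le> \<bar>fst z i - c i\<bar>} \<in> sets post"
  unfolding sets_post by measurable

lemma Pr_le:
  assumes d: "\<And>i. i < p \<Longrightarrow> \<bar>dev i\<bar> / (g + 1) \<le> r" and e: "\<epsilon> > 0" "r + \<eta> \<le> \<epsilon> / 2"
  shows "Pr \<epsilon> \<le> conc_bound lmax a n p g post_scale (\<epsilon> / 2)"
proof -
  interpret P: prob_space post by (rule prob_space_post)
  have "Pr \<epsilon> \<le> measure post {z \<in> space (param_measure p). \<exists>i<p. \<epsilon> / 2 \<le> \<bar>fst z i - post_mean i\<bar>}"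
    unfolding Pr_def
  proof (rule P.finite_measure_mono[OF _ measurable_event2], intro subsetI CollectI conjI)
    fix z assume "z \<in> {z \<in> space (param_measure p). \<exists>i<p. \<epsilon> < \<bar>fst z i - b0 i\<bar>}"
    then obtain i where z: "z \<in> space (param_measure p)" and i: "i < p" and l: "\<epsilon> < \<bar>fst z i - b0 i\<bar>" by auto
    show "z \<in> space (param_measure p)" by (rule z)
    have "\<bar>post_mean i - b0 i\<bar> \<le> \<bar>dev i / (g + 1)\<bar> + \<bar>g / (g + 1) * h i\<bar>" unfolding post_mean_dev by (rule abs_triangle_ineq)
    also have "\<dots> \<le> r + \<eta>" using d[OF i] shrunk_noise[OF i] g by (intro add_mono) (auto simp: abs_divide)
    finally have "\<epsilon> / 2 \<le> \<bar>fst z i - post_mean i\<bar>" using l e by linarith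
    then show "\<exists>i<p. \<epsilon> / 2 \<le> \<bar>fst z i - post_mean i\<bar>" using i by blast
  qed
  also have "\<dots> \<le> conc_bound lmax a n p g post_scale (\<epsilon> / 2)"
    unfolding conc_bound_def by (rule post_concentration) (use e in simp)
  finally show ?thesis .
qed

text \<open>If the two exceptional probabilities sum to less than 1, some point is within \<epsilon>
  of both the true parameter and the posterior mean in every coordinate. Hence these two are within
  \<open>2 * \<epsilon>\<close> of each other.\<close>

lemma dev_le:
  assumes e: "\<epsilon> > 0" and lt: "Pr \<epsilon> + conc_bound lmax a n p g post_scale \<epsilon> < 1" and i: "i < p"
  shows "\<bar>dev i\<bar> / (g + 1) \<le> 2 * \<epsilon> + \<eta>"
proof -
  interpret P: prob_space post by (rule prob_space_post)
  let ?U = "{z \<in> space (param_measure p). \<exists>i<p. \<epsilon> < \<bar>fst z i - b0 i\<bar>}"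
  let ?V = "{z \<in> space (param_measure p). \<exists>i<p. \<epsilon> \<le> \<bar>fst z i - post_mean i\<bar>}"
  have "measure post (?U \<union> ?V) \<le> Pr \<epsilon> + measure post ?V"
    unfolding Pr_def by (rule measure_Un_le[OF measurable_event1 measurable_event2])
  also have "measure post ?V \<le> conc_bound lmax a n p g post_scale \<epsilon>"
    unfolding conc_bound_def by (rule post_concentration[OF e])
  finally have "measure post (?U \<union> ?V) < 1" using lt by simp
  then have "?U \<union> ?V \<noteq> space post" using P.prob_space by force
  moreover have "?U \<union> ?V \<subseteq> space post" by auto
  ultimately obtain z where "z \<in> space post" "z \<notin> ?U \<union> ?V" by blast
  then have "\<not> \<epsilon> < \<bar>fst z i - b0 i\<bar>" "\<not> \<epsilon> \<le> \<bar>fst z i - post_mean i\<bar>" using i by auto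
  then have "\<bar>post_mean i - b0 i\<bar> \<le> 2 * \<epsilon>" by linarith
  moreover have "dev i / (g + 1) = (post_mean i - b0 i) - g / (g + 1) * h i" unfolding post_mean_dev by simp
  ultimately have "\<bar>dev i / (g + 1)\<bar> \<le> 2 * \<epsilon> + \<eta>"
    using shrunk_noise[OF i] abs_triangle_ineq4[of "post_mean i - b0 i" "g / (g + 1) * h i"] by (metis add_mono order_trans)
  then show ?thesis using g by (simp add: abs_divide)
qed

lemma Pr_ge:
  assumes e: "\<epsilon> > 0"
  shows "1 - Pr \<epsilon> \<le> box_bound lmin a n p g post_scale \<epsilon>"
proof -
  interpret P: prob_space post by (rule prob_space_post)
  let ?U = "{z \<in> space (param_measure p). \<exists>i<p. \<epsilon> < \<bar>fst z i - b0 i\<bar>}"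
  have "1 - Pr \<epsilon> = measure post (space post - ?U)" unfolding Pr_def by (rule P.prob_compl[OF measurable_event1, symmetric])
  also have "space post - ?U = {z \<in> space (param_measure p). \<forall>i<p. \<bar>fst z i - b0 i\<bar> \<le> \<epsilon>}" by (auto simp: not_less)
  also have "measure post \<dots> \<le> box_bound lmin a n p g post_scale \<epsilon>"
    unfolding box_bound_def by (rule post_box[OF e])
  finally show ?thesis .
qed

end

text \<open>This is \<tau> log p, the scale of the largest squared deviation among \<open>p\<close>
  Gaussian coordinates.\<close>

definition spread :: "nat \<Rightarrow> nat \<Rightarrow> real \<Rightarrow> real \<Rightarrow> real" where
  "spread n p g B = g * B * ln (real p) / ((g + 1) * (real n)\<^sup>2)"

text \<open>The asymptotics along one sample path: \<open>D2\<close> and \<open>Di\<close> stand for the squared \<open>\<ell>\<^sub>2\<close>-norm and the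
  \<open>\<ell>\<^sub>\<infinity>\<close>-norm of \<open>\<gamma> - \<beta>\<^sub>0\<close>, \<open>E\<close> for the squared length of the noise vector, and \<open>Pr n \<epsilon>\<close> for the posterior
  probability of the complement of the \<open>\<epsilon>\<close>-box around \<open>\<beta>\<^sub>0\<close>.\<close>

locale regime =
  fixes p :: "nat \<Rightarrow> nat" and g B D2 Di E :: "nat \<Rightarrow> real" and a b lmin lmax :: real and Pr :: "nat \<Rightarrow> real \<Rightarrow> real" and N :: nat
  assumes N4: "N \<ge> 4" and a: "a \<ge> -2" and b: "b \<ge> 0" and lmin: "lmin > 0" and lmax: "lmax > 0"
    and p2: "\<And>n. n \<ge> N \<Longrightarrow> p n \<ge> 2" and pn: "\<And>n. n \<ge> N \<Longrightarrow> p n < n"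
    and g: "\<And>n. n \<ge> N \<Longrightarrow> g n > 0" and B: "\<And>n. n \<ge> N \<Longrightarrow> B n > 0"
    and D2: "\<And>n. n \<ge> N \<Longrightarrow> D2 n \<ge> 0" and Di: "\<And>n. n \<ge> N \<Longrightarrow> Di n \<ge> 0"
    and E: "\<And>n. n \<ge> N \<Longrightarrow> 0 \<le> E n \<and> E n \<le> n * sqrt n"
    and B_le: "\<And>n. n \<ge> N \<Longrightarrow> B n \<le> b + E n + (2 * E n + 2 * (n / lmin) * D2 n) / (g n + 1)"
    and D2_le: "\<And>n. n \<ge> N \<Longrightarrow> n / lmax * D2 n \<le> 2 * E n + 2 * (g n + 1) * B n"
    and Pr_le: "\<And>n \<epsilon>. n \<ge> N \<Longrightarrow> \<epsilon> > 0 \<Longrightarrow> Di n / (g n + 1) + 1 / sqrt (sqrt n) \<le> \<epsilon> / 2 \<Longrightarrow> Pr n \<epsilon> \<le> conc_bound lmax a n (p n) (g n) (B n) (\<epsilon> / 2)"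
    and Di_le: "\<And>n \<epsilon>. n \<ge> N \<Longrightarrow> \<epsilon> > 0 \<Longrightarrow> Pr n \<epsilon> + conc_bound lmax a n (p n) (g n) (B n) \<epsilon> < 1 \<Longrightarrow> Di n / (g n + 1) \<le> 2 * \<epsilon> + 1 / sqrt (sqrt n)"
    and Pr_ge: "\<And>n \<epsilon>. n \<ge> N \<Longrightarrow> \<epsilon> > 0 \<Longrightarrow> 1 - Pr n \<epsilon> \<le> box_bound lmin a n (p n) (g n) (B n) \<epsilon>"
    and Pr_nonneg: "\<And>n \<epsilon>. Pr n \<epsilon> \<ge> 0"
begin

abbreviation "T n \<equiv> spread n (p n) (g n) (B n)"
abbreviation "Q n \<equiv> g n * ln (real (p n)) / ((g n + 1)\<^sup>2 * real n) * D2 n"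

lemma ln_p_bounds: "n \<ge> N \<Longrightarrow> 0 < ln (real (p n))" "n \<ge> N \<Longrightarrow> ln 2 \<le> ln (real (p n))" "n \<ge> N \<Longrightarrow> ln (real (p n)) \<le> ln (real n)"
  using p2[of n] pn[of n] by auto

lemma T_pos: "n \<ge> N \<Longrightarrow> T n > 0"
  unfolding spread_def using g[of n] B[of n] ln_p_bounds[of n] N4 by (intro divide_pos_pos mult_pos_pos) auto

lemma exp_lim: "(\<lambda>n. exp (- (real n + a) / 20)) \<longlonglongrightarrow> 0"
  by real_asymp

text \<open>The left-hand side is the factor common to the exponents of \<open>conc_bound\<close>
  and \<open>box_bound\<close>; as \<open>(n + a) / n\<close> tends to 1, both are governed by
  \<open>ln p / T\<close>.\<close>

lemma exponent_eq: "n \<ge> N \<Longrightarrow> n * (g n + 1) * (n + a) / (g n * B n) = (n + a) / n * (ln (p n) / T n)"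
  unfolding spread_def using g[of n] B[of n] ln_p_bounds[of n] N4 by (simp add: field_simps power2_eq_square)

lemma conc_lim:
  assumes T: "T \<longlonglongrightarrow> 0" and e: "\<epsilon> > 0"
  shows "(\<lambda>n. conc_bound lmax a n (p n) (g n) (B n) \<epsilon>) \<longlonglongrightarrow> 0"
proof -
  \<comment> \<open>The denominator 8 is the 4 of \<open>conc_bound\<close> times 2, from
    \<open>(n + a) / n \<ge> 1 / 2\<close>.\<close>
  define c where "c = \<epsilon>\<^sup>2 / (8 * lmax)"
  have c: "c > 0" using e lmax by (simp add: c_def)
  have Tp: "\<forall>\<^sub>F n in sequentially. T n > 0" using eventually_ge_at_top[of N] by eventually_elim (rule T_pos)
  have cT: "filterlim (\<lambda>n. c / T n) at_top sequentially"
    using filterlim_tendsto_pos_mult_at_top[OF tendsto_const c filterlim_inverse_at_top[OF T Tp]]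
    by (simp add: divide_inverse)
  have "(\<lambda>n. exp (ln 2 * (1 - c / T n))) \<longlonglongrightarrow> 0"
  proof (rule filterlim_compose[OF _ cT])
    show "((\<lambda>y. exp (ln 2 * (1 - y))) \<longlongrightarrow> (0::real)) at_top" by real_asymp
  qed
  from tendsto_add[OF tendsto_mult_right_zero[OF this, of 2] exp_lim]
  have lim: "(\<lambda>n. 2 * exp (ln 2 * (1 - c / T n)) + exp (- (real n + a) / 20)) \<longlonglongrightarrow> 0" by simp
  have "\<forall>\<^sub>F n in sequentially. c / T n \<ge> 1" using cT by (auto simp: filterlim_at_top)
  then have "\<forall>\<^sub>F n in sequentially. conc_bound lmax a n (p n) (g n) (B n) \<epsilon> \<le> 2 * exp (ln 2 * (1 - c / T n)) + exp (- (real n + a) / 20)"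
    using eventually_ge_at_top[of N]
  proof eventually_elim
    case (elim n)
    have n: "n \<ge> 4" using elim N4 by simp
    have half: "1 / 2 \<le> (n + a) / n" using n a by (simp add: field_simps)
    have "c / T n * ln (p n) = \<epsilon>\<^sup>2 / (4 * lmax) * (1 / 2 * (ln (p n) / T n))" by (simp add: c_def)
    also have "\<dots> \<le> \<epsilon>\<^sup>2 / (4 * lmax) * ((n + a) / n * (ln (p n) / T n))"
      using half ln_p_bounds(1)[OF elim(2)] T_pos[OF elim(2)] lmax by (intro mult_left_mono mult_right_mono) auto
    also have "\<dots> = \<epsilon>\<^sup>2 * n * (g n + 1) * (n + a) / (4 * lmax * g n * B n)"
      unfolding exponent_eq[OF elim(2), symmetric] by simp
    finally have ex: "c / T n * ln (p n) \<le> \<epsilon>\<^sup>2 * n * (g n + 1) * (n + a) / (4 * lmax * g n * B n)" .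
    have "p n * exp (- (\<epsilon>\<^sup>2 * n * (g n + 1) * (n + a) / (4 * lmax * g n * B n))) \<le> p n * exp (- (c / T n * ln (p n)))"
      using ex by (intro mult_left_mono) auto
    also have "\<dots> = exp (ln (p n)) * exp (- (c / T n * ln (p n)))" using p2[OF elim(2)] by simp
    also have "\<dots> = exp (ln (p n) * (1 - c / T n))" unfolding exp_add[symmetric] by (simp add: algebra_simps)
    \<comment> \<open>The factor \<open>1 - c / T n\<close> is at most 0, so replacing
      \<open>ln p\<close> by its lower bound \<open>ln 2\<close> increases the exponent; this is
      where \<open>p \<ge> 2\<close> enters.\<close>
    also have "\<dots> \<le> exp (ln 2 * (1 - c / T n))"
      using mult_right_mono_neg[OF ln_p_bounds(2)[OF elim(2)], of "1 - c / T n"] elim(1) by simp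
    finally show ?case unfolding conc_bound_def by simp
  qed
  moreover have "\<forall>\<^sub>F n in sequentially. 0 \<le> conc_bound lmax a n (p n) (g n) (B n) \<epsilon>"
    by (intro always_eventually) (auto simp: conc_bound_def)
  ultimately show ?thesis by (intro tendsto_sandwich[OF _ _ tendsto_const lim])
qed

text \<open>If \<open>T n \<ge> r\<close>, then for small \<epsilon> the exponent in
  \<open>box_bound\<close> is at most \<open>ln p\<close>. The \<open>p\<close> factors then remove
  a fixed fraction \<open>1 - exp (- c1)\<close> of the mass of the \<epsilon>-box, up to a
  vanishing term, contradicting consistency.\<close>

lemma T_lim:
  assumes P: "\<And>k::nat. (\<lambda>n. Pr n (1 / real (Suc k))) \<longlonglongrightarrow> 0"
  shows "T \<longlonglongrightarrow> 0"
proof (rule order_tendstoI)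
  fix r :: real assume "r < 0"
  show "\<forall>\<^sub>F n in sequentially. r < T n"
    using eventually_ge_at_top[of N] by eventually_elim (use T_pos \<open>r < 0\<close> in \<open>force intro: less_trans\<close>)
next
  fix r :: real assume r: "0 < r"
  define c1 where "c1 = exp (- 1) / sqrt (2 * pi)"
  have c1: "c1 > 0" by (simp add: c1_def)
  \<comment> \<open>The bound 1 gives \<open>\<epsilon>\<^sup>2 \<le> \<epsilon>\<close>, hence
    \<open>8 * \<epsilon>\<^sup>2 \<le> r * lmin\<close>; the 8 is the 4 of \<open>box_bound\<close>
    times 2, from \<open>(n + a) / n \<le> 2\<close>.\<close>
  obtain k :: nat where k: "1 / real (Suc k) < min 1 (r * lmin / 8)"
    using nat_approx_posE[of "min 1 (r * lmin / 8)"] r lmin by auto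
  define \<epsilon> where "\<epsilon> = 1 / real (Suc k)"
  have e: "\<epsilon> > 0" "\<epsilon> \<le> 1" "\<epsilon> \<le> r * lmin / 8" using k by (auto simp: \<epsilon>_def)
  have "\<epsilon> * \<epsilon> \<le> 1 * (r * lmin / 8)" using e r lmin by (intro mult_mono) auto
  then have e2: "8 * \<epsilon>\<^sup>2 \<le> r * lmin" by (simp add: power2_eq_square)
  have "(\<lambda>n. Pr n \<epsilon> + exp (- (real n + a) / 20)) \<longlonglongrightarrow> 0"
    using tendsto_add[OF P[of k] exp_lim] by (simp add: \<epsilon>_def)
  then have "\<forall>\<^sub>F n in sequentially. Pr n \<epsilon> + exp (- (real n + a) / 20) < 1 - exp (- c1)"
    by (rule order_tendstoD) (use c1 in simp)
  then show "\<forall>\<^sub>F n in sequentially. T n < r"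
    \<comment> \<open>Taking \<open>n \<ge> a\<close> ensures
      \<open>(n + a) / n \<le> 2\<close>.\<close>
    using eventually_ge_at_top[of "max N (nat \<lceil>a\<rceil>)"]
  proof eventually_elim
    case (elim n)
    have n: "n \<ge> N" "real n \<ge> a" using elim(2) by (auto simp: nat_le_iff ceiling_le_iff)
    have n4: "n \<ge> 4" using n N4 by simp
    show ?case
    proof (rule ccontr)
      assume "\<not> T n < r"
      then have Tr: "r \<le> T n" by simp
      have "4 * \<epsilon>\<^sup>2 * n * (g n + 1) * (n + a) / (lmin * g n * B n) = 4 * \<epsilon>\<^sup>2 / lmin * ((n + a) / n * (ln (p n) / T n))"
        unfolding exponent_eq[OF n(1), symmetric] by simp
      also have "\<dots> \<le> 4 * \<epsilon>\<^sup>2 / lmin * (2 * (ln (p n) / r))"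
      proof (intro mult_left_mono mult_mono)
        show "(n + a) / n \<le> 2" using n n4 by (simp add: field_simps)
        show "ln (p n) / T n \<le> ln (p n) / r" using Tr r ln_p_bounds(1)[OF n(1)] by (intro divide_left_mono) auto
        show "0 \<le> ln (p n) / T n" using ln_p_bounds(1)[OF n(1)] T_pos[OF n(1)] by simp
      qed (use lmin in auto)
      also have "\<dots> = 8 * \<epsilon>\<^sup>2 / (r * lmin) * ln (p n)" by (simp add: mult.commute)
      also have "\<dots> \<le> 1 * ln (p n)"
        using e2 r lmin ln_p_bounds(1)[OF n(1)] by (intro mult_right_mono) (auto simp: divide_le_eq)
      finally have x: "4 * \<epsilon>\<^sup>2 * n * (g n + 1) * (n + a) / (lmin * g n * B n) \<le> ln (p n)" by simp
      have "c1 = p n * (exp (- 1 - ln (p n)) / sqrt (2 * pi))"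
        using p2[OF n(1)] by (simp add: c1_def exp_diff)
      also have "\<dots> \<le> p n * (exp (- 1 - 4 * \<epsilon>\<^sup>2 * n * (g n + 1) * (n + a) / (lmin * g n * B n)) / sqrt (2 * pi))"
        using x by (intro mult_left_mono divide_right_mono) auto
      finally have "box_bound lmin a n (p n) (g n) (B n) \<epsilon> \<le> exp (- c1) + exp (- (n + a) / 20)"
        unfolding box_bound_def by simp
      with Pr_ge[OF n(1) e(1)] elim(1) show False by simp
    qed
  qed
qed

text \<open>The noise contribution to \<open>T\<close>, with \<open>E n\<close> replaced by its
  bound n sqrt n. The 3 counts one \<open>E n\<close> and the two further ones divided by
  \<open>g n + 1\<close> in \<open>B_le\<close>.\<close>

lemma noise_lim: "(\<lambda>n. ln (real n) / (real n)\<^sup>2 * (b + 3 * (real n * sqrt (real n)))) \<longlonglongrightarrow> 0"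
  by real_asymp

lemma eta_lim: "(\<lambda>n. 1 / sqrt (sqrt (real n))) \<longlonglongrightarrow> 0"
  by real_asymp

lemma shrinkage_le_1:
  assumes "n \<ge> N"
  shows "0 \<le> g n / (g n + 1)" "g n / (g n + 1) \<le> 1" "g n / (g n + 1)\<^sup>2 \<le> 1"
proof -
  show 1: "0 \<le> g n / (g n + 1)" "g n / (g n + 1) \<le> 1" using g[OF assms] by auto
  have "g n / (g n + 1)\<^sup>2 = g n / (g n + 1) * (1 / (g n + 1))" by (simp add: power2_eq_square)
  also have "\<dots> \<le> 1 * 1" using g[OF assms] 1 by (intro mult_mono) auto
  finally show "g n / (g n + 1)\<^sup>2 \<le> 1" by simp
qed

lemma log_term_le:
  assumes n: "n \<ge> N" and x: "0 \<le> x" "x \<le> b + 3 * (real n * sqrt (real n))"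
  shows "ln (p n) / (real n)\<^sup>2 * x \<le> ln (real n) / (real n)\<^sup>2 * (b + 3 * (real n * sqrt (real n)))"
proof -
  have "0 \<le> ln (real n)" using ln_p_bounds(1,3)[OF n] by linarith
  then show ?thesis using ln_p_bounds[OF n] x by (intro mult_mono divide_right_mono divide_nonneg_nonneg) auto
qed

text \<open>Insert \<open>B_le\<close> into \<open>T\<close>: the factors \<open>g / (g + 1)\<close>
  and \<open>g / (g + 1)\<^sup>2\<close> of the noise terms are at most 1, and the term with
  \<open>D2\<close> is exactly a multiple of \<open>Q\<close>.\<close>

lemma T_le_Q:
  assumes n: "n \<ge> N"
  shows "T n \<le> ln (real n) / (real n)\<^sup>2 * (b + 3 * (real n * sqrt (real n))) + 2 / lmin * Q n"
proof -
  define l where "l = ln (p n) / (real n)\<^sup>2"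
  define u where "u = 1 / (g n + 1)"
  have l: "l \<ge> 0" using ln_p_bounds(1)[OF n] by (simp add: l_def)
  have n0: "real n > 0" using n N4 by simp
  have f: "0 \<le> g n * u" "g n * u \<le> 1" "g n * u\<^sup>2 \<le> 1"
    using shrinkage_le_1[OF n] by (simp_all add: u_def power_divide)
  have En: "0 \<le> E n" "E n \<le> n * sqrt n" using E[OF n] by auto
  have Qe: "Q n = g n * u\<^sup>2 * (l * n) * D2 n" using n0 by (simp add: l_def u_def power_divide power2_eq_square)
  have "T n = g n * u * l * B n" unfolding spread_def l_def u_def by simp
  also have "\<dots> \<le> g n * u * l * (b + E n + (2 * E n + 2 * (n / lmin) * D2 n) / (g n + 1))"
    using f(1) l by (intro mult_left_mono B_le[OF n] mult_nonneg_nonneg[of "g n * u"])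
  also have "\<dots> = g n * u * l * (b + E n + (2 * E n + 2 * (n * (1 / lmin)) * D2 n) * u)" by (simp add: u_def)
  also have "\<dots> = g n * u * (l * (b + E n)) + g n * u\<^sup>2 * (l * (2 * E n)) + 2 * (1 / lmin) * Q n"
    unfolding Qe by (simp only: power2_eq_square ring_distribs mult_ac add_ac)
  also have "\<dots> \<le> l * (b + 3 * E n) + 2 / lmin * Q n"
  proof -
    have "g n * u * (l * (b + E n)) \<le> 1 * (l * (b + E n))"
      using f(2) l b En by (intro mult_right_mono) auto
    moreover have "g n * u\<^sup>2 * (l * (2 * E n)) \<le> 1 * (l * (2 * E n))"
      using f(3) l En by (intro mult_right_mono) auto
    ultimately show ?thesis by (simp add: algebra_simps)
  qed
  also have "l * (b + 3 * E n) \<le> ln (real n) / (real n)\<^sup>2 * (b + 3 * (real n * sqrt (real n)))"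
    unfolding l_def by (rule log_term_le[OF n]) (use En b in auto)
  finally show ?thesis by simp
qed

text \<open>Insert \<open>D2_le\<close> into \<open>Q\<close>: its factor \<open>g n + 1\<close>
  turns \<open>g / (g + 1)\<^sup>2\<close> into the \<open>g / (g + 1)\<close> of
  \<open>T\<close>.\<close>

lemma Q_le_T:
  assumes n: "n \<ge> N"
  shows "Q n \<le> 2 * lmax * (ln (real n) / (real n)\<^sup>2 * (b + 3 * (real n * sqrt (real n))) + T n)"
proof -
  define l where "l = ln (p n) / (real n)\<^sup>2"
  define u where "u = g n / (g n + 1)\<^sup>2"
  have l: "l \<ge> 0" using ln_p_bounds(1)[OF n] by (simp add: l_def)
  have n0: "real n > 0" using n N4 by simp
  have g1: "g n + 1 > 0" using g[OF n] by simp
  have u: "u \<ge> 0" "u \<le> 1" using g[OF n] shrinkage_le_1(3)[OF n] by (auto simp: u_def)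
  have En: "0 \<le> E n" "E n \<le> n * sqrt n" using E[OF n] by auto
  have ug: "u * (g n + 1) = g n / (g n + 1)" using g1 by (simp add: u_def power2_eq_square)
  have Te: "T n = u * (g n + 1) * l * B n" unfolding ug by (simp add: spread_def l_def)
  have "Q n = lmax * (u * l * (n / lmax * D2 n))"
    using n0 lmax by (simp add: u_def l_def power2_eq_square)
  also have "\<dots> \<le> lmax * (u * l * (2 * E n + 2 * (g n + 1) * B n))"
    using u l lmax by (intro mult_left_mono D2_le[OF n] mult_nonneg_nonneg) auto
  also have "\<dots> = 2 * lmax * (u * (l * E n) + T n)"
    unfolding Te by (simp add: algebra_simps)
  also have "\<dots> \<le> 2 * lmax * (ln (real n) / (real n)\<^sup>2 * (b + 3 * (real n * sqrt (real n))) + T n)"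
  proof (rule mult_left_mono)
    have "u * (l * E n) \<le> 1 * (l * E n)" using u l En by (intro mult_right_mono) auto
    moreover have "l * E n \<le> ln (real n) / (real n)\<^sup>2 * (b + 3 * (real n * sqrt (real n)))"
      unfolding l_def by (rule log_term_le[OF n]) (use En b in auto)
    ultimately show "u * (l * E n) + T n \<le> ln (real n) / (real n)\<^sup>2 * (b + 3 * (real n * sqrt (real n))) + T n"
      by linarith
  qed (use lmax in auto)
  finally show ?thesis .
qed

lemma Q_nonneg: "n \<ge> N \<Longrightarrow> Q n \<ge> 0"
  using g[of n] ln_p_bounds(1)[of n] D2[of n] by auto

text \<open>The order matters: \<open>T_lim\<close> knows nothing about the posterior mean, and only
  after \<open>T\<close> vanishes is the concentration bound small enough for \<open>Di_le\<close>
  to locate it.\<close>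

lemma consistent_imp:
  assumes P: "\<And>k::nat. (\<lambda>n. Pr n (1 / real (Suc k))) \<longlonglongrightarrow> 0"
  shows "(\<lambda>n. Di n / (g n + 1)) \<longlonglongrightarrow> 0" "Q \<longlonglongrightarrow> 0"
proof -
  have T: "T \<longlonglongrightarrow> 0" by (rule T_lim[OF P])
  have "(\<lambda>n. 2 * lmax * (ln (real n) / (real n)\<^sup>2 * (b + 3 * (real n * sqrt (real n))) + T n)) \<longlonglongrightarrow> 2 * lmax * (0 + 0)"
    by (intro tendsto_mult tendsto_const tendsto_add noise_lim T)
  then have lim: "(\<lambda>n. 2 * lmax * (ln (real n) / (real n)\<^sup>2 * (b + 3 * (real n * sqrt (real n))) + T n)) \<longlonglongrightarrow> 0" by simp
  show "Q \<longlonglongrightarrow> 0"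
  proof (rule tendsto_sandwich[OF _ _ tendsto_const lim])
    show "\<forall>\<^sub>F n in sequentially. 0 \<le> Q n"
      using eventually_ge_at_top[of N] by eventually_elim (rule Q_nonneg)
    show "\<forall>\<^sub>F n in sequentially. Q n \<le> 2 * lmax * (ln (real n) / (real n)\<^sup>2 * (b + 3 * (real n * sqrt (real n))) + T n)"
      using eventually_ge_at_top[of N] by eventually_elim (rule Q_le_T)
  qed
  show "(\<lambda>n. Di n / (g n + 1)) \<longlonglongrightarrow> 0"
  proof (rule order_tendstoI)
    fix r :: real assume "r < 0"
    show "\<forall>\<^sub>F n in sequentially. r < Di n / (g n + 1)"
      using eventually_ge_at_top[of N]
    proof eventually_elim
      case (elim n)
      then have "0 \<le> Di n / (g n + 1)" using Di[of n] g[of n] by simp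
      with \<open>r < 0\<close> show ?case by linarith
    qed
  next
    fix r :: real assume r: "0 < r"
    \<comment> \<open>\<open>Di_le\<close> gives \<open>2 * \<epsilon>\<close> plus the noise bound;
      with \<epsilon> below \<open>r / 4\<close> each part is below \<open>r / 2\<close>.\<close>
    obtain k :: nat where k: "1 / real (Suc k) < r / 4" using nat_approx_posE[of "r / 4"] r by auto
    have e: "0 < 1 / real (Suc k)" by simp
    have "(\<lambda>n. Pr n (1 / real (Suc k)) + conc_bound lmax a n (p n) (g n) (B n) (1 / real (Suc k))) \<longlonglongrightarrow> 0"
      using tendsto_add[OF P[of k] conc_lim[OF T e]] by simp
    then have "\<forall>\<^sub>F n in sequentially. Pr n (1 / real (Suc k)) + conc_bound lmax a n (p n) (g n) (B n) (1 / real (Suc k)) < 1"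
      by (rule order_tendstoD) simp
    moreover have "\<forall>\<^sub>F n in sequentially. 1 / sqrt (sqrt (real n)) < r / 2"
      using eta_lim by (rule order_tendstoD) (use r in simp)
    ultimately show "\<forall>\<^sub>F n in sequentially. Di n / (g n + 1) < r"
      using eventually_ge_at_top[of N]
    proof eventually_elim
      case (elim n)
      from Di_le[OF elim(3) e elim(1)] elim(2) k show ?case by linarith
    qed
  qed
qed

lemma consistent_if:
  assumes D: "(\<lambda>n. Di n / (g n + 1)) \<longlonglongrightarrow> 0" and Q: "Q \<longlonglongrightarrow> 0" and e: "\<epsilon> > 0"
  shows "(\<lambda>n. Pr n \<epsilon>) \<longlonglongrightarrow> 0"
proof -
  have "(\<lambda>n. ln (real n) / (real n)\<^sup>2 * (b + 3 * (real n * sqrt (real n))) + 2 / lmin * Q n) \<longlonglongrightarrow> 0 + 2 / lmin * 0"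
    by (intro tendsto_mult tendsto_const tendsto_add noise_lim Q)
  then have lim: "(\<lambda>n. ln (real n) / (real n)\<^sup>2 * (b + 3 * (real n * sqrt (real n))) + 2 / lmin * Q n) \<longlonglongrightarrow> 0" by simp
  have T: "T \<longlonglongrightarrow> 0"
  proof (rule tendsto_sandwich[OF _ _ tendsto_const lim])
    show "\<forall>\<^sub>F n in sequentially. 0 \<le> T n"
      using eventually_ge_at_top[of N] by eventually_elim (rule less_imp_le[OF T_pos])
    show "\<forall>\<^sub>F n in sequentially. T n \<le> ln (real n) / (real n)\<^sup>2 * (b + 3 * (real n * sqrt (real n))) + 2 / lmin * Q n"
      using eventually_ge_at_top[of N] by eventually_elim (rule T_le_Q)
  qed
  have e2: "\<epsilon> / 2 > 0" using e by simp
  have "(\<lambda>n. Di n / (g n + 1) + 1 / sqrt (sqrt (real n))) \<longlonglongrightarrow> 0"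
    using tendsto_add[OF D eta_lim] by simp
  then have "\<forall>\<^sub>F n in sequentially. Di n / (g n + 1) + 1 / sqrt (sqrt (real n)) < \<epsilon> / 2"
    by (rule order_tendstoD) (rule e2)
  then have "\<forall>\<^sub>F n in sequentially. Pr n \<epsilon> \<le> conc_bound lmax a n (p n) (g n) (B n) (\<epsilon> / 2)"
    using eventually_ge_at_top[of N] by eventually_elim (use Pr_le e in auto)
  moreover have "\<forall>\<^sub>F n in sequentially. 0 \<le> Pr n \<epsilon>" by (intro always_eventually allI Pr_nonneg)
  ultimately show ?thesis by (intro tendsto_sandwich[OF _ _ tendsto_const conc_lim[OF T e2]])
qed

end

section \<open>The theorem\<close>

lemma l2_norm_sq: "(l2_norm x)\<^sup>2 = (\<Sum>i<dim_vec x. (vec_index x i)\<^sup>2)"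
  by (simp add: l2_norm_def sum_nonneg)

lemma linf_norm_bound: "i < dim_vec x \<Longrightarrow> \<bar>vec_index x i\<bar> \<le> linf_norm x"
  unfolding linf_norm_def by (intro Max_ge) auto

lemma linf_norm_nonneg: "linf_norm x \<ge> 0"
  unfolding linf_norm_def by (intro Max_ge) auto

context noisy_design
begin

lemma g_prior_truth_good:
  assumes w: "\<omega> \<in> space M" and good: "\<omega> \<notin> large_noise" and beta: "\<beta> \<in> carrier_vec p" and n4: "n \<ge> 4"
    and S0: "rss X (X *\<^sub>v \<beta> + Matrix.vec n (e \<omega>)) \<noteq> 0" and g: "g > 0" and a: "a \<ge> -2" and b: "b \<ge> 0"
  shows "g_prior_truth X n p lmin lmax (\<lambda>i. vec_index \<beta> i + vec_index (ols_noise (e \<omega>)) i) g a b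
    (rss X (X *\<^sub>v \<beta> + Matrix.vec n (e \<omega>))) (vec_index \<beta>) (vec_index (ols_noise (e \<omega>))) (\<Sum>k<n. (e \<omega> k)\<^sup>2) (1 / sqrt (sqrt n))"
    and "(\<Sum>k<n. (e \<omega> k)\<^sup>2) \<le> n * sqrt n"
proof -
  let ?S = "rss X (X *\<^sub>v \<beta> + Matrix.vec n (e \<omega>))"
  let ?h = "vec_index (ols_noise (e \<omega>))"
  have S: "?S > 0" using S0 by (simp add: rss_def)
  have q: "bil p A ?h ?h \<ge> 0"
    using bil_lower[of ?h] lmax_pos by (smt (verit) divide_nonneg_pos mult_nonneg_nonneg of_nat_0_le_iff sum_nonneg zero_le_power2)
  note py = rss_pythagoras[OF beta, of "e \<omega>"]
  show "g_prior_truth X n p lmin lmax (\<lambda>i. vec_index \<beta> i + ?h i) g a b ?S (vec_index \<beta>) ?h (\<Sum>k<n. (e \<omega> k)\<^sup>2) (1 / sqrt (sqrt n))"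
  proof unfold_locales
    show "\<bar>?h i\<bar> \<le> 1 / sqrt (sqrt n)" if "i < p" for i
      using good w that by (force simp: large_noise_def not_le)
  qed (use S q py g a b n4 in auto)
  have "(\<Sum>k<n. (e \<omega> k)\<^sup>2) \<le> (\<Sum>k<n. sqrt n)"
  proof (rule sum_mono)
    fix k assume "k \<in> {..<n}"
    then have "\<bar>e \<omega> k\<bar> \<le> sqrt (sqrt n)" using good w by (force simp: large_noise_def not_le)
    then have "\<bar>e \<omega> k\<bar>\<^sup>2 \<le> (sqrt (sqrt n))\<^sup>2" by (intro power_mono) auto
    then show "(e \<omega> k)\<^sup>2 \<le> sqrt n" by simp
  qed
  then show "(\<Sum>k<n. (e \<omega> k)\<^sup>2) \<le> n * sqrt n" by simp
qed

end

theorem theorem1: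
  fixes p :: "nat \<Rightarrow> nat" and \<alpha> :: real
    and X :: "nat \<Rightarrow> real Matrix.mat"
    and lmin lmax :: real
    and \<gamma> \<beta>\<^sub>0 :: "nat \<Rightarrow> real Matrix.vec"
    and g :: "nat \<Rightarrow> real" and a b :: real
    and \<sigma>0sq :: real
    and M :: "'w measure"
    and e :: "nat \<Rightarrow> 'w \<Rightarrow> nat \<Rightarrow> real"
    and Y :: "nat \<Rightarrow> 'w \<Rightarrow> real Matrix.vec"
  assumes p_less: "\<And>n. n \<ge> 1 \<Longrightarrow> p n < n"
    and p_mono: "\<And>m n. 1 \<le> m \<Longrightarrow> m \<le> n \<Longrightarrow> p m \<le> p n"
    and p_lim: "(\<lambda>n. real (p n) / real n) \<longlonglongrightarrow> \<alpha>"
    and alpha: "0 \<le> \<alpha>" "\<alpha> < 1"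
    and p_ne_1: "\<forall>\<^sub>F n in sequentially. p n \<noteq> 1"
    and X_dim: "\<And>n. n \<ge> 1 \<Longrightarrow> X n \<in> carrier_mat n (p n)"
    and X_rank: "\<And>n. n \<ge> 1 \<Longrightarrow> vec_space.rank n (X n) = p n"
    and lmin_pos: "0 < lmin"
    and eig: "\<And>n l. n \<ge> 1 \<Longrightarrow> eigenvalue (real n \<cdot>\<^sub>m gram_inv (X n)) l \<Longrightarrow> lmin \<le> l \<and> l \<le> lmax"
    and gamma_dim: "\<And>n. n \<ge> 1 \<Longrightarrow> \<gamma> n \<in> carrier_vec (p n)"
    and g_pos: "\<And>n. n \<ge> 1 \<Longrightarrow> g n > 0"
    and a: "a \<ge> -2" and b: "b \<ge> 0"
    and beta0_dim: "\<And>n. n \<ge> 1 \<Longrightarrow> \<beta>\<^sub>0 n \<in> carrier_vec (p n)"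
    and sigma0: "\<sigma>0sq > 0"
    and M: "prob_space M"
    and e_law: "\<And>n. n \<ge> 1 \<Longrightarrow>
        distributed M (\<Pi>\<^sub>M i\<in>{..<n}. lborel) (e n)
          (\<lambda>x. ennreal (mvn_density (0\<^sub>v n) (\<sigma>0sq \<cdot>\<^sub>m 1\<^sub>m n) (Matrix.vec n x)))"
    and Y: "\<And>n \<omega>. n \<ge> 1 \<Longrightarrow> Y n \<omega> = X n *\<^sub>v \<beta>\<^sub>0 n + Matrix.vec n (e n \<omega>)"
  shows "(\<forall>\<epsilon>>0. AE \<omega> in M.
            (\<lambda>n. posterior_linf_prob (X n) (\<gamma> n) (g n) a b
                   (ols (X n) (Y n \<omega>)) (rss (X n) (Y n \<omega>)) (\<beta>\<^sub>0 n) \<epsilon>) \<longlonglongrightarrow> 0)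
     \<longleftrightarrow>
         ((\<lambda>n. linf_norm (\<gamma> n - \<beta>\<^sub>0 n) / (g n + 1)) \<longlonglongrightarrow> 0
        \<and> (\<lambda>n. g n * ln (real (p n)) / ((g n + 1)\<^sup>2 * real n) * (l2_norm (\<gamma> n - \<beta>\<^sub>0 n))\<^sup>2)
             \<longlonglongrightarrow> 0)"
proof (cases "\<forall>n\<ge>1. p n = 0")
  \<comment> \<open>In dimension 0 all norms and the posterior probability of a deviation are 0, so
    both sides hold.\<close>
  case True
  have 1: "linf_norm (\<gamma> n - \<beta>\<^sub>0 n) = 0" if "n \<ge> 1" for n
    using True that beta0_dim[OF that] by (auto simp: linf_norm_def)
  have 2: "l2_norm (\<gamma> n - \<beta>\<^sub>0 n) = 0" if "n \<ge> 1" for n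
    using True that beta0_dim[OF that] by (auto simp: l2_norm_def)
  have 3: "posterior_linf_prob (X n) (\<gamma> n) (g n) a b bh S (\<beta>\<^sub>0 n) \<epsilon> = 0" if "n \<ge> 1" "\<epsilon> > 0" for n bh S \<epsilon>
  proof -
    have "\<not> linf_norm (Matrix.vec (dim_col (X n)) \<beta> - \<beta>\<^sub>0 n) > \<epsilon>" for \<beta>
      using True that beta0_dim[OF that(1)] by (subst linf_norm_gt_iff) auto
    then show ?thesis unfolding posterior_linf_prob_def by simp
  qed
  have "(\<lambda>n. posterior_linf_prob (X n) (\<gamma> n) (g n) a b (ols (X n) (Y n \<omega>)) (rss (X n) (Y n \<omega>)) (\<beta>\<^sub>0 n) \<epsilon>) \<longlonglongrightarrow> 0"
    if "\<epsilon> > 0" for \<epsilon> \<omega>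
    by (rule tendsto_eventually) (use 3[OF _ that] in \<open>auto intro: eventually_mono[OF eventually_ge_at_top[of 1]]\<close>)
  moreover have "(\<lambda>n. linf_norm (\<gamma> n - \<beta>\<^sub>0 n) / (g n + 1)) \<longlonglongrightarrow> 0"
    by (rule tendsto_eventually) (use 1 in \<open>auto intro: eventually_mono[OF eventually_ge_at_top[of 1]]\<close>)
  moreover have "(\<lambda>n. g n * ln (real (p n)) / ((g n + 1)\<^sup>2 * real n) * (l2_norm (\<gamma> n - \<beta>\<^sub>0 n))\<^sup>2) \<longlonglongrightarrow> 0"
    by (rule tendsto_eventually) (use 2 in \<open>auto intro: eventually_mono[OF eventually_ge_at_top[of 1]]\<close>)
  ultimately show ?thesis by simp
next
  case False
  \<comment> \<open>As \<open>p\<close> is nondecreasing, one positive value makes all later ones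
    positive; excluding 1 leaves \<open>p n \<ge> 2\<close>.\<close>
  then obtain m where m: "m \<ge> 1" "p m \<ge> 1" by (metis One_nat_def Suc_leI not_gr_zero)
  obtain N1 where N1: "\<And>n. n \<ge> N1 \<Longrightarrow> p n \<noteq> 1" using p_ne_1 unfolding eventually_sequentially by blast
  define N where "N = max 4 (max m N1)"
  have N4: "N \<ge> 4" by (simp add: N_def)
  have n1: "n \<ge> 1" if "n \<ge> N" for n using that N4 by simp
  have p2: "p n \<ge> 2" if "n \<ge> N" for n
  proof -
    have "p m \<le> p n" using that m by (intro p_mono) (auto simp: N_def)
    moreover have "p n \<noteq> 1" using that by (intro N1) (auto simp: N_def)
    ultimately show ?thesis using m by simp
  qed
  interpret prob_space M by (rule M)
  have des: "noisy_design (X n) n (p n) lmin lmax M (e n) \<sigma>0sq" if n: "n \<ge> N" for n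
  proof -
    have "design (X n) n (p n) lmin lmax"
      using X_dim[OF n1[OF n]] X_rank[OF n1[OF n]] p_less[OF n1[OF n]] p2[OF n] lmin_pos eig[OF n1[OF n]]
      by unfold_locales auto
    moreover have "noise M (e n) n \<sigma>0sq"
      using sigma0 e_law[OF n1[OF n]] by unfold_locales auto
    ultimately show ?thesis by (simp add: noisy_design_def)
  qed
  have lmax: "lmax > 0"
  proof -
    interpret D: noisy_design "X N" N "p N" lmin lmax M "e N" \<sigma>0sq by (rule des) simp
    show ?thesis by (rule D.lmax_pos)
  qed
  define bd where "bd n = noisy_design.large_noise (X n) n (p n) M (e n)" for n
  define \<kappa> where "\<kappa> = 1 / (2 * \<sigma>0sq * max 1 lmax)"
  have AE1: "AE \<omega> in M. \<forall>\<^sub>F n in sequentially. \<omega> \<notin> bd n"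
  proof (rule borel_cantelli_bound[OF M])
    show "\<kappa> > 0" using sigma0 by (simp add: \<kappa>_def)
    fix n assume n: "n \<ge> N"
    interpret D: noisy_design "X n" n "p n" lmin lmax M "e n" \<sigma>0sq by (rule des[OF n])
    show "bd n \<in> sets M" unfolding bd_def by (rule D.large_noise_sets)
    show "measure M (bd n) \<le> 4 * real n * exp (- \<kappa> * sqrt n)"
      using D.large_noise_small unfolding bd_def \<kappa>_def by simp
  qed
  \<comment> \<open>At \<open>S = 0\<close> the chi-square density is 0 and Bayes' formula
    degenerates; almost surely this never happens from \<open>N\<close> on.\<close>
  have AE2: "AE \<omega> in M. \<forall>n. n \<ge> N \<longrightarrow> rss (X n) (Y n \<omega>) \<noteq> 0"
  proof (subst AE_all_countable, intro allI)
    fix n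
    show "AE \<omega> in M. n \<ge> N \<longrightarrow> rss (X n) (Y n \<omega>) \<noteq> 0"
    proof (cases "n \<ge> N")
      case n: True
      interpret D: noisy_design "X n" n "p n" lmin lmax M "e n" \<sigma>0sq by (rule des[OF n])
      show ?thesis using D.rss_pos_AE[OF beta0_dim[OF n1[OF n]]] unfolding Y[OF n1[OF n]] by eventually_elim simp
    qed simp
  qed
  define Pr where "Pr \<omega> n \<epsilon> = posterior_linf_prob (X n) (\<gamma> n) (g n) a b (ols (X n) (Y n \<omega>)) (rss (X n) (Y n \<omega>)) (\<beta>\<^sub>0 n) \<epsilon>" for \<omega> n \<epsilon>
  let ?C1 = "(\<lambda>n. linf_norm (\<gamma> n - \<beta>\<^sub>0 n) / (g n + 1)) \<longlonglongrightarrow> 0"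
  let ?C2 = "(\<lambda>n. g n * ln (real (p n)) / ((g n + 1)\<^sup>2 * real n) * (l2_norm (\<gamma> n - \<beta>\<^sub>0 n))\<^sup>2) \<longlonglongrightarrow> 0"
  \<comment> \<open>From here the sample path is fixed and the argument is deterministic. The
    starting index may depend on the path.\<close>
  have reg: "\<exists>B E N'. regime p g B (\<lambda>n. (l2_norm (\<gamma> n - \<beta>\<^sub>0 n))\<^sup>2) (\<lambda>n. linf_norm (\<gamma> n - \<beta>\<^sub>0 n)) E a b lmin lmax (Pr \<omega>) N'"
    if w: "\<omega> \<in> space M" and ev: "\<forall>\<^sub>F n in sequentially. \<omega> \<notin> bd n" and S0: "\<forall>n. n \<ge> N \<longrightarrow> rss (X n) (Y n \<omega>) \<noteq> 0" for \<omega>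
  proof -
    obtain N2 where N2: "\<And>n. n \<ge> N2 \<Longrightarrow> \<omega> \<notin> bd n" using ev unfolding eventually_sequentially by blast
    define E where "E n = (\<Sum>k<n. (e n \<omega> k)\<^sup>2)" for n
    define h where "h n = vec_index (design.ols_noise (X n) n (e n \<omega>))" for n
    define B where "B n = g_prior.post_scale (X n) (p n) (vec_index (\<gamma> n)) (\<lambda>i. vec_index (\<beta>\<^sub>0 n) i + h n i) (g n) b (rss (X n) (Y n \<omega>))" for n
    have each: "B n > 0 \<and> 0 \<le> E n \<and> E n \<le> n * sqrt n
      \<and> B n \<le> b + E n + (2 * E n + 2 * (n / lmin) * (l2_norm (\<gamma> n - \<beta>\<^sub>0 n))\<^sup>2) / (g n + 1)
      \<and> n / lmax * (l2_norm (\<gamma> n - \<beta>\<^sub>0 n))\<^sup>2 \<le> 2 * E n + 2 * (g n + 1) * B n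
      \<and> (\<forall>\<epsilon>>0. linf_norm (\<gamma> n - \<beta>\<^sub>0 n) / (g n + 1) + 1 / sqrt (sqrt n) \<le> \<epsilon> / 2 \<longrightarrow> Pr \<omega> n \<epsilon> \<le> conc_bound lmax a n (p n) (g n) (B n) (\<epsilon> / 2))
      \<and> (\<forall>\<epsilon>>0. Pr \<omega> n \<epsilon> + conc_bound lmax a n (p n) (g n) (B n) \<epsilon> < 1 \<longrightarrow> linf_norm (\<gamma> n - \<beta>\<^sub>0 n) / (g n + 1) \<le> 2 * \<epsilon> + 1 / sqrt (sqrt n))
      \<and> (\<forall>\<epsilon>>0. 1 - Pr \<omega> n \<epsilon> \<le> box_bound lmin a n (p n) (g n) (B n) \<epsilon>)"
      if n: "n \<ge> max N N2" for n
    proof -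
      have nN: "n \<ge> N" and good: "\<omega> \<notin> bd n" using n N2 by auto
      have n4: "n \<ge> 4" using nN N4 by simp
      note n1' = n1[OF nN]
      note Yn = Y[OF n1']
      note bd = beta0_dim[OF n1'] and gd = gamma_dim[OF n1']
      interpret D: noisy_design "X n" n "p n" lmin lmax M "e n" \<sigma>0sq by (rule des[OF nN])
      have S0n: "rss (X n) (X n *\<^sub>v \<beta>\<^sub>0 n + Matrix.vec n (e n \<omega>)) \<noteq> 0" using S0[rule_format, OF nN] unfolding Yn .
      note good' = D.g_prior_truth_good[OF w good[unfolded bd_def] bd n4 S0n g_pos[OF n1'] a b, folded Yn h_def E_def]
      interpret T: g_prior_truth "X n" n "p n" lmin lmax "vec_index (\<gamma> n)" "\<lambda>i. vec_index (\<beta>\<^sub>0 n) i + h n i" "g n" a b "rss (X n) (Y n \<omega>)"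
        "vec_index (\<beta>\<^sub>0 n)" "h n" "E n" "1 / sqrt (sqrt n)"
        by (rule good'(1))
      have Bn: "B n = T.post_scale" unfolding B_def ..
      have gv: "Matrix.vec (p n) (vec_index (\<gamma> n)) = \<gamma> n" by (rule vec_eta[OF gd])
      have ov: "ols (X n) (Y n \<omega>) = Matrix.vec (p n) (\<lambda>i. vec_index (\<beta>\<^sub>0 n) i + h n i)"
        unfolding Yn D.ols_eq[OF bd] h_def using bd D.ols_noise_carrier[of "e n \<omega>"] by (intro eq_vecI) auto
      have Pn: "Pr \<omega> n \<epsilon> = T.Pr \<epsilon>" if "\<epsilon> > 0" for \<epsilon>
        using T.posterior_linf_prob_eq[OF that bd] unfolding Pr_def T.Pr_def ov gv .
      have D2n: "(l2_norm (\<gamma> n - \<beta>\<^sub>0 n))\<^sup>2 = T.D2"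
        unfolding l2_norm_sq T.D2_def T.dev_def using bd gd by (intro sum.cong) auto
      have dev: "\<bar>T.dev i\<bar> \<le> linf_norm (\<gamma> n - \<beta>\<^sub>0 n)" if "i < p n" for i
        using linf_norm_bound[of i "\<gamma> n - \<beta>\<^sub>0 n"] that bd gd by (simp add: T.dev_def)
      have g1: "g n + 1 > 0" using g_pos[OF n1'] by simp
      have c1: "Pr \<omega> n \<epsilon> \<le> conc_bound lmax a n (p n) (g n) (B n) (\<epsilon> / 2)"
        if "\<epsilon> > 0" "linf_norm (\<gamma> n - \<beta>\<^sub>0 n) / (g n + 1) + 1 / sqrt (sqrt n) \<le> \<epsilon> / 2" for \<epsilon>
        unfolding Pn[OF that(1)] Bn
        by (rule T.Pr_le[OF _ that]) (use dev g1 in \<open>auto intro!: divide_right_mono\<close>)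
      have c2: "linf_norm (\<gamma> n - \<beta>\<^sub>0 n) / (g n + 1) \<le> 2 * \<epsilon> + 1 / sqrt (sqrt n)"
        if e: "\<epsilon> > 0" "Pr \<omega> n \<epsilon> + conc_bound lmax a n (p n) (g n) (B n) \<epsilon> < 1" for \<epsilon>
      proof -
        have "\<bar>T.dev i\<bar> \<le> (2 * \<epsilon> + 1 / sqrt (sqrt n)) * (g n + 1)" if "i < p n" for i
          using T.dev_le[OF e(1) _ that] e(2) g1 unfolding Pn[OF e(1)] Bn by (simp add: pos_divide_le_eq)
        then have "linf_norm (\<gamma> n - \<beta>\<^sub>0 n) \<le> (2 * \<epsilon> + 1 / sqrt (sqrt n)) * (g n + 1)"
          using e g1 bd gd by (subst linf_norm_le_iff) (auto simp: T.dev_def)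
        then show ?thesis using g1 by (simp add: pos_divide_le_eq)
      qed
      have c3: "1 - Pr \<omega> n \<epsilon> \<le> box_bound lmin a n (p n) (g n) (B n) \<epsilon>" if "\<epsilon> > 0" for \<epsilon>
        unfolding Pn[OF that] Bn by (rule T.Pr_ge[OF that])
      have "0 \<le> E n" unfolding E_def by (rule sum_nonneg) simp
      then show ?thesis
        using T.post_scale_pos good'(2) T.post_scale_le T.D2_le c1 c2 c3 unfolding D2n Bn by blast
    qed
    have "regime p g B (\<lambda>n. (l2_norm (\<gamma> n - \<beta>\<^sub>0 n))\<^sup>2) (\<lambda>n. linf_norm (\<gamma> n - \<beta>\<^sub>0 n)) E a b lmin lmax (Pr \<omega>) (max N N2)"
    proof (unfold_locales, goal_cases)
      case (6 n) then show ?case using p2[of n] by simp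
    next
      case (7 n) then show ?case using p_less[of n] n1[of n] by simp
    next
      case (8 n) then show ?case using g_pos[of n] n1[of n] by simp
    next
      case (18 n \<epsilon>) show ?case unfolding Pr_def posterior_linf_prob_def by (rule measure_nonneg)
    qed (use N4 a b lmin_pos lmax each linf_norm_nonneg in auto)
    then show ?thesis by blast
  qed
  show ?thesis
  proof
    assume L: "\<forall>\<epsilon>>0. AE \<omega> in M. (\<lambda>n. posterior_linf_prob (X n) (\<gamma> n) (g n) a b
        (ols (X n) (Y n \<omega>)) (rss (X n) (Y n \<omega>)) (\<beta>\<^sub>0 n) \<epsilon>) \<longlonglongrightarrow> 0"
    \<comment> \<open>Consistency provides a null set for each tolerance; countably many tolerances
      \<open>1 / Suc k\<close> give a common one.\<close>
    have "AE \<omega> in M. \<forall>k::nat. (\<lambda>n. Pr \<omega> n (1 / real (Suc k))) \<longlonglongrightarrow> 0"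
      using L unfolding Pr_def by (subst AE_all_countable) auto
    with AE1 AE2 AE_space have "AE \<omega> in M. ?C1 \<and> ?C2"
    proof eventually_elim
      case (elim \<omega>)
      then obtain B E N' where "regime p g B (\<lambda>n. (l2_norm (\<gamma> n - \<beta>\<^sub>0 n))\<^sup>2) (\<lambda>n. linf_norm (\<gamma> n - \<beta>\<^sub>0 n)) E a b lmin lmax (Pr \<omega>) N'"
        using reg by blast
      then interpret R: regime p g B "\<lambda>n. (l2_norm (\<gamma> n - \<beta>\<^sub>0 n))\<^sup>2" "\<lambda>n. linf_norm (\<gamma> n - \<beta>\<^sub>0 n)" E a b lmin lmax "Pr \<omega>" N' .
      have "\<And>k::nat. (\<lambda>n. Pr \<omega> n (1 / real (Suc k))) \<longlonglongrightarrow> 0" using elim by blast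
      from R.consistent_imp[OF this] show ?case ..
    qed
    \<comment> \<open>Both conditions are free of \<omega>, so in a probability space holding almost
      surely means holding.\<close>
    then show "?C1 \<and> ?C2" by (simp only: AE_const)
  next
    assume C: "?C1 \<and> ?C2"
    show "\<forall>\<epsilon>>0. AE \<omega> in M. (\<lambda>n. posterior_linf_prob (X n) (\<gamma> n) (g n) a b
        (ols (X n) (Y n \<omega>)) (rss (X n) (Y n \<omega>)) (\<beta>\<^sub>0 n) \<epsilon>) \<longlonglongrightarrow> 0"
    proof (intro allI impI)
      fix \<epsilon> :: real assume e: "\<epsilon> > 0"
      from AE1 AE2 AE_space have "AE \<omega> in M. (\<lambda>n. Pr \<omega> n \<epsilon>) \<longlonglongrightarrow> 0"
      proof eventually_elim
        case (elim \<omega>)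
        then obtain B E N' where "regime p g B (\<lambda>n. (l2_norm (\<gamma> n - \<beta>\<^sub>0 n))\<^sup>2) (\<lambda>n. linf_norm (\<gamma> n - \<beta>\<^sub>0 n)) E a b lmin lmax (Pr \<omega>) N'"
          using reg by blast
        then interpret R: regime p g B "\<lambda>n. (l2_norm (\<gamma> n - \<beta>\<^sub>0 n))\<^sup>2" "\<lambda>n. linf_norm (\<gamma> n - \<beta>\<^sub>0 n)" E a b lmin lmax "Pr \<omega>" N' .
        show ?case using R.consistent_if[OF _ _ e] C by blast
      qed
      then show "AE \<omega> in M. (\<lambda>n. posterior_linf_prob (X n) (\<gamma> n) (g n) a b
        (ols (X n) (Y n \<omega>)) (rss (X n) (Y n \<omega>)) (\<beta>\<^sub>0 n) \<epsilon>) \<longlonglongrightarrow> 0" unfolding Pr_def .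
    qed
  qed
qed

end
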